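(* Let $n\ge2$ and let $\mathcal C$ be the transversal intersection of $n$ smooth tropical hypersurfaces $X_1,\dots,X_n\subseteq\mathbb R^{n+1}$ of degrees $d_1,\dots,d_n$. If $\mathcal C$ is smooth and connected, then its genus $g$ satisfies $$2g-2=d_1\cdots d_n\,\bigl(d_1+\dots+d_n-(n+2)\bigr).$$
   Context: Over $(\mathbb R,\max,+)$, a tropical polynomial is $f(x)=\max_{a\in\mathcal A}\{\lambda_a+a\cdot x\}$, $\mathcal A\subseteq\mathbb Z^{m}$ finite, $\lambda_a\in\mathbb R$; Newton polytope $\Delta_f=\operatorname{conv}(\mathcal A)$; lifted polytope $\tilde\Delta_f=\operatorname{conv}\{(a,t):a\in\mathcal A,t\le\lambda_a\}$, whose bounded faces project to a regular lattice subdivision $\operatorname{Subdiv}(f)$ of $\Delta_f$. $V_{tr}(f)$ is the non-linear locus of $f$, a polyhedral complex of pure dimension $m-1$, with a bijection $C\mapsto C^\vee$ from $k$-cells of $V_{tr}(f)$ to $(m-k)$-cells of $\operatorname{Subdiv}(f)$, $C^\vee=\operatorname{conv}\{a:\lambda_a+a\cdot x=f(x)\}$ for $x$ in the relative interior of $C$. $V_{tr}(f)$ is smooth of degree $d$ if every maximal cell of $\operatorname{Subdiv}(f)$ is a lattice simplex of volume $1/m!$ and $\Delta_f=\Gamma^m_d:=\operatorname{conv}\{0,de_1,\dots,de_m\}$. For $X_i=V_{tr}(f_i)$, let $U=X_1\cup\dots\cup X_n=V_{tr}(f_1\odot\cdots\odot f_n)$ (the product polynomial has function $f_1+\dots+f_n$),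 and $\operatorname{Subdiv}_U=\operatorname{Subdiv}(f_1\odot\cdots\odot f_n)$. Each cell of $\operatorname{Subdiv}_U$ has a privileged representation $\Lambda=\Lambda_1+\dots+\Lambda_n$, $\Lambda_i\in\operatorname{Subdiv}(f_i)$, obtained by uniquely decomposing the corresponding bounded face of $\tilde\Delta_{f_1\odot\cdots\odot f_n}=\tilde\Delta_{f_1}+\dots+\tilde\Delta_{f_n}$. Each cell $C$ of $X_1\cap\dots\cap X_n$ is uniquely $C_1\cap\dots\cap C_n$ with $C_i$ a cell of $X_i$ containing $C$ in its relative interior, and $C^\vee\in\operatorname{Subdiv}_U$ has privileged representation $C_1^\vee+\dots+C_n^\vee$. The intersection is transversal if for all $J\subseteq\{1,\dots,n\}$, $|J|\ge2$, $\bigcap_{i\in J}X_i$ has dimension $m-|J|$ and every cell $C$ of it satisfies $\dim C^\vee=\sum_{i\in J}\dim C_i^\vee$ (duals w.r.t. $\bigcup_{i\in J}X_i$). Here $m=n+1$; $\mathcal C$ is a one-dimensional polyhedral complex some of whose edges are unbounded. The intersection multiplicity at a vertex $P$ of $\mathcal C$ is $m_P=2\operatorname{vol}_{n+1}(P^\vee)$, $P^\vee\in\operatorname{Subdiv}_U$; $\mathcal C$ is smooth if $m_P=1$ at every vertex. The genus of $\mathcal C$ is its first Betti number (number of independent cycles). *)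

theory Defs
  imports "HOL-Analysis.Analysis"
begin

text \<open>Ambient space R^m is real^'m (m = CARD('m)). Exponent vectors are lattice points of real^'m.
A tropical polynomial is given by its finite support A and coefficient function lam.\<close>

definition lattice_pt :: "real^'m \<Rightarrow> bool" where
  "lattice_pt a \<longleftrightarrow> (\<forall>i. a $ i \<in> \<int>)"

definition is_tpoly :: "(real^'m) set \<Rightarrow> bool" where
  "is_tpoly A \<longleftrightarrow> finite A \<and> A \<noteq> {} \<and> (\<forall>a\<in>A. lattice_pt a)"

text \<open>f(x) = max_{a in A} (lam a + a . x)\<close>
definition teval :: "(real^'m) set \<Rightarrow> (real^'m \<Rightarrow> real) \<Rightarrow> real^'m \<Rightarrow> real" where
  "teval A lam x = Max ((\<lambda>a. lam a + a \<bullet> x) ` A)"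

text \<open>monomials attaining the maximum at x\<close>
definition active :: "(real^'m) set \<Rightarrow> (real^'m \<Rightarrow> real) \<Rightarrow> real^'m \<Rightarrow> (real^'m) set" where
  "active A lam x = {a \<in> A. lam a + a \<bullet> x = teval A lam x}"

text \<open>V_tr(f): non-linear locus (maximum attained by at least two monomials)\<close>
definition Vtr :: "(real^'m) set \<Rightarrow> (real^'m \<Rightarrow> real) \<Rightarrow> (real^'m) set" where
  "Vtr A lam = {x. \<exists>a\<in>active A lam x. \<exists>b\<in>active A lam x. a \<noteq> b}"

text \<open>Cells of Subdiv(f): projections of bounded faces of the lifted polytope, i.e. conv of the
active monomials at some point x.\<close>
definition subdiv_cells :: "(real^'m) set \<Rightarrow> (real^'m \<Rightarrow> real) \<Rightarrow> (real^'m) set set" where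
  "subdiv_cells A lam = {convex hull (active A lam x) | x. True}"

definition lattice_simplex :: "int \<Rightarrow> (real^'m) set \<Rightarrow> bool" where
  "lattice_simplex k S \<longleftrightarrow> (\<exists>C. \<not> affine_dependent C \<and> int (card C) = k + 1 \<and>
       S = convex hull C \<and> (\<forall>c\<in>C. lattice_pt c))"

text \<open>Gamma^m_d = conv{0, d e_1, ..., d e_m}\<close>
definition std_simplex :: "nat \<Rightarrow> (real^'m) set" where
  "std_simplex d = convex hull (insert 0 ((\<lambda>i. real d *\<^sub>R axis i 1) ` UNIV))"

definition smooth_hyp :: "(real^'m) set \<Rightarrow> (real^'m \<Rightarrow> real) \<Rightarrow> nat \<Rightarrow> bool" where
  "smooth_hyp A lam d \<longleftrightarrow> is_tpoly A \<and> convex hull A = std_simplex d \<and>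
     (\<forall>L\<in>subdiv_cells A lam. (\<not> (\<exists>L'\<in>subdiv_cells A lam. L \<subset> L')) \<longrightarrow>
         (\<exists>k. lattice_simplex k L) \<and> measure lebesgue L = 1 / fact CARD('m))"

text \<open>Tropical product f_J = odot_{i in J} f_i: monomials sum_i a_i, coefficient of b is the
maximum of sum_i lam_i(a_i) over representations b = sum_i a_i.\<close>
definition tprodA :: "nat set \<Rightarrow> (nat \<Rightarrow> (real^'m) set) \<Rightarrow> (real^'m) set" where
  "tprodA J A = {(\<Sum>i\<in>J. g i) | g. \<forall>i\<in>J. g i \<in> A i}"

definition tprodL :: "nat set \<Rightarrow> (nat \<Rightarrow> (real^'m) set) \<Rightarrow> (nat \<Rightarrow> real^'m \<Rightarrow> real) \<Rightarrow> real^'m \<Rightarrow> real" where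
  "tprodL J A lam b = Max {(\<Sum>i\<in>J. lam i (g i)) | g. (\<forall>i\<in>J. g i \<in> A i) \<and> (\<Sum>i\<in>J. g i) = b}"

text \<open>intersection of the X_i, i in J\<close>
definition inter_hyp :: "nat set \<Rightarrow> (nat \<Rightarrow> (real^'m) set) \<Rightarrow> (nat \<Rightarrow> real^'m \<Rightarrow> real) \<Rightarrow> (real^'m) set" where
  "inter_hyp J A lam = (\<Inter>i\<in>J. Vtr (A i) (lam i))"

text \<open>The relatively open cell (relative interior of C_1 cap ... cap C_n) of the intersection
containing x: points where every f_i, i in J, has the same active monomials as at x, i.e. lying in
the relative interiors of the same cells C_i.\<close>
definition stratum :: "nat set \<Rightarrow> (nat \<Rightarrow> (real^'m) set) \<Rightarrow> (nat \<Rightarrow> real^'m \<Rightarrow> real) \<Rightarrow> real^'m \<Rightarrow> (real^'m) set" where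
  "stratum J A lam x = {y. \<forall>i\<in>J. active (A i) (lam i) y = active (A i) (lam i) x}"

definition transversal :: "nat \<Rightarrow> (nat \<Rightarrow> (real^'m) set) \<Rightarrow> (nat \<Rightarrow> real^'m \<Rightarrow> real) \<Rightarrow> bool" where
  "transversal n A lam \<longleftrightarrow> (\<forall>J \<subseteq> {..<n}. card J \<ge> 2 \<longrightarrow>
     (\<exists>x\<in>inter_hyp J A lam. aff_dim (stratum J A lam x) = int CARD('m) - int (card J)) \<and>
     (\<forall>x\<in>inter_hyp J A lam. aff_dim (stratum J A lam x) \<le> int CARD('m) - int (card J)) \<and>
     (\<forall>x\<in>inter_hyp J A lam.
        aff_dim (convex hull (active (tprodA J A) (tprodL J A lam) x)) =
        (\<Sum>i\<in>J. aff_dim (convex hull (active (A i) (lam i) x)))))"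

text \<open>The curve C = X_1 cap ... cap X_n, its vertices and its bounded edges (as open cells).\<close>
definition curve :: "nat \<Rightarrow> (nat \<Rightarrow> (real^'m) set) \<Rightarrow> (nat \<Rightarrow> real^'m \<Rightarrow> real) \<Rightarrow> (real^'m) set" where
  "curve n A lam = inter_hyp {..<n} A lam"

definition curve_vertices :: "nat \<Rightarrow> (nat \<Rightarrow> (real^'m) set) \<Rightarrow> (nat \<Rightarrow> real^'m \<Rightarrow> real) \<Rightarrow> (real^'m) set" where
  "curve_vertices n A lam = {x \<in> curve n A lam. stratum {..<n} A lam x = {x}}"

definition curve_bounded_edges :: "nat \<Rightarrow> (nat \<Rightarrow> (real^'m) set) \<Rightarrow> (nat \<Rightarrow> real^'m \<Rightarrow> real) \<Rightarrow> (real^'m) set set" where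
  "curve_bounded_edges n A lam = {stratum {..<n} A lam x | x. x \<in> curve n A lam \<and>
      aff_dim (stratum {..<n} A lam x) = 1 \<and> bounded (stratum {..<n} A lam x)}"

text \<open>Genus = first Betti number = cyclomatic number E - V + (number of connected components) of the
graph formed by the vertices and bounded edges (unbounded edges do not contribute cycles).\<close>
definition curve_adj :: "nat \<Rightarrow> (nat \<Rightarrow> (real^'m) set) \<Rightarrow> (nat \<Rightarrow> real^'m \<Rightarrow> real) \<Rightarrow> ((real^'m) \<times> (real^'m)) set" where
  "curve_adj n A lam = {(v, w). v \<in> curve_vertices n A lam \<and> w \<in> curve_vertices n A lam \<and>
      (\<exists>e\<in>curve_bounded_edges n A lam. v \<in> closure e \<and> w \<in> closure e)}"

definition genus :: "nat \<Rightarrow> (nat \<Rightarrow> (real^'m) set) \<Rightarrow> (nat \<Rightarrow> real^'m \<Rightarrow> real) \<Rightarrow> int" where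
  "genus n A lam = int (card (curve_bounded_edges n A lam)) - int (card (curve_vertices n A lam))
      + int (card (curve_vertices n A lam // ((curve_adj n A lam)\<^sup>*)))"

text \<open>m_P = 2 vol_{n+1}(P^dual), P^dual the cell of Subdiv_U dual to P.\<close>
definition int_mult :: "nat \<Rightarrow> (nat \<Rightarrow> (real^'m) set) \<Rightarrow> (nat \<Rightarrow> real^'m \<Rightarrow> real) \<Rightarrow> real^'m \<Rightarrow> real" where
  "int_mult n A lam P = 2 * measure lebesgue (convex hull (active (tprodA {..<n} A) (tprodL {..<n} A lam) P))"

definition smooth_curve :: "nat \<Rightarrow> (nat \<Rightarrow> (real^'m) set) \<Rightarrow> (nat \<Rightarrow> real^'m \<Rightarrow> real) \<Rightarrow> bool" where
  "smooth_curve n A lam \<longleftrightarrow> (\<forall>P\<in>curve_vertices n A lam. int_mult n A lam P = 1)"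

end

theory Submission
  imports Defs
begin

text \<open>The curve is a graph in which every vertex has exactly three edges: transversality forces one
  of the \<open>n\<close> dual cells at a vertex to be a triangle and the others to be segments. Counting flags
  gives \<open>3 V = 2 E + U\<close> with \<open>E\<close> bounded and \<open>U\<close> unbounded edges, hence \<open>2 g - 2 = V - U\<close> when
  the curve is connected.

  The dual cells of a tropical polynomial tile its Newton polytope, so an alternating sum of the
  volumes of the Newton polytopes of the subproducts of a family counts the mixed cells of the
  whole family. For the given hypersurfaces these cells have volume \<open>1/2\<close> and belong to the vertices,
  and polarization of \<open>t ^ (n + 1)\<close> gives \<open>V = D (d_1 + ... + d_n)\<close> with \<open>D = d_1 ... d_n\<close>. The
  unbounded edges have the directions \<open>(1, ..., 1)\<close> and \<open>- e_j\<close>; adding a tropical hyperplane far away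
  that only meets those of one direction, each with index one, gives \<open>D\<close> edges for each of these
  \<open>n + 2\<close> directions.\<close>

subsection \<open>Polarization\<close>

text \<open>Dual cells are indexed by points of space instead of by polytopes; only the finitely
  many points whose dual cell has positive volume matter. The two counts differ only in the number
  of polynomials: with \<open>n\<close> of them in dimension \<open>n + 1\<close> the exponent
  exceeds their number by one, which produces the factor (d_1 + ... + d_n) / 2; with the additional
  hyperplane the two numbers agree and only the product of the degrees remains. To cut the curve
  with x_j = c, the natural choice is a polynomial with Newton polytope [0, e_j], but sums of this
  segment with simplices have no convenient volume. A polynomial of degree one whose other
  coefficients are sufficiently negative has the unit simplex as Newton polytope and looks the same
  on the curve. Each crossing counts with a determinant. It is 1 or -1 because a smooth vertex makes
  the dual segments of its edges part of a lattice basis, and because the primitive vectors (1, ...,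
  1) and - e_j have \<open>j\<close>-th coordinate 1 or -1.\<close>

lemma alternating_sum_Pow_insert:
  fixes F :: "'i set \<Rightarrow> real"
  assumes "finite I" "a \<notin> I"
  shows "(\<Sum>S\<in>Pow (insert a I). (-1) ^ card (insert a I - S) * F S) =
    (\<Sum>S\<in>Pow I. (-1) ^ card (I - S) * (F (insert a S) - F S))"
proof -
  have inj: "inj_on (insert a) (Pow I)"
    using assms by (auto simp: inj_on_def)
  have "(\<Sum>S\<in>Pow (insert a I). (-1) ^ card (insert a I - S) * F S) =
     (\<Sum>S\<in>Pow I. (-1) ^ card (insert a I - S) * F S) +
     (\<Sum>S\<in>insert a ` Pow I. (-1) ^ card (insert a I - S) * F S)"
    unfolding Pow_insert by (rule sum.union_disjoint) (use assms in auto)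
  also have "(\<Sum>S\<in>Pow I. (-1) ^ card (insert a I - S) * F S) =
     (\<Sum>S\<in>Pow I. - ((-1) ^ card (I - S) * F S))"
  proof (rule sum.cong[OF refl])
    fix S assume "S \<in> Pow I"
    then have "insert a I - S = insert a (I - S)" "a \<notin> I - S" "finite (I - S)"
      using assms by auto
    then have "card (insert a I - S) = Suc (card (I - S))" by (metis card_insert_disjoint)
    then show "(-1) ^ card (insert a I - S) * F S = - ((-1) ^ card (I - S) * F S)"
      by simp
  qed
  also have "(\<Sum>S\<in>insert a ` Pow I. (-1) ^ card (insert a I - S) * F S) =
     (\<Sum>S\<in>Pow I. (-1) ^ card (I - S) * F (insert a S))"
  proof (subst sum.reindex[OF inj], rule sum.cong[OF refl])
    fix S assume "S \<in> Pow I"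
    then have "insert a I - insert a S = I - S"
      using assms by auto
    then show "((\<lambda>S. (-1) ^ card (insert a I - S) * F S) \<circ> insert a) S =
        (-1) ^ card (I - S) * F (insert a S)"
      by simp
  qed
  finally show ?thesis
    by (simp add: algebra_simps sum.distrib sum_subtractf sum_negf)
qed

text \<open>The alternating sum is a \<open>card I\<close>-fold iterated finite difference at 0 of
  the \<open>k\<close>-th power, with steps \<open>d i\<close>, and each difference lowers the
  degree by one. The three claims go through one induction because the power
  \<open>card I + 1\<close> for a larger index set draws on the two lower powers for the smaller
  one.\<close>

lemma polarization_all:
  fixes d :: "'i \<Rightarrow> real"
  assumes "finite I"
  shows "k < card I \<Longrightarrow> (\<Sum>S\<in>Pow I. (-1) ^ card (I - S) * (sum d S) ^ k) = 0"
    and "(\<Sum>S\<in>Pow I. (-1) ^ card (I - S) * (sum d S) ^ card I) = fact (card I) * prod d I"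
    and "(\<Sum>S\<in>Pow I. (-1) ^ card (I - S) * (sum d S) ^ Suc (card I)) =
      fact (Suc (card I)) / 2 * prod d I * sum d I"
  using assms
proof (induction I arbitrary: k rule: finite_induct)
  case empty
  { case 1 then show ?case by simp }
  { case 2 then show ?case by simp }
  { case 3 then show ?case by simp }
next
  case (insert a I)
  define G where "G l = (\<Sum>S\<in>Pow I. (-1) ^ card (I - S) * (sum d S) ^ l)" for l
  \<comment> \<open>Pairing \<open>S\<close> with \<open>insert a S\<close> leaves (d a + s)^k -
    s^k, whose binomial expansion lacks its top term.\<close>
  have step: "(\<Sum>S\<in>Pow (insert a I). (-1) ^ card (insert a I - S) * (sum d S) ^ k) =
      (\<Sum>l<k. of_nat (k choose l) * d a ^ (k - l) * G l)" for k
  proof -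
    have diff: "(d a + s) ^ k - s ^ k = (\<Sum>l<k. of_nat (k choose l) * d a ^ (k - l) * s ^ l)" for s
    proof -
      have "(d a + s) ^ k = (s + d a) ^ k" by (simp add: add.commute)
      also have "\<dots> = (\<Sum>l\<le>k. of_nat (k choose l) * s ^ l * d a ^ (k - l))"
        by (rule binomial_ring)
      also have "{..k} = insert k {..<k}" by auto
      finally show ?thesis by (simp add: mult_ac)
    qed
    have "(\<Sum>S\<in>Pow (insert a I). (-1) ^ card (insert a I - S) * (sum d S) ^ k) =
        (\<Sum>S\<in>Pow I. (-1) ^ card (I - S) * ((d a + sum d S) ^ k - (sum d S) ^ k))"
      unfolding alternating_sum_Pow_insert[OF insert.hyps]
    proof (intro sum.cong refl)
      fix S assume "S \<in> Pow I"
      then have "finite S" "a \<notin> S" using insert.hyps by (auto intro: finite_subset)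
      then show "(-1) ^ card (I - S) * (sum d (insert a S) ^ k - sum d S ^ k) =
          (-1) ^ card (I - S) * ((d a + sum d S) ^ k - sum d S ^ k)" by simp
    qed
    also have "\<dots> = (\<Sum>l<k. of_nat (k choose l) * d a ^ (k - l) * G l)"
      unfolding diff G_def sum_distrib_left
      by (subst sum.swap) (simp add: mult_ac)
    finally show ?thesis .
  qed
  have G0: "G l = 0" if "l < card I" for l
    using insert.IH(1)[OF that] by (simp add: G_def)
  have G1: "G (card I) = fact (card I) * prod d I"
    using insert.IH(2) by (simp add: G_def)
  have G2: "G (Suc (card I)) = fact (Suc (card I)) / 2 * prod d I * sum d I"
    using insert.IH(3) by (simp add: G_def)
  have c: "card (insert a I) = Suc (card I)" using insert.hyps by simp
  { case 1
    then show ?case unfolding step using c by (intro sum.neutral) (auto simp: G0) }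
  { case 2
    have "{..<Suc (card I)} = insert (card I) {..<card I}" by auto
    then show ?case unfolding step c using insert.hyps
      by (simp add: G0 G1 algebra_simps) }
  { case 3
    \<comment> \<open>Of the powers below \<open>card I + 2\<close> only the two highest survive, by
      \<open>G0\<close>; their weights are the binomial coefficients at \<open>card I + 1\<close>
      and \<open>card I\<close>.\<close>
    have e: "{..<Suc (Suc (card I))} = insert (Suc (card I)) (insert (card I) {..<card I})" by auto
    have ch: "real (Suc (Suc (card I)) choose card I) = real (Suc (Suc (card I))) * real (Suc (card I)) / 2"
    proof -
      have "2 * (Suc (Suc (card I)) choose card I) = Suc (Suc (card I)) * Suc (card I)"
        using binomial_symmetric[of "card I" "Suc (Suc (card I))"]
        by (induction ("card I")) (simp_all add: numeral_2_eq_2)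
      then have "2 * real (Suc (Suc (card I)) choose card I) = real (Suc (Suc (card I))) * real (Suc (card I))"
        by (metis of_nat_mult of_nat_numeral)
      then show ?thesis by simp
    qed
    show ?case unfolding step c e using insert.hyps
      by (simp add: G0 G1 G2 ch field_simps power2_eq_square) }
qed

subsection \<open>Volumes of linear images\<close>

text \<open>The change of variables formula of the library needs a well-ordered index type; this
  one has the cardinality of a given finite type.\<close>

typedef ('m::finite) widx = "{..<CARD('m)}"
  by (rule exI[of _ 0]) simp

instance widx :: (finite) finite
proof
  have "(UNIV :: 'a widx set) = Abs_widx ` {..<CARD('a)}"
    by (metis type_definition.Abs_image type_definition_widx)
  then show "finite (UNIV :: 'a widx set)" by (metis finite_imageI finite_lessThan)
qed

lemma card_widx [simp]: "CARD('m::finite widx) = CARD('m)"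
  by (simp add: type_definition.card[OF type_definition_widx])

instantiation widx :: (finite) linorder
begin

definition "x \<le> y \<longleftrightarrow> Rep_widx x \<le> Rep_widx y"
definition "x < y \<longleftrightarrow> Rep_widx x < Rep_widx y"

instance
  by intro_classes (auto simp: less_eq_widx_def less_widx_def Rep_widx_inject)

end

instance widx :: (finite) wellorder
proof -
  have "{(x, y :: 'a widx). x < y} = inv_image less_than Rep_widx"
    by (auto simp: less_widx_def)
  then have "wf {(x, y :: 'a widx). x < y}" by simp
  then show "OFCLASS('a widx, wellorder_class)"
    by (rule wf_wellorderI) intro_classes
qed

lemma Rep_widx_cases:
  assumes "i < CARD('m)"
  obtains k :: "'m::finite widx" where "i = Rep_widx k"
  using assms by (metis Abs_widx_inverse lessThan_iff)

lemma bij_betw_Rep_widx: "bij_betw Rep_widx (UNIV :: 'm::finite widx set) {..<CARD('m)}"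
  by (metis bij_betw_imageI inj_on_def Rep_widx_inject type_definition.Rep_range type_definition_widx)

definition widx_bij :: "'m::finite widx \<Rightarrow> 'm" where
  "widx_bij = (SOME f. bij f)"

lemma bij_widx_bij: "bij (widx_bij :: 'm::finite widx \<Rightarrow> 'm)"
proof -
  have "\<exists>f. bij_betw f (UNIV :: 'm widx set) (UNIV :: 'm set)"
    by (rule finite_same_card_bij) auto
  then show ?thesis unfolding widx_bij_def by (rule someI_ex)
qed

definition reidx :: "real^'m \<Rightarrow> real^('m::finite widx)" where
  "reidx x = (\<chi> k. x $ widx_bij k)"

lemma reidx_nth [simp]: "reidx x $ k = x $ widx_bij k"
  by (simp add: reidx_def)

lemma linear_reidx: "linear reidx"
  by (rule linearI) (simp_all add: vec_eq_iff)

lemma inner_reidx [simp]: "reidx x \<bullet> reidx y = x \<bullet> y"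
  by (simp add: inner_vec_def sum.reindex_bij_betw[OF bij_widx_bij, of "\<lambda>k. x $ k * y $ k"])

lemma bij_reidx: "bij (reidx :: real^'m \<Rightarrow> _)"
proof (rule o_bij)
  let ?g = "\<lambda>y::real^'m widx. (\<chi> i. y $ inv widx_bij i) :: real^'m"
  show "?g \<circ> reidx = id"
    by (auto simp: fun_eq_iff vec_eq_iff bij_is_surj[OF bij_widx_bij] surj_f_inv_f)
  show "reidx \<circ> ?g = id"
    by (auto simp: fun_eq_iff vec_eq_iff bij_is_inj[OF bij_widx_bij])
qed

lemma prod_Basis_cart: "(\<Prod>b\<in>Basis. (v::real^'n) \<bullet> b) = (\<Prod>i\<in>UNIV. v $ i)"
proof -
  have Basis: "(Basis :: (real^'n) set) = range (\<lambda>i. axis i 1)" by (auto simp: Basis_vec_def)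
  have "inj (\<lambda>i. axis i 1 :: real^'n)" by (auto simp: inj_def axis_eq_axis)
  then show ?thesis unfolding Basis by (subst prod.reindex) (simp_all add: inner_axis)
qed

text \<open>Lebesgue measure is determined by its values on boxes, and permuting coordinates maps a
  box to a box with the same side lengths.\<close>

lemma measure_reidx:
  fixes S :: "(real^'m) set"
  assumes "compact S"
  shows "measure lebesgue (reidx ` S) = measure lebesgue S"
proof -
  let ?g = "inv reidx :: real^'m widx \<Rightarrow> real^'m"
  have surj: "surj (reidx :: real^'m \<Rightarrow> _)" and inj: "inj (reidx :: real^'m \<Rightarrow> _)"
    using bij_reidx bij_is_surj bij_is_inj by blast+
  have ling: "linear ?g"
  proof (rule linearI)
    fix x y :: "real^'m widx" and c :: real
    obtain x' y' where xy: "x = reidx x'" "y = reidx y'" using surj by (metis surjD)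
    show "?g (x + y) = ?g x + ?g y"
      unfolding xy linear_add[OF linear_reidx, symmetric] by (simp add: inv_f_f[OF inj])
    show "?g (c *\<^sub>R x) = c *\<^sub>R ?g x"
      unfolding xy linear_scale[OF linear_reidx, symmetric] by (simp add: inv_f_f[OF inj])
  qed
  have meas [measurable]: "?g \<in> borel_measurable borel"
    by (intro borel_measurable_continuous_onI linear_continuous_on linear_conv_bounded_linear[THEN iffD1] ling)
  have vim: "?g -` T = reidx ` T" for T
    by (metis bij_reidx bij_vimage_eq_inv_image inv_inv_eq bij_imp_bij_inv)
  have "lborel = distr lborel borel ?g"
  proof (rule lborel_eqI)
    fix l u :: "real^'m" assume lu: "\<And>b. b \<in> Basis \<Longrightarrow> l \<bullet> b \<le> u \<bullet> b"
    have im: "reidx ` box l u = box (reidx l) (reidx u)"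
    proof -
      have "reidx x \<in> box (reidx l) (reidx u) \<longleftrightarrow> x \<in> box l u" for x
        using bij_is_surj[OF bij_widx_bij[where 'm='m]]
        unfolding mem_box_cart reidx_nth by (metis surjD)
      then show ?thesis using surj by (auto simp: image_iff) (metis surjD)
    qed
    have "emeasure (distr lborel borel ?g) (box l u) = emeasure lborel (?g -` box l u)"
      by (subst emeasure_distr) auto
    also have "\<dots> = emeasure lborel (box (reidx l) (reidx u))"
      by (simp add: vim im)
    also have "\<dots> = (\<Prod>b\<in>Basis. (reidx u - reidx l) \<bullet> b)"
    proof (rule emeasure_lborel_box)
      fix b :: "real^'m widx" assume "b \<in> Basis"
      then obtain k where "b = axis k 1" by (auto simp: Basis_vec_def)
      then show "reidx l \<bullet> b \<le> reidx u \<bullet> b"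
        using lu[of "axis (widx_bij k) 1"] by (auto simp: inner_axis Basis_vec_def)
    qed
    also have "(\<Prod>b\<in>Basis. (reidx u - reidx l) \<bullet> b) = (\<Prod>b\<in>Basis. (u - l) \<bullet> b)"
    proof -
      show ?thesis
        unfolding prod_Basis_cart using prod.reindex_bij_betw[OF bij_widx_bij, of "\<lambda>i. (u - l) $ i"] by simp
    qed
    finally show "emeasure (distr lborel borel ?g) (box l u) = ennreal (\<Prod>b\<in>Basis. (u - l) \<bullet> b)" .
  qed simp
  then have "emeasure lborel S = emeasure (distr lborel borel ?g) S" by simp
  also have "\<dots> = emeasure lborel (reidx ` S)"
    using assms by (subst emeasure_distr) (auto simp: vim borel_compact)
  finally have "measure lborel (reidx ` S) = measure lborel S"
    by (simp add: measure_def)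
  moreover have "compact (reidx ` S)"
    using assms by (intro compact_continuous_image linear_continuous_on linear_conv_bounded_linear[THEN iffD1] linear_reidx)
  ultimately show ?thesis
    using assms by (simp add: borel_compact measure_completion)
qed

text \<open>The determinant of the vectors \<open>v 0, ..., v (m - 1)\<close>, up to a sign that depends on
  the enumeration of the coordinates.\<close>

definition vdet :: "(nat \<Rightarrow> real^'m) \<Rightarrow> real" where
  "vdet v = det (\<chi> k::'m widx. reidx (v (Rep_widx k)))"

text \<open>Followed by the volume preserving \<open>reidx\<close>, the map becomes multiplication
  by a square matrix, to which the determinant formula applies.\<close>

lemma measure_lincomb_image:
  fixes v :: "nat \<Rightarrow> real^'m" and S :: "(real^'m widx) set"
  assumes "compact S"
  shows "measure lebesgue ((\<lambda>s. \<Sum>k\<in>UNIV. s $ k *\<^sub>R v (Rep_widx k)) ` S) = \<bar>vdet v\<bar> * measure lebesgue S"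
proof -
  define N where "N = (\<chi> k::'m widx. reidx (v (Rep_widx k)))"
  let ?f = "\<lambda>s :: real^'m widx. \<Sum>k\<in>UNIV. s $ k *\<^sub>R v (Rep_widx k)"
  have lin: "linear ?f"
    by (rule linearI) (simp_all add: algebra_simps sum.distrib scaleR_sum_right)
  have eq: "reidx (?f s) = transpose N *v s" for s
    unfolding linear_sum[OF linear_reidx] matrix_mult_sum
    by (simp add: N_def linear_scale[OF linear_reidx] column_transpose row_def vec_eq_iff scalar_mult_eq_scaleR)
  have "measure lebesgue (?f ` S) = measure lebesgue (reidx ` ?f ` S)"
    using assms by (intro measure_reidx[symmetric] compact_continuous_image
        linear_continuous_on linear_conv_bounded_linear[THEN iffD1] lin)
  also have "reidx ` ?f ` S = (*v) (transpose N) ` S"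
    by (simp add: image_image eq)
  also have "measure lebesgue \<dots> = \<bar>det (matrix ((*v) (transpose N)))\<bar> * measure lebesgue S"
    by (rule measure_linear_image) (auto simp: assms lmeasurable_compact)
  finally show ?thesis by (simp add: N_def vdet_def det_transpose)
qed

lemma sum_Rep_widx: "(\<Sum>k\<in>(UNIV::'m::finite widx set). f (Rep_widx k)) = (\<Sum>i<CARD('m). f i)"
  by (rule sum.reindex_bij_betw[OF bij_betw_Rep_widx])

lemma measure_parallelepiped:
  fixes v :: "nat \<Rightarrow> real^'m"
  shows "measure lebesgue {(\<Sum>i<CARD('m). s i *\<^sub>R v i) | s. \<forall>i<CARD('m). 0 \<le> s i \<and> s i \<le> 1} = \<bar>vdet v\<bar>"
proof -
  let ?C = "cbox 0 1 :: (real^'m widx) set"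
  have "{(\<Sum>i<CARD('m). s i *\<^sub>R v i) | s. \<forall>i<CARD('m). 0 \<le> s i \<and> s i \<le> 1} =
      (\<lambda>s. \<Sum>k\<in>UNIV. s $ k *\<^sub>R v (Rep_widx k)) ` ?C" (is "?L = ?R")
  proof safe
    fix s :: "nat \<Rightarrow> real" assume s: "\<forall>i<CARD('m). 0 \<le> s i \<and> s i \<le> 1"
    have "(\<Sum>i<CARD('m). s i *\<^sub>R v i) = (\<Sum>k\<in>(UNIV::'m widx set). (\<chi> k. s (Rep_widx k)) $ k *\<^sub>R v (Rep_widx k))"
      by (simp add: sum_Rep_widx[symmetric])
    moreover have "(\<chi> k. s (Rep_widx k)) \<in> ?C"
      using s Rep_widx by (auto simp: mem_box_cart)
    ultimately show "(\<Sum>i<CARD('m). s i *\<^sub>R v i) \<in> ?R" by blast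
  next
    fix s :: "real^'m widx" assume s: "s \<in> ?C"
    have "(\<Sum>k\<in>UNIV. s $ k *\<^sub>R v (Rep_widx k)) = (\<Sum>k\<in>(UNIV::'m widx set). s $ Abs_widx (Rep_widx k) *\<^sub>R v (Rep_widx k))"
      by (simp add: Rep_widx_inverse)
    also have "\<dots> = (\<Sum>i<CARD('m). s $ (Abs_widx i) *\<^sub>R v i)"
      by (rule sum_Rep_widx)
    finally show "\<exists>t. (\<Sum>k\<in>UNIV. s $ k *\<^sub>R v (Rep_widx k)) = (\<Sum>i<CARD('m). t i *\<^sub>R v i) \<and>
        (\<forall>i<CARD('m). 0 \<le> t i \<and> t i \<le> 1)"
      using s by (intro exI[of _ "\<lambda>i. s $ (Abs_widx i)"]) (auto simp: mem_box_cart)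
  qed
  moreover have "measure lebesgue ?C = 1"
  proof -
    have "?C \<noteq> {}" by (simp add: interval_ne_empty_cart)
    then show ?thesis by (simp add: content_cbox_cart)
  qed
  ultimately show ?thesis by (simp add: measure_lincomb_image)
qed

lemma measure_unit_simplex_image:
  fixes v :: "nat \<Rightarrow> real^'m"
  shows "measure lebesgue (convex hull (insert 0 (v ` {..<CARD('m)}))) = \<bar>vdet v\<bar> / fact CARD('m)"
proof -
  let ?S = "convex hull (insert 0 Basis) :: (real^'m widx) set"
  let ?f = "\<lambda>s :: real^'m widx. \<Sum>k\<in>UNIV. s $ k *\<^sub>R v (Rep_widx k)"
  have cpt: "compact ?S" by (intro finite_imp_compact_convex_hull) auto
  have lin: "linear ?f"
    by (rule linearI) (simp_all add: algebra_simps sum.distrib scaleR_sum_right)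
  have ax: "?f (axis k 1) = v (Rep_widx k)" for k
    by (simp add: axis_def if_distrib[of "\<lambda>c. c *\<^sub>R _"] sum.delta cong: if_cong)
  have "range (\<lambda>k::'m widx. v (Rep_widx k)) = v ` {..<CARD('m)}"
    using bij_betw_Rep_widx[where 'm='m] by (metis bij_betw_def image_image)
  moreover have "?f ` Basis = range (\<lambda>k::'m widx. v (Rep_widx k))"
  proof -
    have Basis: "(Basis :: (real^'m widx) set) = range (\<lambda>k. axis k 1)" by (auto simp: Basis_vec_def)
    show ?thesis unfolding Basis image_image ax ..
  qed
  ultimately have "?f ` (insert 0 Basis) = insert 0 (v ` {..<CARD('m)})"
    using linear_0[OF lin] by simp
  then have "?f ` ?S = convex hull (insert 0 (v ` {..<CARD('m)}))"
    using convex_hull_linear_image[OF lin, of "insert 0 Basis"] by simp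
  moreover have "measure lebesgue ?S = 1 / fact CARD('m)"
    using content_std_simplex[where 'a="real^'m widx"] cpt
    by (simp add: measure_completion borel_compact)
  ultimately show ?thesis
    using measure_lincomb_image[OF cpt, of v] by simp
qed

lemma vdet_Ints:
  fixes v :: "nat \<Rightarrow> real^'m"
  assumes "\<And>i. i < CARD('m) \<Longrightarrow> lattice_pt (v i)"
  shows "vdet v \<in> \<int>"
  unfolding vdet_def det_def
  using assms Rep_widx
  by (intro Ints_sum Ints_mult Ints_prod) (auto simp: lattice_pt_def)

text \<open>The hypothesis says that the matrix with rows \<open>v i\<close> has trivial kernel.
  Orthogonality is the form in which independence is obtained from the dual cell of a
  vertex.\<close>

lemma vdet_nonzero:
  fixes v :: "nat \<Rightarrow> real^'m"
  assumes "\<And>w. (\<And>i. i < CARD('m) \<Longrightarrow> v i \<bullet> w = 0) \<Longrightarrow> w = 0"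
  shows "vdet v \<noteq> 0"
proof -
  let ?N = "\<chi> k::'m widx. reidx (v (Rep_widx k))"
  have "\<exists>B. B ** ?N = mat 1"
  proof (subst matrix_left_invertible_ker, intro allI impI)
    fix x assume x: "?N *v x = 0"
    obtain w where w: "x = reidx w" using bij_is_surj[OF bij_reidx] by (metis surjD)
    have "v i \<bullet> w = 0" if i: "i < CARD('m)" for i
    proof -
      obtain k :: "'m widx" where "i = Rep_widx k"
        using i Rep_widx_cases by blast
      moreover have "(?N *v x) $ k = v (Rep_widx k) \<bullet> w"
        by (simp add: matrix_vector_mul_component w)
      ultimately show ?thesis using x by simp
    qed
    then have "w = 0" by (rule assms)
    then show "x = 0" using w linear_0[OF linear_reidx] by simp
  qed
  then show ?thesis
    unfolding vdet_def by (simp add: invertible_det_nz[symmetric] invertible_left_inverse)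
qed

text \<open>Linearity in one row, and invariance under adding combinations of the other rows. In the
  applications \<open>c\<close> is a barycentric coordinate or a lattice index.\<close>

lemma vdet_upd_scale_span:
  fixes v :: "nat \<Rightarrow> real^'m"
  assumes i: "i < CARD('m)" and x: "x \<in> span (v ` ({..<CARD('m)} - {i}))"
  shows "vdet (v(i := c *\<^sub>R w + x)) = c * vdet (v(i := w))"
proof -
  obtain k :: "'m widx" where k: "i = Rep_widx k"
    using i Rep_widx_cases by blast
  have m: "(\<chi> l::'m widx. reidx ((v(i := y)) (Rep_widx l))) =
     (\<chi> l. if l = k then reidx y else reidx (v (Rep_widx l)))" for y
    by (auto simp: vec_eq_iff k Rep_widx_inject)
  let ?A = "\<chi> l. if l = k then c *s reidx w else reidx (v (Rep_widx l))"
  have "reidx x \<in> vec.span {row j ?A | j. j \<noteq> k}"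
  proof -
    have "reidx x \<in> span (reidx ` (v ` ({..<CARD('m)} - {i})))"
      using x linear_span_image[OF linear_reidx] by blast
    moreover have "reidx ` (v ` ({..<CARD('m)} - {i})) \<subseteq> {row j ?A | j. j \<noteq> k}"
    proof
      fix y assume "y \<in> reidx ` (v ` ({..<CARD('m)} - {i}))"
      then obtain l where l: "l < CARD('m)" "l \<noteq> i" and y: "y = reidx (v l)" by auto
      then obtain j :: "'m widx" where j: "l = Rep_widx j"
        using l(1) Rep_widx_cases by blast
      with l k have "j \<noteq> k" by auto
      then have "reidx (v l) = row j ?A" by (simp add: row_def j vec_eq_iff)
      with \<open>j \<noteq> k\<close> show "y \<in> {row j ?A | j. j \<noteq> k}" unfolding y by blast
    qed
    ultimately show ?thesis
      unfolding span_vec_eq using span_mono by blast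
  qed
  then have "det (\<chi> l. if l = k then row k ?A + reidx x else row l ?A) = det ?A"
    by (rule det_row_span)
  moreover have "(\<chi> l. if l = k then row k ?A + reidx x else row l ?A) =
     (\<chi> l. if l = k then reidx (c *\<^sub>R w + x) else reidx (v (Rep_widx l)))"
    by (auto simp: vec_eq_iff row_def)
  moreover have "det ?A = c * det (\<chi> l. if l = k then reidx w else reidx (v (Rep_widx l)))"
    by (rule det_row_mul)
  ultimately show ?thesis
    unfolding vdet_def m by simp
qed

subsection \<open>Active monomials\<close>

lemma teval_ge: "finite A \<Longrightarrow> a \<in> A \<Longrightarrow> lam a + a \<bullet> x \<le> teval A lam x"
  unfolding teval_def by (rule Max_ge) auto

lemma active_subset: "active A lam x \<subseteq> A"
  by (auto simp: active_def)

lemma finite_active: "finite A \<Longrightarrow> finite (active A lam x)"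
  by (rule finite_subset[OF active_subset])

lemma active_nonempty:
  assumes "finite A" "A \<noteq> {}"
  shows "active A lam x \<noteq> {}"
proof -
  have "teval A lam x \<in> (\<lambda>a. lam a + a \<bullet> x) ` A"
    unfolding teval_def using assms by (intro Max_in) auto
  then show ?thesis by (auto simp: active_def)
qed

lemma active_iff:
  assumes "finite A"
  shows "a \<in> active A lam x \<longleftrightarrow> a \<in> A \<and> (\<forall>b\<in>A. lam b + b \<bullet> x \<le> lam a + a \<bullet> x)"
proof
  assume "a \<in> active A lam x"
  then show "a \<in> A \<and> (\<forall>b\<in>A. lam b + b \<bullet> x \<le> lam a + a \<bullet> x)"
    using teval_ge[OF assms] by (auto simp: active_def)
next
  assume *: "a \<in> A \<and> (\<forall>b\<in>A. lam b + b \<bullet> x \<le> lam a + a \<bullet> x)"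
  then obtain c where "c \<in> active A lam x" using active_nonempty[OF assms] by blast
  then have c: "c \<in> A" "lam c + c \<bullet> x = teval A lam x" by (auto simp: active_def)
  with * have "teval A lam x \<le> lam a + a \<bullet> x" by force
  moreover have "lam a + a \<bullet> x \<le> teval A lam x" using * teval_ge[OF assms] by blast
  ultimately show "a \<in> active A lam x" using * by (auto simp: active_def)
qed

lemma active_less:
  assumes "finite A" "a \<in> active A lam x" "b \<in> A" "b \<notin> active A lam x"
  shows "lam b + b \<bullet> x < lam a + a \<bullet> x"
proof -
  have "lam b + b \<bullet> x \<noteq> teval A lam x" "lam a + a \<bullet> x = teval A lam x"
    using assms by (auto simp: active_def)
  then show ?thesis using teval_ge[OF assms(1,3), of lam x] by linarith
qed

lemma active_diff_inner:
  assumes "a \<in> active A lam x" "b \<in> active A lam x" "a \<in> active A lam y" "b \<in> active A lam y"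
  shows "(a - b) \<bullet> (y - x) = 0"
  using assms by (simp add: active_def inner_diff_left inner_diff_right)

lemma eventually_affine_less:
  fixes c d :: real
  assumes "c < d"
  shows "eventually (\<lambda>t. c + t * c' < d + t * d') (at_right 0)"
proof -
  have "((\<lambda>t. (d - c) + t * (d' - c')) \<longlongrightarrow> (d - c) + 0 * (d' - c')) (at_right 0)"
    by (intro tendsto_intros)
  then have "eventually (\<lambda>t. 0 < (d - c) + t * (d' - c')) (at_right 0)"
    by (rule order_tendstoD) (use assms in auto)
  then show ?thesis by (rule eventually_mono) (simp add: algebra_simps)
qed

text \<open>A monomial inactive at \<open>x\<close> stays below for a while because of its strict
  gap; among the active ones the slope along \<open>u\<close> decides. Dually, a small move along
  \<open>u\<close> passes to the face of the dual cell on which \<open>u\<close> is maximal.\<close>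

lemma active_perturb:
  assumes "finite A" "A \<noteq> {}"
  shows "eventually (\<lambda>t. active A lam (x + t *\<^sub>R u) =
    {a \<in> active A lam x. \<forall>b\<in>active A lam x. b \<bullet> u \<le> a \<bullet> u}) (at_right 0)"
proof -
  let ?B = "active A lam x" and ?C = "{a \<in> active A lam x. \<forall>b\<in>active A lam x. b \<bullet> u \<le> a \<bullet> u}"
  have B: "finite ?B" "?B \<noteq> {}" using finite_active[OF assms(1)] active_nonempty[OF assms] by auto
  have "Max ((\<lambda>a. a \<bullet> u) ` ?B) \<in> (\<lambda>a. a \<bullet> u) ` ?B" by (rule Max_in) (use B in auto)
  then obtain a where a: "a \<in> ?B" "a \<bullet> u = Max ((\<lambda>a. a \<bullet> u) ` ?B)" by auto
  have aC: "a \<in> ?C" using a B by auto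
  have "eventually (\<lambda>t. lam b + b \<bullet> (x + t *\<^sub>R u) < lam a + a \<bullet> (x + t *\<^sub>R u)) (at_right 0)"
    if b: "b \<in> A - ?C" for b
  proof (cases "b \<in> ?B")
    case True
    then have "lam b + b \<bullet> x = lam a + a \<bullet> x" using a by (simp add: active_def)
    moreover have "b \<bullet> u < a \<bullet> u"
    proof -
      have "\<not> (\<forall>c\<in>?B. c \<bullet> u \<le> b \<bullet> u)" using b True by simp
      then obtain c where "c \<in> ?B" "b \<bullet> u < c \<bullet> u" by (auto simp: not_le)
      moreover from this have "c \<bullet> u \<le> a \<bullet> u" using aC by simp
      ultimately show ?thesis by simp
    qed
    ultimately have "lam b + b \<bullet> (x + t *\<^sub>R u) < lam a + a \<bullet> (x + t *\<^sub>R u)" if "t > 0" for t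
      using mult_strict_left_mono[OF \<open>b \<bullet> u < a \<bullet> u\<close> that] by (simp add: inner_add_right)
    then show ?thesis by (rule eventually_mono[OF eventually_at_right_less])
  next
    case False
    then have "lam b + b \<bullet> x < lam a + a \<bullet> x"
      using a b teval_ge[OF assms(1), of b lam x] by (auto simp: active_def)
    from eventually_affine_less[OF this, of "b \<bullet> u" "a \<bullet> u"] show ?thesis
      by (simp add: inner_add_right add.assoc)
  qed
  then have "eventually (\<lambda>t. \<forall>b\<in>A - ?C. lam b + b \<bullet> (x + t *\<^sub>R u) < lam a + a \<bullet> (x + t *\<^sub>R u)) (at_right 0)"
    using assms by (intro eventually_ball_finite) auto
  then show ?thesis
  proof (rule eventually_mono)
    fix t assume t: "\<forall>b\<in>A - ?C. lam b + b \<bullet> (x + t *\<^sub>R u) < lam a + a \<bullet> (x + t *\<^sub>R u)"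
    have eq: "lam b + b \<bullet> (x + t *\<^sub>R u) = lam a + a \<bullet> (x + t *\<^sub>R u)" if "b \<in> ?C" for b
    proof -
      have "lam b + b \<bullet> x = lam a + a \<bullet> x" using that a by (simp add: active_def)
      moreover have "b \<bullet> u = a \<bullet> u" using that aC by (auto intro: antisym)
      ultimately show ?thesis by (simp add: inner_add_right)
    qed
    have le: "lam b + b \<bullet> (x + t *\<^sub>R u) \<le> lam a + a \<bullet> (x + t *\<^sub>R u)" if "b \<in> A" for b
      using that t eq by (cases "b \<in> ?C") (auto simp: less_imp_le)
    show "active A lam (x + t *\<^sub>R u) = ?C"
    proof (intro set_eqI iffI)
      fix b assume "b \<in> active A lam (x + t *\<^sub>R u)"
      then have "b \<in> A" "lam a + a \<bullet> (x + t *\<^sub>R u) \<le> lam b + b \<bullet> (x + t *\<^sub>R u)"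
        using a active_subset by (auto simp: active_iff[OF assms(1)])
      then show "b \<in> ?C"
        using t not_le by (metis (no_types, lifting) DiffI)
    next
      fix b assume b: "b \<in> ?C"
      then show "b \<in> active A lam (x + t *\<^sub>R u)"
        using le eq[OF b] active_subset by (fastforce simp: active_iff[OF assms(1)])
    qed
  qed
qed

lemma closed_active:
  assumes "finite A"
  shows "closed {y. a \<in> active A lam y}"
proof -
  have "{y. a \<in> active A lam y} = (if a \<in> A then \<Inter>b\<in>A. {y. lam b + b \<bullet> y \<le> lam a + a \<bullet> y} else {})"
    using active_iff[OF assms] by auto
  then show ?thesis
    by (auto intro!: closed_INT closed_Collect_le continuous_intros)
qed

lemma active_closure:
  assumes "finite A" "z \<in> closure S" "\<And>y. y \<in> S \<Longrightarrow> a \<in> active A lam y"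
  shows "a \<in> active A lam z"
  using closure_minimal[OF _ closed_active[OF assms(1)], of S a lam] assms by blast

text \<open>Monomials are affine along a segment, so equalities and strict inequalities that hold at
  both ends hold in between.\<close>

lemma convex_active_eq:
  assumes "finite A" "A \<noteq> {}"
  shows "convex {y. active A lam y = B}"
proof (rule convexI, clarify)
  fix y z and s t :: real
  assume yz: "active A lam z = active A lam y" and st: "0 \<le> s" "0 \<le> t" "s + t = 1"
  let ?w = "s *\<^sub>R y + t *\<^sub>R z"
  have val: "lam b + b \<bullet> ?w = s * (lam b + b \<bullet> y) + t * (lam b + b \<bullet> z)" for b
  proof -
    have "lam b = (s + t) * lam b" using st by simp
    then show ?thesis by (simp add: algebra_simps inner_add_right)
  qed
  obtain a where a: "a \<in> active A lam y" using active_nonempty[OF assms] by blast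
  have le: "lam b + b \<bullet> ?w \<le> lam c + c \<bullet> ?w" if "b \<in> A" "c \<in> active A lam y" for b c
  proof -
    have "lam b + b \<bullet> y \<le> lam c + c \<bullet> y" "lam b + b \<bullet> z \<le> lam c + c \<bullet> z"
      using that yz active_iff[OF assms(1), of c lam] by auto
    then show ?thesis unfolding val using st by (metis add_mono mult_left_mono)
  qed
  have less: "lam b + b \<bullet> ?w < lam a + a \<bullet> ?w" if "b \<in> A" "b \<notin> active A lam y" for b
  proof -
    have "lam b + b \<bullet> y < lam a + a \<bullet> y" "lam b + b \<bullet> z < lam a + a \<bullet> z"
      using that a yz by (auto intro: active_less[OF assms(1)])
    then show ?thesis unfolding val
      using st by (cases "s = 0") (auto intro!: add_less_le_mono mult_left_mono)
  qed
  show "active A lam ?w = active A lam y"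
  proof (intro set_eqI iffI)
    fix b assume b: "b \<in> active A lam ?w"
    then have "lam a + a \<bullet> ?w \<le> lam b + b \<bullet> ?w" "b \<in> A"
      using a active_subset by (auto simp: active_iff[OF assms(1)])
    then show "b \<in> active A lam y" using less by force
  next
    fix b assume b: "b \<in> active A lam y"
    then show "b \<in> active A lam ?w"
      using le active_subset by (auto simp: active_iff[OF assms(1)])
  qed
qed

subsection \<open>The dual subdivision and volumes\<close>

lemma continuous_on_teval:
  assumes "finite A" "A \<noteq> {}"
  shows "continuous_on S (teval A lam)"
proof -
  have "continuous_on S (\<lambda>x. Max ((\<lambda>a. lam a + a \<bullet> x) ` A))"
    using assms
  proof (induction A rule: finite_ne_induct)
    case (singleton a)
    show ?case by (simp, intro continuous_intros)
  next
    case (insert a A)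
    have "continuous_on S (\<lambda>x. max (lam a + a \<bullet> x) (Max ((\<lambda>a. lam a + a \<bullet> x) ` A)))"
      by (intro continuous_on_max insert.IH continuous_intros)
    then show ?case using insert.hyps by simp
  qed
  then show ?thesis by (simp add: teval_def[abs_def])
qed

lemma convex_hull_inner_le:
  assumes "p \<in> convex hull S" "\<And>a. a \<in> S \<Longrightarrow> a \<bullet> u \<le> c"
  shows "p \<bullet> u \<le> c"
proof -
  have "convex hull S \<subseteq> {p. u \<bullet> p \<le> c}"
    using assms(2) by (intro hull_minimal convex_halfspace_le) (auto simp: inner_commute)
  then show ?thesis using assms(1) by (auto simp: inner_commute)
qed

text \<open>Points of the dual cell at \<open>x\<close> are subgradients of the polynomial function
  there. A common subgradient at \<open>x\<close> and \<open>y\<close> satisfies the subgradient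
  inequality in both directions, which puts it on a hyperplane with normal
  \<open>y - x\<close>.\<close>

lemma negligible_dual_cells_Int:
  assumes "finite A" "x \<noteq> y"
  shows "negligible (convex hull (active A lam x) \<inter> convex hull (active A lam y))"
proof (rule negligible_subset)
  show "negligible {p. (y - x) \<bullet> p = teval A lam y - teval A lam x}"
    using assms by (intro negligible_hyperplane) auto
  have le: "p \<bullet> (y - x) \<le> teval A lam y - teval A lam x" if "p \<in> convex hull (active A lam x)" for p x y
    using that
  proof (rule convex_hull_inner_le)
    fix a assume "a \<in> active A lam x"
    then show "a \<bullet> (y - x) \<le> teval A lam y - teval A lam x"
      using teval_ge[OF assms(1), of a lam y] by (auto simp: active_def inner_diff_right)
  qed
  show "convex hull (active A lam x) \<inter> convex hull (active A lam y) \<subseteq>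
      {p. (y - x) \<bullet> p = teval A lam y - teval A lam x}"
    using le[of _ x y] le[of _ y x] by (fastforce simp: inner_commute inner_diff_right)
qed

text \<open>A minimizer of f(x) - p \<bullet> x is a point at which \<open>p\<close> is a
  subgradient, hence in the dual cell. The minimum exists because an interior point \<open>p\<close>
  makes this function grow at least linearly.\<close>

lemma interior_newton_covered:
  assumes A: "finite A" "A \<noteq> {}" and p: "p \<in> interior (convex hull A)"
  obtains x where "p \<in> convex hull (active A lam x)"
proof -
  define g where "g x = teval A lam x - p \<bullet> x" for x
  define L where "L = Min (lam ` A)"
  obtain e where e: "e > 0" "cball p e \<subseteq> convex hull A"
    using p by (auto simp: mem_interior_cball)
  have g_ge: "L + e * norm x \<le> g x" for x
  proof -
    \<comment> \<open>Shifting \<open>p\<close> by length \<open>e\<close> towards \<open>x\<close>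
      stays in the polytope and gains \<open>e * norm x\<close>. For \<open>x = 0\<close> the
      quotient is 0 and \<open>q = p\<close>.\<close>
    define q where "q = p + (e / norm x) *\<^sub>R x"
    have "q \<in> cball p e" using e by (simp add: q_def dist_norm)
    then have "q \<in> convex hull A" using e by auto
    then have "q \<bullet> x \<le> teval A lam x - L"
    proof (rule convex_hull_inner_le)
      fix a assume a: "a \<in> A"
      then have "L \<le> lam a" unfolding L_def using A by auto
      then show "a \<bullet> x \<le> teval A lam x - L" using teval_ge[OF A(1) a, of lam x] by linarith
    qed
    moreover have "q \<bullet> x = p \<bullet> x + e * norm x"
      by (simp add: q_def inner_add_left power2_norm_eq_inner[symmetric] power2_eq_square)
    ultimately show ?thesis by (simp add: g_def)
  qed
  \<comment> \<open>Outside the ball of this radius the lower bound \<open>L + e * norm x\<close>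
    exceeds \<open>g 0\<close>.\<close>
  define R where "R = (g 0 - L) / e"
  have "R \<ge> 0" using g_ge[of 0] e by (simp add: R_def)
  have "continuous_on (cball 0 R) g"
    unfolding g_def by (intro continuous_intros continuous_on_teval A)
  then obtain x where x: "x \<in> cball 0 R" "\<And>y. y \<in> cball 0 R \<Longrightarrow> g x \<le> g y"
    using continuous_attains_inf[of "cball 0 R" g] \<open>R \<ge> 0\<close> by auto
  have min: "g x \<le> g y" for y
  proof (cases "y \<in> cball 0 R")
    case False
    then have "R < norm y" by simp
    then have "g 0 - L < e * norm y" using e by (simp add: R_def field_simps)
    then show ?thesis using g_ge[of y] x(2)[of 0] \<open>R \<ge> 0\<close> by simp
  qed (use x in auto)
  have "p \<in> convex hull (active A lam x)"
  proof (rule ccontr)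
    assume "p \<notin> convex hull (active A lam x)"
    then obtain a b where ab: "a \<bullet> p < b" "\<And>y. y \<in> convex hull (active A lam x) \<Longrightarrow> a \<bullet> y > b"
      using separating_hyperplane_closed_point[of "convex hull (active A lam x)" p]
        finite_active[OF A(1)] by (auto simp: compact_imp_closed finite_imp_compact_convex_hull)
    have "eventually (\<lambda>t. t > 0 \<and> active A lam (x + t *\<^sub>R (- a)) \<subseteq> active A lam x) (at_right 0)"
      using eventually_conj[OF eventually_at_right_less active_perturb[OF A, of lam x "- a"]]
      by (rule eventually_mono) auto
    then obtain t :: real where t: "t > 0" "active A lam (x + t *\<^sub>R (- a)) \<subseteq> active A lam x"
      using eventually_happens by force
    \<comment> \<open>A monomial active at both points measures the change of the function exactly;
      separation from \<open>p\<close> makes \<open>g\<close> drop, contrary to minimality.\<close>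
    obtain c where c: "c \<in> active A lam (x + t *\<^sub>R (- a))" using active_nonempty[OF A] by blast
    with t have cx: "c \<in> active A lam x" by auto
    then have "b < a \<bullet> c" using ab(2) hull_inc by metis
    with ab(1) have "t * (a \<bullet> p) < t * (a \<bullet> c)" using t by simp
    then have "g (x + t *\<^sub>R (- a)) < g x"
      using c cx by (auto simp: g_def active_def inner_add_right inner_diff_right inner_commute)
    then show False using min[of "x + t *\<^sub>R (- a)"] by simp
  qed
  then show ?thesis by (rule that)
qed

text \<open>If two points had the same active set, their common dual cell would be its own overlap,
  hence negligible. So points with a cell of positive volume are told apart by subsets of
  \<open>A\<close>.\<close>

lemma finite_dual_cells_support:
  assumes "finite A"
  shows "finite {x. measure lebesgue (convex hull (active A lam x)) \<noteq> 0}" (is "finite ?X")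
proof (rule inj_on_finite)
  show "inj_on (active A lam) ?X"
  proof (rule inj_onI, rule ccontr)
    fix x y assume x: "x \<in> ?X" and eq: "active A lam x = active A lam y" and ne: "x \<noteq> y"
    have "negligible (convex hull (active A lam x))"
      using negligible_dual_cells_Int[OF assms ne, of lam] eq by simp
    with x show False by (simp add: negligible_imp_measure0)
  qed
  show "active A lam ` ?X \<subseteq> Pow A" using active_subset by auto
  show "finite (Pow A)" using assms by simp
qed

text \<open>The cells at points of \<open>X\<close> overlap negligibly. What they leave uncovered
  lies on the frontier or in null cells; the latter belong to infinitely many points but are only
  finitely many sets.\<close>

lemma measure_newton_polytope:
  assumes A: "finite A" "A \<noteq> {}" and X: "finite X"
    and out: "\<And>x. x \<notin> X \<Longrightarrow> measure lebesgue (convex hull (active A lam x)) = 0"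
  shows "measure lebesgue (convex hull A) = (\<Sum>x\<in>X. measure lebesgue (convex hull (active A lam x)))"
proof -
  define K where "K x = convex hull (active A lam x)" for x
  have cpt: "compact (K x)" for x
    unfolding K_def using finite_active[OF A(1)] by (rule finite_imp_compact_convex_hull)
  have fin: "finite (range K)"
  proof (rule finite_subset)
    show "range K \<subseteq> (\<lambda>B. convex hull B) ` Pow A" unfolding K_def using active_subset by fastforce
  qed (use A in auto)
  have neg1: "negligible (\<Union>{C \<in> range K. measure lebesgue C = 0})"
    using fin cpt by (intro negligible_Union) (auto simp: negligible_iff_measure lmeasurable_compact)
  have neg2: "negligible (frontier (convex hull A))"
    by (simp add: negligible_convex_frontier)
  have "convex hull A - (\<Union>x\<in>X. K x) \<subseteq>
      frontier (convex hull A) \<union> \<Union>{C \<in> range K. measure lebesgue C = 0}"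
  proof
    fix p assume p: "p \<in> convex hull A - (\<Union>x\<in>X. K x)"
    show "p \<in> frontier (convex hull A) \<union> \<Union>{C \<in> range K. measure lebesgue C = 0}"
    proof (cases "p \<in> interior (convex hull A)")
      case True
      then obtain x where x: "p \<in> K x" unfolding K_def using interior_newton_covered[OF A] by metis
      with p have "x \<notin> X" by auto
      then show ?thesis using x out unfolding K_def by auto
    next
      case False
      then show ?thesis using p closure_subset[of "convex hull A"] by (auto simp: frontier_def)
    qed
  qed
  then have 1: "negligible (convex hull A - (\<Union>x\<in>X. K x))"
    by (rule negligible_subset[OF negligible_Un[OF neg2 neg1]])
  have 2: "(\<Union>x\<in>X. K x) - convex hull A = {}"
    unfolding K_def using active_subset hull_mono by (metis (no_types, lifting) Diff_eq_empty_iff UN_least)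
  have "measure lebesgue (convex hull A) = measure lebesgue (\<Union>x\<in>X. K x)"
  proof (rule measure_negligible_symdiff)
    show "(\<Union>x\<in>X. K x) \<in> lmeasurable"
      using X cpt by (intro fmeasurable.finite_UN lmeasurable_compact) auto
    show "negligible ((\<Union>x\<in>X. K x) - convex hull A \<union> (convex hull A - (\<Union>x\<in>X. K x)))"
      using 1 2 by simp
  qed
  also have "\<dots> = (\<Sum>x\<in>X. measure lebesgue (K x))"
  proof (rule measure_negligible_finite_Union_image)
    show "pairwise (\<lambda>x y. negligible (K x \<inter> K y)) X"
      unfolding K_def pairwise_def using negligible_dual_cells_Int[OF A(1)] by auto
  qed (use X cpt in \<open>auto simp: lmeasurable_compact\<close>)
  finally show ?thesis by (simp add: K_def)
qed

subsection \<open>Minkowski sums and tropical products\<close>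

lemma tprodA_eq_image: "tprodA J A = (\<lambda>g. sum g J) ` (PiE J A)"
proof (intro set_eqI iffI)
  fix b assume "b \<in> tprodA J A"
  then obtain g where "b = sum g J" "\<forall>i\<in>J. g i \<in> A i" by (auto simp: tprodA_def)
  then show "b \<in> (\<lambda>g. sum g J) ` (PiE J A)"
    by (intro image_eqI[of _ _ "restrict g J"]) auto
next
  fix b assume "b \<in> (\<lambda>g. sum g J) ` (PiE J A)"
  then show "b \<in> tprodA J A" by (auto simp: tprodA_def)
qed

lemma finite_tprodA:
  assumes "finite J" "\<And>i. i \<in> J \<Longrightarrow> finite (A i)"
  shows "finite (tprodA J A)"
  unfolding tprodA_eq_image using assms by (intro finite_imageI finite_PiE) auto

lemma tprodA_nonempty:
  assumes "\<And>i. i \<in> J \<Longrightarrow> A i \<noteq> {}"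
  shows "tprodA J A \<noteq> {}"
  unfolding tprodA_eq_image using assms by (simp add: PiE_eq_empty_iff)

lemma convex_hull_tprodA:
  "finite J \<Longrightarrow> convex hull (tprodA J B) = tprodA J (\<lambda>i. convex hull (B i))"
  using convex_hull_set_sum[of B J] by (simp add: set_sum_alt tprodA_def)

text \<open>A sum of monomials, one from each factor, reaches the total maximum \<open>?T\<close>
  exactly when every summand is maximal in its factor. The maximum in \<open>tprodL\<close> is
  attained by some representation, to which this applies.\<close>

lemma active_tprod:
  assumes J: "finite J" and A: "\<And>i. i \<in> J \<Longrightarrow> finite (A i) \<and> A i \<noteq> {}"
  shows "active (tprodA J A) (tprodL J A lam) x = tprodA J (\<lambda>i. active (A i) (lam i) x)"
proof -
  let ?T = "\<Sum>i\<in>J. teval (A i) (lam i) x"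
  let ?V = "\<lambda>b. {(\<Sum>i\<in>J. lam i (g i)) | g. (\<forall>i\<in>J. g i \<in> A i) \<and> (\<Sum>i\<in>J. g i) = b}"
  have finV: "finite (?V b)" for b
  proof (rule finite_subset)
    show "?V b \<subseteq> (\<lambda>g. \<Sum>i\<in>J. lam i (g i)) ` (PiE J A)"
    proof clarify
      fix g assume "\<forall>i\<in>J. g i \<in> A i"
      then show "(\<Sum>i\<in>J. lam i (g i)) \<in> (\<lambda>g. \<Sum>i\<in>J. lam i (g i)) ` (PiE J A)"
        by (intro image_eqI[of _ _ "restrict g J"]) auto
    qed
    show "finite ((\<lambda>g. \<Sum>i\<in>J. lam i (g i)) ` (PiE J A))"
      using J A by (intro finite_imageI finite_PiE) auto
  qed
  have attained: "\<exists>g. (\<forall>i\<in>J. g i \<in> A i) \<and> sum g J = b \<and> tprodL J A lam b = (\<Sum>i\<in>J. lam i (g i))"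
    if "b \<in> tprodA J A" for b
  proof -
    have "?V b \<noteq> {}" using that by (auto simp: tprodA_def)
    then have "tprodL J A lam b \<in> ?V b" unfolding tprodL_def using finV by (intro Max_in) auto
    then show ?thesis by auto
  qed
  have val: "(\<Sum>i\<in>J. lam i (g i)) + sum g J \<bullet> x = (\<Sum>i\<in>J. lam i (g i) + g i \<bullet> x)" for g
    by (simp add: sum.distrib inner_sum_left)
  have le: "tprodL J A lam b + b \<bullet> x \<le> ?T" if b: "b \<in> tprodA J A" for b
  proof -
    obtain g where g: "\<forall>i\<in>J. g i \<in> A i" "sum g J = b" "tprodL J A lam b = (\<Sum>i\<in>J. lam i (g i))"
      using attained[OF b] by blast
    have "tprodL J A lam b + b \<bullet> x = (\<Sum>i\<in>J. lam i (g i) + g i \<bullet> x)"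
      using g val[of g] by simp
    also have "\<dots> \<le> ?T" using g A by (intro sum_mono teval_ge) auto
    finally show ?thesis .
  qed
  have ge: "?T \<le> tprodL J A lam (sum g J) + sum g J \<bullet> x"
    if g: "\<forall>i\<in>J. g i \<in> active (A i) (lam i) x" for g
  proof -
    have "?T = (\<Sum>i\<in>J. lam i (g i) + g i \<bullet> x)"
      using g by (intro sum.cong) (auto simp: active_def)
    also have "\<dots> = (\<Sum>i\<in>J. lam i (g i)) + sum g J \<bullet> x" by (simp add: val)
    also have "(\<Sum>i\<in>J. lam i (g i)) \<le> tprodL J A lam (sum g J)"
      unfolding tprodL_def using g active_subset by (intro Max_ge finV) blast
    finally show ?thesis by simp
  qed
  have fin: "finite (tprodA J A)" using J A by (intro finite_tprodA) auto
  show ?thesis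
  proof (intro set_eqI iffI)
    fix b assume b: "b \<in> active (tprodA J A) (tprodL J A lam) x"
    then have bA: "b \<in> tprodA J A" using active_subset by blast
    obtain g where g: "\<forall>i\<in>J. g i \<in> A i" "sum g J = b" "tprodL J A lam b = (\<Sum>i\<in>J. lam i (g i))"
      using attained[OF bA] by blast
    have "\<forall>i\<in>J. \<exists>a. a \<in> active (A i) (lam i) x" using A active_nonempty by blast
    then obtain h where h: "\<forall>i\<in>J. h i \<in> active (A i) (lam i) x" by metis
    have "sum h J \<in> tprodA J A" using h active_subset by (fastforce simp: tprodA_def)
    then have "?T \<le> tprodL J A lam b + b \<bullet> x"
      using b ge[OF h] by (force simp: active_iff[OF fin])
    then have "(\<Sum>i\<in>J. lam i (g i) + g i \<bullet> x) = ?T"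
      using le[OF bA] g val[of g] by simp
    then have "lam i (g i) + g i \<bullet> x = teval (A i) (lam i) x" if "i \<in> J" for i
      using that sum_mono_inv[of "\<lambda>i. lam i (g i) + g i \<bullet> x" J "\<lambda>i. teval (A i) (lam i) x" i] g A J
      by (auto intro: teval_ge)
    then show "b \<in> tprodA J (\<lambda>i. active (A i) (lam i) x)"
      using g by (auto simp: tprodA_def active_def)
  next
    fix b assume "b \<in> tprodA J (\<lambda>i. active (A i) (lam i) x)"
    then obtain g where g: "b = sum g J" "\<forall>i\<in>J. g i \<in> active (A i) (lam i) x"
      by (auto simp: tprodA_def)
    have "b \<in> tprodA J A" using g active_subset by (fastforce simp: tprodA_def)
    then show "b \<in> active (tprodA J A) (tprodL J A lam) x"
      using le ge[OF g(2)] g(1) by (force simp: active_iff[OF fin])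
  qed
qed

lemma tprodA_insert_singleton:
  assumes "finite J" "i \<notin> J" "B i = {p}"
  shows "tprodA (insert i J) B = (+) p ` tprodA J B"
proof (intro set_eqI iffI)
  fix b assume "b \<in> tprodA (insert i J) B"
  then obtain g where "b = sum g (insert i J)" "\<forall>j\<in>insert i J. g j \<in> B j" by (auto simp: tprodA_def)
  then have "b = p + sum g J" "sum g J \<in> tprodA J B" using assms by (auto simp: tprodA_def)
  then show "b \<in> (+) p ` tprodA J B" by blast
next
  fix b assume "b \<in> (+) p ` tprodA J B"
  then obtain g where g: "b = p + sum g J" "\<forall>j\<in>J. g j \<in> B j" by (auto simp: tprodA_def)
  have "sum (g(i := p)) J = sum g J" using assms by (intro sum.cong) auto
  then have "b = sum (g(i := p)) (insert i J)" using g assms by simp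
  then show "b \<in> tprodA (insert i J) B"
    using g assms unfolding tprodA_def by (intro CollectI exI[of _ "g(i := p)"]) auto
qed

text \<open>The plain volume of the Minkowski sum of the hulls: of Newton polytopes for
  \<open>B = A\<close>, and of the dual cell at \<open>x\<close> when \<open>B\<close> consists of
  the active sets at \<open>x\<close>. Mixed volumes arise only through alternating sums.\<close>

definition mink_vol :: "nat set \<Rightarrow> (nat \<Rightarrow> (real^'m) set) \<Rightarrow> real" where
  "mink_vol J B = measure lebesgue (convex hull (tprodA J B))"

text \<open>At a point outside some hypersurface of the family the alternating sum over subfamilies
  cancels.\<close>

lemma mixed_volume_eq_sum:
  assumes I: "finite I" and A: "\<And>i. i \<in> I \<Longrightarrow> finite (A i) \<and> A i \<noteq> {}"
    and small: "\<And>x S. x \<in> inter_hyp I A lam \<Longrightarrow> S \<subset> I \<Longrightarrow> mink_vol S (\<lambda>i. active (A i) (lam i) x) = 0"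
  defines "Z \<equiv> {x \<in> inter_hyp I A lam. mink_vol I (\<lambda>i. active (A i) (lam i) x) \<noteq> 0}"
  shows "finite Z"
    and "(\<Sum>S\<in>Pow I. (-1) ^ card (I - S) * mink_vol S A) = (\<Sum>x\<in>Z. mink_vol I (\<lambda>i. active (A i) (lam i) x))"
proof -
  define F where "F S x = mink_vol S (\<lambda>i. active (A i) (lam i) x)" for S x
  \<comment> \<open>One finite set that supports the cell volumes of all subfamilies at once, so
    that the sums over subfamilies and points can be exchanged.\<close>
  define X where "X = (\<Union>S\<in>Pow I. {x. F S x \<noteq> 0})"
  have F_eq: "F S x = measure lebesgue (convex hull (active (tprodA S A) (tprodL S A lam) x))"
    if "S \<subseteq> I" for S x
    unfolding F_def mink_vol_def using that I A by (subst active_tprod) (auto intro: finite_subset)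
  have fin: "finite (tprodA S A)" "tprodA S A \<noteq> {}" if "S \<subseteq> I" for S
    using that I A by (intro finite_tprodA tprodA_nonempty; auto intro: finite_subset)+
  have X: "finite X"
  proof -
    have "finite {x. F S x \<noteq> 0}" if "S \<subseteq> I" for S
      using finite_dual_cells_support[OF fin(1)[OF that], of "tprodL S A lam"] by (simp add: F_eq[OF that])
    then show ?thesis unfolding X_def using I by auto
  qed
  have ZX: "Z \<subseteq> X" unfolding Z_def X_def F_def by auto
  show "finite Z" using ZX X finite_subset by blast
  have vol: "mink_vol S A = (\<Sum>x\<in>X. F S x)" if "S \<subseteq> I" for S
    unfolding mink_vol_def F_eq[OF that]
    using X fin[OF that] that by (intro measure_newton_polytope) (auto simp: X_def F_eq[OF that, symmetric])
  have inner: "(\<Sum>S\<in>Pow I. (-1) ^ card (I - S) * F S x) = (if x \<in> Z then F I x else 0)" for x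
  proof (cases "x \<in> inter_hyp I A lam")
    case True
    have "(\<Sum>S\<in>Pow I. (-1) ^ card (I - S) * F S x) = (\<Sum>S\<in>{I}. (-1) ^ card (I - S) * F S x)"
      using I small[OF True] by (intro sum.mono_neutral_right) (auto simp: F_def)
    then show ?thesis using True by (auto simp: Z_def F_def)
  next
    case False
    then obtain i where i: "i \<in> I" "x \<notin> Vtr (A i) (lam i)" by (auto simp: inter_hyp_def)
    then obtain p where p: "active (A i) (lam i) x = {p}"
      using A active_nonempty[of "A i" "lam i" x] unfolding Vtr_def by blast
    \<comment> \<open>The polynomial \<open>i\<close> has the single active monomial
      \<open>p\<close> at \<open>x\<close>, so including it merely translates the dual cell.\<close>
    have eq: "F (insert i S) x = F S x" if "S \<subseteq> I - {i}" for S
    proof -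
      have "tprodA (insert i S) (\<lambda>i. active (A i) (lam i) x) = (+) p ` tprodA S (\<lambda>i. active (A i) (lam i) x)"
        using that I p by (intro tprodA_insert_singleton) (auto intro: finite_subset)
      then show ?thesis
        unfolding F_def mink_vol_def by (simp add: convex_hull_translation measure_translation)
    qed
    have Ii: "insert i (I - {i}) = I" using i by auto
    have "(\<Sum>S\<in>Pow I. (-1) ^ card (I - S) * F S x) =
        (\<Sum>S\<in>Pow (I - {i}). (-1) ^ card (I - {i} - S) * (F (insert i S) x - F S x))"
      using alternating_sum_Pow_insert[of "I - {i}" i "\<lambda>S. F S x"] I unfolding Ii by simp
    also have "\<dots> = 0" using eq by (intro sum.neutral) auto
    finally show ?thesis using False by (simp add: Z_def)
  qed
  have "(\<Sum>S\<in>Pow I. (-1) ^ card (I - S) * mink_vol S A) =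
      (\<Sum>S\<in>Pow I. \<Sum>x\<in>X. (-1) ^ card (I - S) * F S x)"
    using vol by (intro sum.cong) (auto simp: sum_distrib_left)
  also have "\<dots> = (\<Sum>x\<in>X. if x \<in> Z then F I x else 0)"
    by (subst sum.swap) (simp add: inner)
  also have "\<dots> = (\<Sum>x\<in>Z. F I x)"
    using X ZX by (simp add: sum.If_cases Int_absorb1)
  finally show "(\<Sum>S\<in>Pow I. (-1) ^ card (I - S) * mink_vol S A) = (\<Sum>x\<in>Z. mink_vol I (\<lambda>i. active (A i) (lam i) x))"
    by (simp add: F_def)
qed

subsection \<open>Standard simplices\<close>

lemma std_simplex_eq_scaled: "(std_simplex d :: (real^'m) set) = (*\<^sub>R) (real d) ` (convex hull (insert 0 Basis))"
proof -
  have Basis: "(Basis :: (real^'m) set) = range (\<lambda>i. axis i 1)" by (auto simp: Basis_vec_def)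
  have "insert 0 ((\<lambda>i. real d *\<^sub>R axis i 1) ` UNIV) = (*\<^sub>R) (real d) ` (insert 0 (Basis :: (real^'m) set))"
    unfolding Basis by (simp add: image_image)
  then show ?thesis
    unfolding std_simplex_def by (simp only: convex_hull_scaling)
qed

lemma measure_std_simplex: "measure lebesgue (std_simplex d :: (real^'m) set) = real d ^ CARD('m) / fact CARD('m)"
proof -
  let ?S = "convex hull (insert 0 Basis) :: (real^'m) set"
  have "compact ?S" by (intro finite_imp_compact_convex_hull) auto
  then have "measure lebesgue ?S = 1 / fact CARD('m)"
    using content_std_simplex[where 'a="real^'m"] by (simp add: measure_completion borel_compact)
  then show ?thesis
    using measure_lebesgue_affine[of "real d" "0 :: real^'m" ?S] by (simp add: std_simplex_eq_scaled)
qed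

lemma mem_std_simplex: "(x :: real^'m) \<in> std_simplex d \<longleftrightarrow> (\<forall>i. 0 \<le> x $ i) \<and> (\<Sum>i\<in>UNIV. x $ i) \<le> real d"
proof -
  have unit: "(y :: real^'m) \<in> convex hull (insert 0 Basis) \<longleftrightarrow> (\<forall>i. 0 \<le> y $ i) \<and> (\<Sum>i\<in>UNIV. y $ i) \<le> 1" for y
  proof -
    have Basis: "(Basis :: (real^'m) set) = range (\<lambda>i. axis i 1)" by (auto simp: Basis_vec_def)
    have inj: "inj (\<lambda>i. axis i 1 :: real^'m)" by (auto simp: inj_def axis_eq_axis)
    show ?thesis unfolding Starlike.std_simplex mem_Collect_eq unfolding Basis
      by (simp add: sum.reindex[OF inj] inner_axis)
  qed
  show ?thesis
  proof (cases "d = 0")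
    case True
    have "convex hull (insert 0 Basis) \<noteq> ({} :: (real^'m) set)" by simp
    then have 0: "std_simplex d = {0 :: real^'m}" unfolding std_simplex_eq_scaled True by (simp add: image_constant_conv)
    have "x = 0" if x: "\<forall>i. 0 \<le> x $ i" "(\<Sum>i\<in>UNIV. x $ i) \<le> 0"
    proof -
      have "(\<Sum>i\<in>UNIV. x $ i) \<ge> 0" using x by (intro sum_nonneg) auto
      then have "\<forall>i\<in>UNIV. x $ i = 0"
        using x by (subst sum_nonneg_eq_0_iff[symmetric]) auto
      then show ?thesis by (simp add: vec_eq_iff)
    qed
    then show ?thesis unfolding 0 using True by auto
  next
    case False
    have "x \<in> std_simplex d \<longleftrightarrow> (1 / real d) *\<^sub>R x \<in> convex hull (insert 0 Basis)"
    proof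
      assume "x \<in> std_simplex d"
      then show "(1 / real d) *\<^sub>R x \<in> convex hull (insert 0 Basis)"
        using False by (auto simp: std_simplex_eq_scaled)
    next
      assume "(1 / real d) *\<^sub>R x \<in> convex hull (insert 0 Basis)"
      then show "x \<in> std_simplex d"
        unfolding std_simplex_eq_scaled using False by (intro image_eqI[of _ _ "(1 / real d) *\<^sub>R x"]) auto
    qed
    also have "\<dots> \<longleftrightarrow> (\<forall>i. 0 \<le> x $ i) \<and> (\<Sum>i\<in>UNIV. x $ i) \<le> real d"
      unfolding unit using False by (simp add: sum_divide_distrib[symmetric] field_simps zero_le_divide_iff)
    finally show ?thesis .
  qed
qed

lemma tprodA_std_simplex:
  assumes "finite J"
  shows "tprodA J (\<lambda>i. std_simplex (d i)) = (std_simplex (sum d J) :: (real^'m) set)"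
proof (intro set_eqI iffI)
  fix b :: "real^'m" assume "b \<in> tprodA J (\<lambda>i. std_simplex (d i))"
  then obtain g :: "_ \<Rightarrow> real^'m" where g: "b = sum g J" "\<And>i. i \<in> J \<Longrightarrow> g i \<in> std_simplex (d i)"
    by (auto simp: tprodA_def)
  have "(\<Sum>k\<in>UNIV. b $ k) = (\<Sum>i\<in>J. \<Sum>k\<in>UNIV. g i $ k)"
    unfolding g by (simp add: sum.swap[of _ UNIV])
  also have "\<dots> \<le> (\<Sum>i\<in>J. real (d i))" using g by (intro sum_mono) (auto simp: mem_std_simplex)
  finally show "b \<in> std_simplex (sum d J)"
    using g by (auto simp: mem_std_simplex intro!: sum_nonneg)
next
  fix b :: "real^'m" assume b: "b \<in> std_simplex (sum d J)"
  show "b \<in> tprodA J (\<lambda>i. std_simplex (d i))"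
  proof (cases "sum d J = 0")
    case True
    have "b = 0" using b unfolding True std_simplex_eq_scaled by auto
    then show ?thesis unfolding tprodA_def
      by (auto intro!: exI[of _ "\<lambda>_. 0"] simp: mem_std_simplex)
  next
    case False
    \<comment> \<open>The point is split in proportion to the degrees.\<close>
    let ?g = "\<lambda>i. (real (d i) / real (sum d J)) *\<^sub>R b"
    have "sum ?g J = b"
    proof -
      have "(\<Sum>i\<in>J. real (d i) / real (sum d J)) = real (sum d J) / real (sum d J)"
        by (simp only: sum_divide_distrib of_nat_sum)
      also have "\<dots> = 1" using False by (metis divide_self of_nat_eq_0_iff)
      finally have "(\<Sum>i\<in>J. real (d i) / real (sum d J)) = 1" .
      then show ?thesis by (simp only: scaleR_sum_left[symmetric]) simp
    qed
    moreover have "?g i \<in> std_simplex (d i)" for i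
    proof -
      have "(\<Sum>k\<in>UNIV. ?g i $ k) = real (d i) * (\<Sum>k\<in>UNIV. b $ k) / real (sum d J)"
        by (simp add: sum_distrib_left sum_divide_distrib)
      also have "\<dots> \<le> real (d i)"
      proof -
        have "0 < real (sum d J)" using False by (metis of_nat_0_less_iff neq0_conv)
        moreover have "(\<Sum>k\<in>UNIV. b $ k) \<le> real (sum d J)" using b by (simp only: mem_std_simplex)
        ultimately show ?thesis by (simp only: pos_divide_le_eq mult_left_mono of_nat_0_le_iff)
      qed
      finally have "(\<Sum>k\<in>UNIV. ?g i $ k) \<le> real (d i)" .
      moreover have "0 \<le> ?g i $ k" for k
      proof -
        have "0 \<le> b $ k" using b by (simp only: mem_std_simplex)
        then show ?thesis by (simp del: of_nat_sum)
      qed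
      ultimately show ?thesis unfolding mem_std_simplex by blast
    qed
    ultimately show ?thesis unfolding tprodA_def by (intro CollectI exI[of _ ?g]) auto
  qed
qed

lemma mink_vol_std_simplex:
  assumes "finite J" "\<And>i. i \<in> J \<Longrightarrow> convex hull (A i) = (std_simplex (d i) :: (real^'m) set)"
  shows "mink_vol J A = real (sum d J) ^ CARD('m) / fact CARD('m)"
proof -
  have "PiE J (\<lambda>i. convex hull (A i)) = PiE J (\<lambda>i. std_simplex (d i))"
    using assms by (intro PiE_cong) auto
  then have "tprodA J (\<lambda>i. convex hull (A i)) = tprodA J (\<lambda>i. std_simplex (d i))"
    by (simp add: tprodA_eq_image)
  then show ?thesis
    using assms by (simp add: mink_vol_def convex_hull_tprodA tprodA_std_simplex measure_std_simplex)
qed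

subsection \<open>Dimensions of Minkowski sums\<close>

lemma negligible_aff_dim:
  fixes S :: "'a::euclidean_space set"
  assumes "aff_dim S < int DIM('a)"
  shows "negligible S"
proof (cases "S = {}")
  case False
  then obtain a where "a \<in> S" by blast
  then have "aff_dim S = int (dim ((+) (- a) ` S))"
    by (intro aff_dim_eq_dim hull_inc)
  then have "negligible ((+) (- a) ` S)"
    using assms by (intro negligible_lowdim) simp
  then show ?thesis by (rule negligible_translation_rev)
qed simp

text \<open>The edge directions of all the dual cells together. Their span is the direction space of
  the Minkowski sum, and its orthogonal complement consists of the directions in which the active
  sets persist.\<close>

definition differences :: "nat set \<Rightarrow> (nat \<Rightarrow> (real^'m) set) \<Rightarrow> (real^'m) set" where
  "differences J B = (\<Union>i\<in>J. {a - b | a b. a \<in> B i \<and> b \<in> B i})"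

lemma differencesI: "i \<in> J \<Longrightarrow> a \<in> B i \<Longrightarrow> b \<in> B i \<Longrightarrow> a - b \<in> differences J B"
  by (auto simp: differences_def)

text \<open>Changing only the \<open>i\<close>-th summand of a point exhibits every difference from
  \<open>B i\<close> as a difference of two points of the Minkowski sum.\<close>

lemma aff_dim_tprodA:
  assumes "finite J" "\<And>i. i \<in> J \<Longrightarrow> B i \<noteq> {}"
  shows "aff_dim (tprodA J B) = int (dim (differences J B))"
proof -
  define g0 where "g0 i = (SOME a. a \<in> B i)" for i
  have g0: "g0 i \<in> B i" if "i \<in> J" for i
    using assms(2)[OF that] by (simp add: g0_def some_in_eq)
  define p where "p = sum g0 J"
  have p: "p \<in> tprodA J B" using g0 by (auto simp: p_def tprodA_def)
  have "span ((+) (- p) ` tprodA J B) = span (differences J B)"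
    unfolding span_eq
  proof (intro conjI)
    show "(+) (- p) ` tprodA J B \<subseteq> span (differences J B)"
    proof
      fix y assume "y \<in> (+) (- p) ` tprodA J B"
      then obtain g where g: "y = - p + sum g J" "\<forall>i\<in>J. g i \<in> B i" by (auto simp: tprodA_def)
      have "y = (\<Sum>i\<in>J. g i - g0 i)" using g by (simp add: p_def sum_subtractf)
      also have "\<dots> \<in> span (differences J B)"
        using g g0 by (intro span_sum span_base differencesI) auto
      finally show "y \<in> span (differences J B)" .
    qed
    show "differences J B \<subseteq> span ((+) (- p) ` tprodA J B)"
    proof
      fix y assume "y \<in> differences J B"
      then obtain i a b where y: "i \<in> J" "a \<in> B i" "b \<in> B i" "y = a - b" by (auto simp: differences_def)
      have mem: "- p + sum (g0(i := c)) J \<in> span ((+) (- p) ` tprodA J B)" if "c \<in> B i" for c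
        using that g0 by (intro span_base imageI) (auto simp: tprodA_def intro!: exI[of _ "g0(i := c)"])
      have "y = (- p + sum (g0(i := a)) J) - (- p + sum (g0(i := b)) J)"
        using y assms(1) by (simp add: sum.remove[of J i])
      also have "\<dots> \<in> span ((+) (- p) ` tprodA J B)"
        using y by (intro span_diff mem)
      finally show "y \<in> span ((+) (- p) ` tprodA J B)" .
    qed
  qed
  then have "dim ((+) (- p) ` tprodA J B) = dim (differences J B)" by (rule span_eq_dim)
  then show ?thesis using aff_dim_eq_dim[OF hull_inc[OF p]] by simp
qed

lemma dim_differences_le:
  assumes J: "finite J" and B: "\<And>i. i \<in> J \<Longrightarrow> finite (B i) \<and> B i \<noteq> {}"
  shows "dim (differences J B) \<le> (\<Sum>i\<in>J. card (B i) - 1)"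
proof -
  define g where "g i = (SOME a. a \<in> B i)" for i
  have g: "g i \<in> B i" if "i \<in> J" for i
    using B[OF that] by (simp add: g_def some_in_eq)
  define W where "W = (\<Union>i\<in>J. (\<lambda>a. a - g i) ` (B i - {g i}))"
  have fin: "finite W" unfolding W_def using J B by auto
  have mem: "a - g i \<in> span W" if "i \<in> J" "a \<in> B i" for i a
    using that by (cases "a = g i") (auto simp: W_def span_zero intro!: span_base)
  have "differences J B \<subseteq> span W"
  proof
    fix y assume "y \<in> differences J B"
    then obtain i a b where y: "i \<in> J" "a \<in> B i" "b \<in> B i" "y = a - b" by (auto simp: differences_def)
    then have "(a - g i) - (b - g i) \<in> span W" by (intro span_diff mem)
    then show "y \<in> span W" using y by simp
  qed
  then have "dim (differences J B) \<le> card W" by (rule dim_le_card) (rule fin)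
  also have "\<dots> \<le> (\<Sum>i\<in>J. card ((\<lambda>a. a - g i) ` (B i - {g i})))"
    unfolding W_def by (rule card_UN_le[OF J])
  also have "\<dots> \<le> (\<Sum>i\<in>J. card (B i) - 1)"
  proof (rule sum_mono)
    fix i assume "i \<in> J"
    then show "card ((\<lambda>a. a - g i) ` (B i - {g i})) \<le> card (B i) - 1"
      using B g card_image_le[of "B i - {g i}" "\<lambda>a. a - g i"] by (auto simp: card_Diff_singleton)
  qed
  finally show ?thesis .
qed

lemma mink_vol_eq_0:
  fixes B :: "nat \<Rightarrow> (real^'m) set"
  assumes J: "finite J" and B: "\<And>i. i \<in> J \<Longrightarrow> finite (B i) \<and> B i \<noteq> {}"
    and less: "(\<Sum>i\<in>J. card (B i) - 1) < CARD('m)"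
  shows "mink_vol J B = 0"
proof -
  have "aff_dim (convex hull (tprodA J B)) = int (dim (differences J B))"
    unfolding aff_dim_convex_hull using B by (intro aff_dim_tprodA J) auto
  also have "\<dots> < int CARD('m)"
    using dim_differences_le[of J B] J B less by fastforce
  finally show ?thesis
    unfolding mink_vol_def by (intro negligible_imp_measure0 negligible_aff_dim) simp
qed

subsection \<open>Unimodular simplices and smooth hypersurfaces\<close>

lemma lattice_pt_diff: "lattice_pt a \<Longrightarrow> lattice_pt b \<Longrightarrow> lattice_pt (a - b)"
  by (auto simp: lattice_pt_def)

text \<open>By Cramer's rule the barycentric coordinates are quotients of integer determinants by 1
  or -1, hence integers; nonnegative integers with sum 1 single out one vertex.\<close>

lemma lattice_pt_in_unimodular_simplex:
  fixes C :: "(real^'m) set"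
  assumes ind: "\<not> affine_dependent C" and card: "card C = CARD('m) + 1"
    and lat: "\<And>c. c \<in> C \<Longrightarrow> lattice_pt c"
    and vol: "measure lebesgue (convex hull C) = 1 / fact CARD('m)"
    and a: "lattice_pt a" "a \<in> convex hull C"
  shows "a \<in> C"
proof -
  have fin: "finite C" using ind by (rule aff_independent_finite)
  obtain l where l: "\<And>c. c \<in> C \<Longrightarrow> 0 \<le> l c" "sum l C = 1" "(\<Sum>c\<in>C. l c *\<^sub>R c) = a"
    using a(2) unfolding convex_hull_finite[OF fin] by auto
  obtain c0 where c0: "c0 \<in> C" using card by fastforce
  have "card (C - {c0}) = CARD('m)" using card c0 fin by simp
  then obtain h where h: "bij_betw h {..<CARD('m)} (C - {c0})"
    using finite_same_card_bij[of "{..<CARD('m)}" "C - {c0}"] fin by auto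
  define v where "v i = h i - c0" for i
  have hC: "h i \<in> C" if "i < CARD('m)" for i using that h by (auto simp: bij_betw_def)
  have "insert 0 (v ` {..<CARD('m)}) = (+) (- c0) ` C"
  proof -
    have "v ` {..<CARD('m)} = (+) (- c0) ` (C - {c0})"
      using h unfolding bij_betw_def v_def by (metis (no_types, lifting) image_cong image_image uminus_add_conv_diff)
    then show ?thesis using c0 by (metis image_insert insert_Diff ab_left_minus)
  qed
  then have "\<bar>vdet v\<bar> / fact CARD('m) = measure lebesgue ((+) (- c0) ` (convex hull C))"
    using measure_unit_simplex_image[of v] by (simp only: convex_hull_translation)
  then have vd: "\<bar>vdet v\<bar> = 1"
    unfolding measure_translation vol by simp
  have a_eq: "a - c0 = (\<Sum>i<CARD('m). l (h i) *\<^sub>R v i)"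
  proof -
    have "(\<Sum>i<CARD('m). l (h i) *\<^sub>R v i) = (\<Sum>c\<in>C - {c0}. l c *\<^sub>R (c - c0))"
      unfolding v_def by (rule sum.reindex_bij_betw[OF h])
    also have "\<dots> = (\<Sum>c\<in>C. l c *\<^sub>R (c - c0))"
      using fin c0 by (simp add: sum.remove)
    also have "\<dots> = a - c0"
      using l by (simp add: scaleR_diff_right sum_subtractf scaleR_sum_left[symmetric])
    finally show ?thesis by simp
  qed
  have int: "l (h i) \<in> \<int>" if i: "i < CARD('m)" for i
  proof -
    \<comment> \<open>Putting \<open>a - c0\<close> in place of \<open>v i\<close> multiplies the
      determinant by the coordinate \<open>l (h i)\<close>, since the remaining terms lie in the
      span of the other rows.\<close>
    let ?x = "\<Sum>j\<in>{..<CARD('m)} - {i}. l (h j) *\<^sub>R v j"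
    have "?x \<in> span (v ` ({..<CARD('m)} - {i}))"
      by (intro span_sum span_scale span_base) auto
    then have "vdet (v(i := l (h i) *\<^sub>R v i + ?x)) = l (h i) * vdet v"
      using vdet_upd_scale_span[OF i, of ?x v] by simp
    moreover have "l (h i) *\<^sub>R v i + ?x = a - c0"
      using i unfolding a_eq by (simp add: sum.remove)
    moreover have "vdet (v(i := a - c0)) \<in> \<int>"
      using lat hC c0 a by (intro vdet_Ints) (auto simp: v_def intro: lattice_pt_diff)
    ultimately have "l (h i) * vdet v \<in> \<int>" by simp
    moreover have "vdet v = 1 \<or> vdet v = -1" using vd by linarith
    ultimately show ?thesis by auto
  qed
  \<comment> \<open>A nonzero coordinate away from \<open>c0\<close> is at least 1 and exhausts the
    total; if there is none, the whole weight sits at \<open>c0\<close>.\<close>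
  show ?thesis
  proof (cases "\<exists>c\<in>C - {c0}. l c \<noteq> 0")
    case True
    then obtain c where c: "c \<in> C" "c \<noteq> c0" "l c \<noteq> 0" by auto
    then obtain i where "i < CARD('m)" "c = h i" using h by (auto simp: bij_betw_def)
    then have "l c \<in> \<int>" using int by simp
    then have "l c \<ge> 1" using c l(1)[of c] by (auto elim!: Ints_cases)
    moreover have "sum l C = l c + sum l (C - {c})" using fin c by (simp add: sum.remove)
    moreover have "0 \<le> sum l (C - {c})" using l by (intro sum_nonneg) auto
    ultimately have "l c = 1" "sum l (C - {c}) = 0" using l(2) by auto
    then have "\<forall>x\<in>C - {c}. l x = 0" using fin l by (subst (asm) sum_nonneg_eq_0_iff) auto
    then have "(\<Sum>c\<in>C. l c *\<^sub>R c) = c"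
      using fin c \<open>l c = 1\<close> by (simp add: sum.remove[of C c])
    then show ?thesis using l c by simp
  next
    case False
    then have "sum l C = l c0" "(\<Sum>c\<in>C. l c *\<^sub>R c) = l c0 *\<^sub>R c0"
      using fin c0 by (simp_all add: sum.remove[of C c0])
    then show ?thesis using l c0 by simp
  qed
qed

text \<open>There are finitely many cells, so each lies in a maximal one. The definition of
  smoothness leaves the dimension of the simplex open; positive volume forces it to be that of the
  space.\<close>

lemma smooth_hyp_maximal_cell:
  fixes A :: "(real^'m) set"
  assumes "smooth_hyp A lam d"
  obtains C where "\<not> affine_dependent C" "card C = CARD('m) + 1" "\<And>c. c \<in> C \<Longrightarrow> lattice_pt c"
    "measure lebesgue (convex hull C) = 1 / fact CARD('m)" "active A lam x \<subseteq> convex hull C"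
    "convex hull C \<subseteq> convex hull A"
proof -
  have A: "finite A" using assms by (auto simp: smooth_hyp_def is_tpoly_def)
  let ?cells = "subdiv_cells A lam"
  have "?cells \<subseteq> (\<lambda>B. convex hull B) ` Pow A"
    using active_subset by (fastforce simp: subdiv_cells_def)
  then have "finite ?cells" using A by (simp add: finite_subset)
  moreover have "convex hull (active A lam x) \<in> ?cells" by (auto simp: subdiv_cells_def)
  ultimately obtain L where L: "L \<in> ?cells" "convex hull (active A lam x) \<subseteq> L"
    "\<forall>L'\<in>?cells. L \<subseteq> L' \<longrightarrow> L = L'"
    using finite_has_maximal2[of ?cells "convex hull (active A lam x)"] by (elim meta_impE bexE conjE) auto
  then have "(\<exists>k. lattice_simplex k L) \<and> measure lebesgue L = 1 / fact CARD('m)"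
    using assms unfolding smooth_hyp_def by blast
  then obtain k C where C: "\<not> affine_dependent C" "int (card C) = k + 1" "L = convex hull C"
      "\<forall>c\<in>C. lattice_pt c" and vol: "measure lebesgue L = 1 / fact CARD('m)"
    by (auto simp: lattice_simplex_def)
  have ad: "aff_dim L = int (card C) - 1"
    using C by (simp add: aff_dim_convex_hull aff_dim_affine_independent)
  have "aff_dim L \<le> int CARD('m)" using aff_dim_le_DIM[of L] by simp
  moreover have "\<not> aff_dim L < int CARD('m)"
  proof
    assume "aff_dim L < int CARD('m)"
    then have "measure lebesgue L = 0"
      by (intro negligible_imp_measure0 negligible_aff_dim) simp
    then show False using vol by simp
  qed
  ultimately have card: "card C = CARD('m) + 1" using ad by linarith
  have sub: "active A lam x \<subseteq> convex hull C"
    using order_trans[OF hull_subset L(2)] C(3) by simp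
  have subA: "convex hull C \<subseteq> convex hull A"
  proof -
    obtain y where "L = convex hull (active A lam y)" using L(1) by (auto simp: subdiv_cells_def)
    then show ?thesis using C(3) hull_mono[OF active_subset] by simp
  qed
  show ?thesis
    by (rule that[of C]) (use C card vol sub subA in auto)
qed

text \<open>An active monomial could a priori be a non-vertex of its cell. As a lattice point of a
  unimodular simplex it is one of the vertices, so the active set is part of an affinely independent
  set.\<close>

lemma smooth_hyp_active_independent:
  fixes A :: "(real^'m) set"
  assumes "smooth_hyp A lam d"
  shows "\<not> affine_dependent (active A lam x)"
proof -
  obtain C where C: "\<not> affine_dependent C" "card C = CARD('m) + 1" "\<And>c. c \<in> C \<Longrightarrow> lattice_pt c"
    "measure lebesgue (convex hull C) = 1 / fact CARD('m)" "active A lam x \<subseteq> convex hull C"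
    by (rule smooth_hyp_maximal_cell[OF assms, where x = x]) (rule that, assumption+)
  have "active A lam x \<subseteq> C"
  proof
    fix a assume a: "a \<in> active A lam x"
    then have "a \<in> A" using active_subset by blast
    then have "lattice_pt a" using assms by (simp add: smooth_hyp_def is_tpoly_def)
    moreover have "a \<in> convex hull C" using a C(5) by auto
    ultimately show "a \<in> C" using C(3) by (intro lattice_pt_in_unimodular_simplex[OF C(1,2) _ C(4)]) auto
  qed
  then show ?thesis using C(1) affine_independent_subset by blast
qed

lemma smooth_hyp_degree_pos:
  fixes A :: "(real^'m) set"
  assumes "smooth_hyp A lam d"
  shows "d > 0"
proof (rule ccontr)
  assume "\<not> d > 0"
  obtain C where C: "\<not> affine_dependent C" "measure lebesgue (convex hull C) = 1 / fact CARD('m)"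
     "convex hull C \<subseteq> convex hull A"
    by (rule smooth_hyp_maximal_cell[OF assms, where x = 0])
  have "convex hull A = std_simplex d" using assms by (simp add: smooth_hyp_def)
  moreover have "finite A" using assms by (auto simp: smooth_hyp_def is_tpoly_def)
  ultimately have "measure lebesgue (convex hull C) \<le> measure lebesgue (std_simplex d :: (real^'m) set)"
    using C aff_independent_finite[OF C(1)]
    by (intro measure_mono_fmeasurable fmeasurableD lmeasurable_compact)
       (auto intro: finite_imp_compact_convex_hull simp flip: \<open>convex hull A = std_simplex d\<close>)
  then show False using C(2) \<open>\<not> d > 0\<close> using fact_gt_zero[of "CARD('m)", where 'a=real]
    by (simp add: measure_std_simplex power_0_left del: fact_gt_zero)
qed

subsection \<open>Vertices and edges of a smooth transversal curve\<close>

locale tropical_curve =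
  fixes A :: "nat \<Rightarrow> (real^'m) set" and lam :: "nat \<Rightarrow> real^'m \<Rightarrow> real"
    and d :: "nat \<Rightarrow> nat" and n :: nat
  assumes n_ge_2: "n \<ge> 2"
    and card_m: "CARD('m) = n + 1"
    and smooth_hyp: "\<And>i. i < n \<Longrightarrow> smooth_hyp (A i) (lam i) (d i)"
    and transversal: "transversal n A lam"
    and smooth_curve: "smooth_curve n A lam"
begin

abbreviation act :: "nat \<Rightarrow> real^'m \<Rightarrow> (real^'m) set" where
  "act i x \<equiv> active (A i) (lam i) x"

abbreviation cell :: "real^'m \<Rightarrow> (real^'m) set" where
  "cell x \<equiv> stratum {..<n} A lam x"

abbreviation Cur :: "(real^'m) set" where
  "Cur \<equiv> curve n A lam"

abbreviation Ver :: "(real^'m) set" where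
  "Ver \<equiv> curve_vertices n A lam"

definition dif :: "real^'m \<Rightarrow> (real^'m) set" where
  "dif x = differences {..<n} (\<lambda>i. act i x)"

text \<open>A combinatorial encoding of lying on an open edge: all \<open>n\<close> dual cells are
  segments. Its agreement with the dimension of the stratum is derived later.\<close>

definition edge_pt :: "real^'m \<Rightarrow> bool" where
  "edge_pt x \<longleftrightarrow> (\<forall>i<n. card (act i x) = 2)"

lemma A_fin: "i < n \<Longrightarrow> finite (A i)" and A_ne: "i < n \<Longrightarrow> A i \<noteq> {}"
  using smooth_hyp by (auto simp: smooth_hyp_def is_tpoly_def)

lemma hull_A: "i < n \<Longrightarrow> convex hull (A i) = std_simplex (d i)"
  using smooth_hyp by (auto simp: smooth_hyp_def)

lemma lattice_A: "i < n \<Longrightarrow> a \<in> A i \<Longrightarrow> lattice_pt a"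
  using smooth_hyp by (auto simp: smooth_hyp_def is_tpoly_def)

lemma d_pos: "i < n \<Longrightarrow> d i > 0"
  using smooth_hyp smooth_hyp_degree_pos by blast

lemma act_fin: "i < n \<Longrightarrow> finite (act i x)"
  by (intro finite_active A_fin)

lemma act_ne: "i < n \<Longrightarrow> act i x \<noteq> {}"
  by (intro active_nonempty A_fin A_ne)

lemma act_sub: "act i x \<subseteq> A i"
  by (rule active_subset)

lemma act_ind: "i < n \<Longrightarrow> \<not> affine_dependent (act i x)"
  using smooth_hyp smooth_hyp_active_independent by blast

lemma curve_iff: "x \<in> Cur \<longleftrightarrow> (\<forall>i<n. card (act i x) \<ge> 2)"
proof -
  have "x \<in> Vtr (A i) (lam i) \<longleftrightarrow> card (act i x) \<ge> 2" if "i < n" for i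
    using act_fin[OF that, of x] card_le_Suc0_iff_eq[of "act i x"]
    by (auto simp: Vtr_def numeral_2_eq_2 not_less_eq_eq[symmetric])
  then show ?thesis by (auto simp: curve_def inter_hyp_def)
qed

lemma edge_pt_in_curve: "edge_pt x \<Longrightarrow> x \<in> Cur"
  by (auto simp: edge_pt_def curve_iff)

lemma active_prod: "active (tprodA {..<n} A) (tprodL {..<n} A lam) x = tprodA {..<n} (\<lambda>i. act i x)"
  by (rule active_tprod) (auto simp: A_fin A_ne)

text \<open>Transversality for the whole family makes the dimensions of the dual cells add up, and
  affine independence turns each of them into a cardinality.\<close>

lemma dim_dif:
  assumes "x \<in> Cur"
  shows "dim (dif x) = (\<Sum>i<n. card (act i x) - 1)"
proof -
  have "aff_dim (convex hull (active (tprodA {..<n} A) (tprodL {..<n} A lam) x)) =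
        (\<Sum>i<n. aff_dim (convex hull (act i x)))"
    using transversal assms n_ge_2 unfolding transversal_def curve_def by auto
  moreover have "aff_dim (convex hull (active (tprodA {..<n} A) (tprodL {..<n} A lam) x)) = int (dim (dif x))"
    unfolding active_prod aff_dim_convex_hull dif_def
    by (rule aff_dim_tprodA) (auto simp: act_ne)
  moreover have "aff_dim (convex hull (act i x)) = int (card (act i x) - 1)" if "i < n" for i
    using act_ind[OF that] act_fin[OF that] act_ne[OF that]
    by (simp add: aff_dim_convex_hull aff_dim_affine_independent of_nat_diff Suc_leI card_gt_0_iff)
  ultimately have "int (dim (dif x)) = (\<Sum>i<n. int (card (act i x) - 1))" by simp
  then show ?thesis by (simp flip: of_nat_sum)
qed

text \<open>Each of the \<open>n\<close> dual cells contributes at least one dimension, and the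
  space has \<open>n + 1\<close>. At most one dimension is left over, and it goes to a single
  cell.\<close>

lemma curve_cases:
  assumes "x \<in> Cur"
  obtains (edge) "edge_pt x" "dim (dif x) = n"
    | (vertex) i where "i < n" "card (act i x) = 3" "\<And>j. j < n \<Longrightarrow> j \<noteq> i \<Longrightarrow> card (act j x) = 2"
        "dim (dif x) = n + 1" "\<not> edge_pt x"
proof -
  define k where "k i = card (act i x) - 2" for i
  have k: "card (act i x) = k i + 2" if "i < n" for i
    using assms that by (force simp: k_def curve_iff)
  have dim: "dim (dif x) = (\<Sum>i<n. k i) + n"
  proof -
    have "(\<Sum>i<n. card (act i x) - 1) = (\<Sum>i<n. k i + 1)"
      using k by (intro sum.cong) auto
    then show ?thesis unfolding dim_dif[OF assms] by (simp add: sum.distrib del: sum_Suc add_Suc_right)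
  qed
  have "dim (dif x) \<le> n + 1" using dim_subset_UNIV[of "dif x"] by (simp add: card_m)
  with dim have le: "(\<Sum>i<n. k i) \<le> 1" by simp
  show ?thesis
  proof (cases "\<forall>i<n. k i = 0")
    case True
    then show ?thesis using edge k dim by (simp add: edge_pt_def)
  next
    case False
    then obtain i where i: "i < n" "k i \<noteq> 0" by auto
    have s: "(\<Sum>i<n. k i) = k i + (\<Sum>j\<in>{..<n} - {i}. k j)" using i by (simp add: sum.remove)
    have ki: "k i = 1" and rest: "(\<Sum>j\<in>{..<n} - {i}. k j) = 0"
      using le i(2) unfolding s by linarith+
    have "k j = 0" if "j < n" "j \<noteq> i" for j
      using rest that by simp
    moreover have "dim (dif x) = n + 1" using dim s ki rest by simp
    moreover have "\<not> edge_pt x" using i k ki by (auto simp: edge_pt_def)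
    ultimately show ?thesis using i k ki by (intro vertex[of i]) auto
  qed
qed

lemma dif_cong: "(\<And>i. i < n \<Longrightarrow> act i x = act i y) \<Longrightarrow> dif x = dif y"
  by (auto simp: dif_def differences_def)

lemma cell_iff: "y \<in> cell x \<longleftrightarrow> (\<forall>i<n. act i y = act i x)"
  by (auto simp: stratum_def)

lemma cell_self: "x \<in> cell x"
  by (simp add: cell_iff)

lemma cell_eqI: "y \<in> cell x \<Longrightarrow> cell y = cell x"
  by (auto simp: stratum_def)

lemma edge_pt_cell: "y \<in> cell x \<Longrightarrow> edge_pt y = edge_pt x"
  by (simp add: cell_iff edge_pt_def)

lemma dif_cell: "y \<in> cell x \<Longrightarrow> dif y = dif x"
  by (rule dif_cong) (simp add: cell_iff)

lemma cell_orthogonal: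
  assumes "y \<in> cell x" "e \<in> dif x"
  shows "e \<bullet> (y - x) = 0"
proof -
  obtain i a b where i: "i < n" "a \<in> act i x" "b \<in> act i x" "e = a - b"
    using assms(2) by (auto simp: dif_def differences_def)
  moreover from this have "a \<in> act i y" "b \<in> act i y" using assms(1) by (auto simp: cell_iff)
  ultimately show ?thesis by (simp add: active_diff_inner)
qed

lemma orthogonal_zero:
  assumes "dim (dif x) = n + 1" "\<And>e. e \<in> dif x \<Longrightarrow> e \<bullet> w = 0"
  shows "w = 0"
proof -
  have "span (dif x) = UNIV" using assms(1) by (simp add: dim_eq_full[symmetric] card_m)
  moreover have "v \<bullet> w = 0" if "v \<in> span (dif x)" for v
    using that by (induction rule: span_induct_alt) (auto simp: inner_add_left assms(2))
  ultimately have "w \<bullet> w = 0" by simp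
  then show ?thesis by simp
qed

lemma eventually_cell:
  assumes "\<And>e. e \<in> dif x \<Longrightarrow> e \<bullet> u = 0"
  shows "eventually (\<lambda>t. x + t *\<^sub>R u \<in> cell x) (at_right 0)"
proof -
  have "eventually (\<lambda>t. act i (x + t *\<^sub>R u) = act i x) (at_right 0)" if i: "i < n" for i
  proof -
    have "b \<bullet> u \<le> a \<bullet> u" if "a \<in> act i x" "b \<in> act i x" for a b
    proof -
      have "a - b \<in> dif x" unfolding dif_def using that i by (intro differencesI[of i]) auto
      then show ?thesis using assms[of "a - b"] by (simp add: inner_diff_left)
    qed
    then have "{a \<in> act i x. \<forall>b\<in>act i x. b \<bullet> u \<le> a \<bullet> u} = act i x" by blast
    then show ?thesis using active_perturb[OF A_fin[OF i] A_ne[OF i], of "lam i" x u] by simp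
  qed
  then have "eventually (\<lambda>t. \<forall>i\<in>{..<n}. act i (x + t *\<^sub>R u) = act i x) (at_right 0)"
    by (intro eventually_ball_finite) auto
  then show ?thesis by (simp add: cell_iff Ball_def)
qed

lemma edge_not_singleton:
  assumes "edge_pt x"
  shows "cell x \<noteq> {x}"
proof -
  have "dim (dif x) = n" by (rule curve_cases[OF edge_pt_in_curve[OF assms]]) (use assms in auto)
  then obtain u where u: "u \<noteq> 0" "span (dif x) \<subseteq> {y. u \<bullet> y = 0}"
    using lowdim_subset_hyperplane[of "dif x"] card_m by auto
  then have "e \<bullet> u = 0" if "e \<in> dif x" for e
    using that span_base by (fastforce simp: inner_commute)
  from eventually_cell[OF this] have "eventually (\<lambda>t::real. t > 0 \<and> x + t *\<^sub>R u \<in> cell x) (at_right 0)"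
    by (intro eventually_conj eventually_at_right_less) auto
  then obtain t :: real where "t > 0" "x + t *\<^sub>R u \<in> cell x"
    using eventually_happens by force
  then show ?thesis using u by auto
qed

text \<open>Links the definition by one-point strata with the dichotomy of active sets. At an edge
  point there is room to move orthogonally to the \<open>n\<close>-dimensional difference space; at
  any other curve point the differences span everything and pin the point down.\<close>

lemma vertex_iff: "x \<in> Ver \<longleftrightarrow> x \<in> Cur \<and> \<not> edge_pt x"
proof
  assume "x \<in> Ver"
  then show "x \<in> Cur \<and> \<not> edge_pt x"
    using edge_not_singleton by (auto simp: curve_vertices_def)
next
  assume x: "x \<in> Cur \<and> \<not> edge_pt x"
  then have "dim (dif x) = n + 1" by (metis curve_cases)
  then have "y = x" if "y \<in> cell x" for y
    using orthogonal_zero[of x "y - x"] cell_orthogonal[OF that] by simp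
  then show "x \<in> Ver" using x cell_self by (auto simp: curve_vertices_def)
qed

lemma edge_pt_dim: "edge_pt x \<Longrightarrow> dim (dif x) = n"
  using curve_cases[OF edge_pt_in_curve] by metis

lemma vertex_dim: "x \<in> Ver \<Longrightarrow> dim (dif x) = n + 1"
  using curve_cases vertex_iff by metis

lemma vertex_cases:
  assumes "x \<in> Ver"
  obtains i where "i < n" "card (act i x) = 3" "\<And>j. j < n \<Longrightarrow> j \<noteq> i \<Longrightarrow> card (act j x) = 2"
  using assms curve_cases vertex_iff by metis

lemma edge_direction:
  assumes "edge_pt x"
  obtains u where "u \<noteq> 0" "{w. \<forall>e\<in>dif x. e \<bullet> w = 0} = span {u}"
    "{w. u \<bullet> w = 0} = span (dif x)"
proof -
  let ?W = "{w. \<forall>e\<in>dif x. e \<bullet> w = 0}"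
  have dim: "dim (dif x) = n" using assms by (rule edge_pt_dim)
  have W: "?W = {y \<in> UNIV. \<forall>e\<in>span (dif x). orthogonal e y}"
  proof -
    have "e \<bullet> w = 0" if "e \<in> span (dif x)" "\<forall>e\<in>dif x. e \<bullet> w = 0" for e w
      using that(1) by (induction rule: span_induct_alt) (use that(2) in \<open>auto simp: inner_add_left\<close>)
    then show ?thesis by (auto simp: orthogonal_def span_base)
  qed
  have dW: "dim ?W = 1"
    using dim_subspace_orthogonal_to_vectors[of "span (dif x)" UNIV] dim card_m unfolding W by simp
  obtain u where u: "u \<noteq> 0" "span (dif x) \<subseteq> {y. u \<bullet> y = 0}"
    using lowdim_subset_hyperplane[of "dif x"] dim card_m by auto
  have subW: "subspace ?W" by (auto simp: subspace_def inner_add_right)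
  have "u \<in> ?W" using u span_base by (fastforce simp: inner_commute)
  then have 1: "span {u} = ?W"
    using u dW subW by (intro subspace_dim_equal) (auto simp: span_minimal)
  have "dim {y. u \<bullet> y = 0} = n" using dim_hyperplane[of u] u card_m by simp
  then have "span (dif x) = {y. u \<bullet> y = 0}"
    using u dim by (intro subspace_dim_equal) (auto simp: subspace_hyperplane)
  then show ?thesis using that u 1 by simp
qed


subsection \<open>The number of vertices\<close>

lemma inter_hyp_eq: "inter_hyp {..<n} A lam = Cur"
  by (simp add: curve_def)

lemma sum_card_act_le:
  assumes "x \<in> Cur"
  shows "(\<Sum>i<n. card (act i x) - 1) \<le> n + 1"
  using curve_cases[OF assms] dim_dif[OF assms] by (metis le_add1 le_refl)

text \<open>All cells together have dimension at most \<open>n + 1\<close>, and an omitted cell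
  takes away at least one.\<close>

lemma mink_vol_proper:
  assumes x: "x \<in> Cur" and S: "S \<subset> {..<n}"
  shows "mink_vol S (\<lambda>i. act i x) = 0"
proof (rule mink_vol_eq_0)
  show "finite S" using S finite_subset by blast
  show "finite (act i x) \<and> act i x \<noteq> {}" if "i \<in> S" for i
    using that S act_fin act_ne by blast
  obtain j where j: "j < n" "j \<notin> S" using S by auto
  have "(\<Sum>i\<in>S. card (act i x) - 1) + (card (act j x) - 1) = (\<Sum>i\<in>insert j S. card (act i x) - 1)"
    using j \<open>finite S\<close> by simp
  also have "\<dots> \<le> (\<Sum>i<n. card (act i x) - 1)"
    using S j by (intro sum_mono2) auto
  also have "\<dots> \<le> n + 1" by (rule sum_card_act_le[OF x])
  finally have "(\<Sum>i\<in>S. card (act i x) - 1) + (card (act j x) - 1) \<le> n + 1" .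
  moreover have "card (act j x) \<ge> 2" using x j by (simp add: curve_iff)
  ultimately show "(\<Sum>i\<in>S. card (act i x) - 1) < CARD('m)" unfolding card_m by linarith
qed

lemma mink_vol_edge:
  assumes "edge_pt x"
  shows "mink_vol {..<n} (\<lambda>i. act i x) = 0"
proof (rule mink_vol_eq_0)
  show "finite (act i x) \<and> act i x \<noteq> {}" if "i \<in> {..<n}" for i
    using that act_fin act_ne by blast
  show "(\<Sum>i<n. card (act i x) - 1) < CARD('m)"
    using assms by (simp add: edge_pt_def card_m)
qed simp

lemma mink_vol_vertex:
  assumes "x \<in> Ver"
  shows "mink_vol {..<n} (\<lambda>i. act i x) = 1 / 2"
  using assms smooth_curve unfolding smooth_curve_def int_mult_def active_prod mink_vol_def by force

lemma vertices_count:
  shows finite_vertices: "finite Ver"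
    and card_vertices: "card Ver = (\<Prod>i<n. d i) * (\<Sum>i<n. d i)"
proof -
  let ?Z = "{x \<in> inter_hyp {..<n} A lam. mink_vol {..<n} (\<lambda>i. act i x) \<noteq> 0}"
  have Z: "?Z = Ver"
  proof (rule set_eqI)
    fix x
    show "x \<in> ?Z \<longleftrightarrow> x \<in> Ver"
    proof (cases "x \<in> Ver")
      case True
      then show ?thesis using vertex_iff[of x] by (simp add: inter_hyp_eq mink_vol_vertex)
    next
      case False
      then show ?thesis using vertex_iff[of x] mink_vol_edge[of x] by (auto simp: inter_hyp_eq)
    qed
  qed
  have fin: "finite ?Z" and eq: "(\<Sum>S\<in>Pow {..<n}. (-1) ^ card ({..<n} - S) * mink_vol S A) =
      (\<Sum>x\<in>?Z. mink_vol {..<n} (\<lambda>i. act i x))"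
    by (rule mixed_volume_eq_sum; simp add: A_fin A_ne inter_hyp_eq mink_vol_proper)+
  show "finite Ver" using fin Z by simp
  have "(\<Sum>S\<in>Pow {..<n}. (-1) ^ card ({..<n} - S) * mink_vol S A) =
      (\<Sum>S\<in>Pow {..<n}. (-1) ^ card ({..<n} - S) * (\<Sum>i\<in>S. real (d i)) ^ Suc n) / fact (Suc n)"
    unfolding sum_divide_distrib
  proof (rule sum.cong[OF refl])
    fix S assume "S \<in> Pow {..<n}"
    then have "mink_vol S A = real (sum d S) ^ CARD('m) / fact CARD('m)"
      by (intro mink_vol_std_simplex) (auto simp: hull_A intro: finite_subset)
    then show "(-1) ^ card ({..<n} - S) * mink_vol S A =
        (-1) ^ card ({..<n} - S) * (\<Sum>i\<in>S. real (d i)) ^ Suc n / fact (Suc n)"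
      by (simp add: card_m)
  qed
  \<comment> \<open>The exponent \<open>n + 1\<close> is one more than the number of polynomials,
    which calls for the third polarization identity.\<close>
  also have "\<dots> = (\<Prod>i<n. real (d i)) * (\<Sum>i<n. real (d i)) / 2"
    using polarization_all(3)[of "{..<n}" "\<lambda>i. real (d i)"] by simp
  also have "(\<Sum>S\<in>Pow {..<n}. (-1) ^ card ({..<n} - S) * mink_vol S A) = real (card Ver) / 2"
    unfolding eq Z by (simp add: mink_vol_vertex)
  finally have "real (card Ver) = real ((\<Prod>i<n. d i) * (\<Sum>i<n. d i))" by simp
  then show "card Ver = (\<Prod>i<n. d i) * (\<Sum>i<n. d i)" by linarith
qed

lemma vertices_nonempty: "Ver \<noteq> {}"
proof -
  have "card Ver > 0" unfolding card_vertices
    using d_pos n_ge_2 by (auto simp: prod_pos_nat_iff lessThan_empty_iff intro!: sum_pos)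
  then show ?thesis by auto
qed

subsection \<open>Edges\<close>

lemma convex_cell: "convex (cell x)"
proof -
  have "cell x = (\<Inter>i\<in>{..<n}. {y. act i y = act i x})" by (auto simp: cell_iff)
  then show ?thesis
    by (auto intro!: convex_INT convex_active_eq A_fin A_ne)
qed

lemma closure_cell_act:
  assumes "z \<in> closure (cell x)" "i < n"
  shows "act i x \<subseteq> act i z"
proof
  fix a assume "a \<in> act i x"
  then show "a \<in> act i z"
    using assms by (intro active_closure[OF A_fin[OF assms(2)] assms(1)]) (auto simp: cell_iff)
qed

text \<open>Active sets can only grow in the limit. If they keep two elements each they are
  unchanged; otherwise the limit is a curve point that is not an edge point.\<close>

lemma closure_edge_cases:
  assumes z: "z \<in> closure (cell x)" and x: "edge_pt x"
  shows "z \<in> cell x \<or> z \<in> Ver"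
proof -
  have sub: "act i x \<subseteq> act i z" if "i < n" for i using closure_cell_act[OF z that] .
  have "2 \<le> card (act i z)" if "i < n" for i
    using card_mono[OF act_fin[OF that] sub[OF that]] x that by (simp add: edge_pt_def)
  then have "z \<in> Cur" by (simp add: curve_iff)
  moreover have "z \<in> cell x" if "edge_pt z"
    unfolding cell_iff
  proof clarify
    fix i assume i: "i < n"
    then show "act i z = act i x"
      using card_subset_eq[OF act_fin[OF i] sub[OF i]] x that by (simp add: edge_pt_def)
  qed
  ultimately show ?thesis by (auto simp: vertex_iff)
qed

section \<open>Ends of edges and directions of rays\<close>

lemma cell_line_interval:
  assumes "x + s *\<^sub>R u \<in> cell y" "x + t *\<^sub>R u \<in> cell y" "s \<le> r" "r \<le> t"
  shows "x + r *\<^sub>R u \<in> cell y"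
proof -
  have "x + r *\<^sub>R u \<in> closed_segment (x + s *\<^sub>R u) (x + t *\<^sub>R u)"
  proof (cases "s = t")
    case False
    then have st: "s < t" using assms by simp
    define k where "k = (r - s) / (t - s)"
    have k: "0 \<le> k" "k \<le> 1" using assms st by (auto simp: k_def)
    have "k * (t - s) = r - s" using st by (simp add: k_def)
    then have "r = (1 - k) * s + k * t" by (simp add: algebra_simps)
    moreover have "(1 - k) *\<^sub>R (x + s *\<^sub>R u) + k *\<^sub>R (x + t *\<^sub>R u) = x + ((1 - k) * s + k * t) *\<^sub>R u"
      by (simp add: algebra_simps)
    ultimately have "x + r *\<^sub>R u = (1 - k) *\<^sub>R (x + s *\<^sub>R u) + k *\<^sub>R (x + t *\<^sub>R u)"
      by simp
    then show ?thesis using k by (auto simp: closed_segment_def)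
  qed (use assms in auto)
  then show ?thesis
    using convex_contains_segment[of "cell y"] convex_cell assms by blast
qed

text \<open>\<open>T\<close> is the first parameter at which the line leaves the cell. The exit
  point lies in the closure but not in the cell, so it is a vertex.\<close>

lemma edge_end_cases:
  assumes x: "edge_pt x" and u: "\<And>e. e \<in> dif x \<Longrightarrow> e \<bullet> u = 0"
  obtains (ray) "\<And>t. t \<ge> 0 \<Longrightarrow> x + t *\<^sub>R u \<in> cell x"
    | (vertex) T where "T > 0" "x + T *\<^sub>R u \<in> Ver"
      "\<And>t. 0 \<le> t \<Longrightarrow> x + t *\<^sub>R u \<in> cell x \<longleftrightarrow> t < T"
proof (cases "\<forall>t\<ge>0. x + t *\<^sub>R u \<in> cell x")
  case True
  then show ?thesis using ray by blast
next
  case False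
  define B where "B = {t. t \<ge> 0 \<and> x + t *\<^sub>R u \<notin> cell x}"
  define T where "T = Inf B"
  have B: "B \<noteq> {}" "bdd_below B" using False by (auto simp: B_def intro!: bdd_belowI[of _ 0])
  have below: "x + t *\<^sub>R u \<in> cell x" if "0 \<le> t" "t < T" for t
    using that cInf_lower[of t B] B by (force simp: B_def T_def)
  \<comment> \<open>The cell is open along the line and convex, so a parameter inside it is strictly
    below \<open>T\<close>; in particular the exit point is outside.\<close>
  have extend: "T > r" if r: "r \<ge> 0" "x + r *\<^sub>R u \<in> cell x" for r
  proof -
    have "dif (x + r *\<^sub>R u) = dif x" using dif_cell[OF r(2)] .
    then have "eventually (\<lambda>t. (x + r *\<^sub>R u) + t *\<^sub>R u \<in> cell (x + r *\<^sub>R u)) (at_right 0)"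
      using u by (intro eventually_cell) auto
    then have "eventually (\<lambda>t::real. t > 0 \<and> (x + r *\<^sub>R u) + t *\<^sub>R u \<in> cell (x + r *\<^sub>R u)) (at_right 0)"
      by (intro eventually_conj eventually_at_right_less)
    then obtain t :: real where t: "t > 0" "(x + r *\<^sub>R u) + t *\<^sub>R u \<in> cell (x + r *\<^sub>R u)"
      using eventually_happens'[OF trivial_limit_at_right_real] by blast
    have in_cell: "x + (r + t) *\<^sub>R u \<in> cell x"
      using t(2) cell_eqI[OF r(2)] by (simp add: algebra_simps)
    have "r + t \<le> b" if "b \<in> B" for b
    proof (rule ccontr)
      assume "\<not> r + t \<le> b"
      then have "x + b *\<^sub>R u \<in> cell x"
        using that in_cell cell_self[of x] by (intro cell_line_interval[of x 0 u x "r + t" b]) (auto simp: B_def)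
      then show False using that by (simp add: B_def)
    qed
    then have "r + t \<le> T" unfolding T_def using B by (intro cInf_greatest) auto
    then show ?thesis using t by simp
  qed
  have T0: "T > 0" using extend[of 0] cell_self by simp
  have notT: "x + t *\<^sub>R u \<notin> cell x" if "t \<ge> T" for t
    using extend[of t] that T0 by force
  have "x + T *\<^sub>R u \<in> closure (cell x)"
  proof (rule Lim_in_closed_set[OF closed_closure])
    show "((\<lambda>t. x + t *\<^sub>R u) \<longlongrightarrow> x + T *\<^sub>R u) (at_left T)" by (intro tendsto_intros)
    have "eventually (\<lambda>t. t \<in> {0<..<T}) (at_left T)" using T0 by (rule eventually_at_leftI[rotated]) auto
    then show "eventually (\<lambda>t. x + t *\<^sub>R u \<in> closure (cell x)) (at_left T)"
      by (rule eventually_mono) (auto intro!: below subsetD[OF closure_subset])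
  qed simp
  then have "x + T *\<^sub>R u \<in> Ver" using closure_edge_cases[OF _ x] notT[of T] by blast
  then show ?thesis using vertex[of T] T0 below notT by (meson not_le)
qed

text \<open>Monomials that stay active along a whole ray maximize \<open>u\<close> on the Newton
  polytope. The faces of a standard simplex are so special that lying on the face selected by
  \<open>u\<close> makes either some e_j or (1, ..., 1) orthogonal to all differences, and the
  orthogonal complement is the line of \<open>u\<close>.\<close>

lemma ray_direction:
  assumes x: "edge_pt x" and u0: "u \<noteq> 0" and span: "{w. \<forall>e\<in>dif x. e \<bullet> w = 0} = span {u}"
    and ray: "\<And>t. t \<ge> 0 \<Longrightarrow> x + t *\<^sub>R u \<in> cell x"
  obtains (plus) s where "s > 0" "u = s *\<^sub>R vec 1"
    | (minus) s j where "s > 0" "u = - s *\<^sub>R axis j 1"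
proof -
  \<comment> \<open>The support function of the unit simplex: the maximum of
    \<open>a \<bullet> u\<close> over \<open>std_simplex (d i)\<close> is
    \<open>c * d i\<close>.\<close>
  define c where "c = Max (insert 0 (range (($) u)))"
  have c0: "0 \<le> c" unfolding c_def by (rule Max_ge) auto
  have cu: "u $ j \<le> c" for j unfolding c_def by (rule Max_ge) auto
  have c_attained: "c = 0 \<or> (\<exists>j. u $ j = c)"
    using Max_in[of "insert 0 (range (($) u))"] by (auto simp: c_def)
  \<comment> \<open>A monomial with larger slope along \<open>u\<close> would overtake
    \<open>p\<close> at the parameter \<open>t\<close>.\<close>
  have max: "a \<bullet> u \<le> p \<bullet> u" if i: "i < n" and p: "p \<in> act i x" and a: "a \<in> std_simplex (d i)" for i p a
  proof -
    have "b \<bullet> u \<le> p \<bullet> u" if b: "b \<in> A i" for b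
    proof (rule ccontr)
      assume less: "\<not> b \<bullet> u \<le> p \<bullet> u"
      define K where "K = (lam i p + p \<bullet> x) - (lam i b + b \<bullet> x)"
      define t where "t = (\<bar>K\<bar> + 1) / (b \<bullet> u - p \<bullet> u)"
      have t: "t \<ge> 0" using less by (simp add: t_def)
      have "p \<in> act i (x + t *\<^sub>R u)" using ray[OF t] p i by (simp add: cell_iff)
      then have "lam i b + b \<bullet> (x + t *\<^sub>R u) \<le> lam i p + p \<bullet> (x + t *\<^sub>R u)"
        using b i by (simp add: active_iff[OF A_fin[OF i]])
      then have "t * (b \<bullet> u - p \<bullet> u) \<le> K"
        by (simp add: K_def inner_add_right algebra_simps)
      then show False using less by (simp add: t_def)
    qed
    moreover have "a \<in> convex hull (A i)" using a hull_A[OF i] by simp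
    ultimately show ?thesis by (metis convex_hull_inner_le)
  qed
  have face: "(\<forall>j. u $ j < c \<longrightarrow> p $ j = 0) \<and> (c > 0 \<longrightarrow> (\<Sum>j\<in>UNIV. p $ j) = d i)"
    if i: "i < n" and p: "p \<in> act i x" for i p
  proof -
    have "p \<in> convex hull (A i)" using p act_sub by (meson hull_inc subsetD)
    then have "p \<in> std_simplex (d i)" using hull_A[OF i] by simp
    then have p_ge: "0 \<le> p $ j" and p_le: "(\<Sum>j\<in>UNIV. p $ j) \<le> d i" for j
      by (auto simp: mem_std_simplex)
    have "c * d i \<le> p \<bullet> u"
    proof (cases "c = 0")
      case True
      have "(0::real^'m) \<in> std_simplex (d i)" by (simp add: mem_std_simplex)
      then show ?thesis using max[OF i p] True by force
    next
      case False
      then obtain j where j: "u $ j = c" using c_attained by auto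
      have "real (d i) *\<^sub>R axis j 1 \<in> (std_simplex (d i) :: (real^'m) set)"
        by (auto simp: mem_std_simplex axis_def if_distrib sum.delta cong: if_cong)
      from max[OF i p this] j show ?thesis by (simp add: inner_axis' mult.commute)
    qed
    \<comment> \<open>The gap between the maximum over the simplex and the value at \<open>p\<close>
      splits into two nonnegative terms; maximality of \<open>p\<close> makes the gap nonpositive,
      so both vanish.\<close>
    moreover have "c * d i - p \<bullet> u = (\<Sum>j\<in>UNIV. p $ j * (c - u $ j)) + c * (d i - (\<Sum>j\<in>UNIV. p $ j))"
      by (simp add: inner_vec_def algebra_simps sum_subtractf sum_distrib_left)
    moreover have "0 \<le> (\<Sum>j\<in>UNIV. p $ j * (c - u $ j))"
      using p_ge cu by (intro sum_nonneg mult_nonneg_nonneg) auto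
    moreover have "0 \<le> c * (d i - (\<Sum>j\<in>UNIV. p $ j))" using c0 p_le by simp
    ultimately have "(\<Sum>j\<in>UNIV. p $ j * (c - u $ j)) = 0" "c * (d i - (\<Sum>j\<in>UNIV. p $ j)) = 0" by linarith+
    moreover from this(1) have "\<forall>j\<in>UNIV. p $ j * (c - u $ j) = 0"
      using p_ge cu by (subst (asm) sum_nonneg_eq_0_iff) auto
    ultimately show ?thesis by auto
  qed
  have orth: "w \<in> span {u}" if w: "\<And>i p q. i < n \<Longrightarrow> p \<in> act i x \<Longrightarrow> q \<in> act i x \<Longrightarrow> p \<bullet> w = q \<bullet> w" for w
  proof -
    have "e \<bullet> w = 0" if e: "e \<in> dif x" for e
    proof -
      obtain i p q where "i < n" "p \<in> act i x" "q \<in> act i x" "e = p - q"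
        using e by (auto simp: dif_def differences_def)
      then show ?thesis using w[of i p q] by (simp add: inner_diff_left)
    qed
    then show ?thesis unfolding span[symmetric] by blast
  qed
  show ?thesis
  proof (cases "c = 0")
    case True
    obtain j where "u $ j \<noteq> 0" using u0 by (auto simp: vec_eq_iff)
    then have j: "u $ j < 0" using cu[of j] True by simp
    \<comment> \<open>All active monomials have \<open>j\<close>-th coordinate 0, so e_j is
      orthogonal to their differences.\<close>
    have "axis j 1 \<in> span {u}"
      using face j True by (intro orth) (simp add: inner_axis)
    then obtain k where k: "axis j 1 = k *\<^sub>R u" by (auto simp: span_singleton)
    have "k * u $ j = 1" using arg_cong[OF k, of "\<lambda>v. v $ j"] by (simp add: axis_def)
    then have "u = - (- u $ j) *\<^sub>R axis j 1" unfolding k by (simp add: mult.commute)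
    then show ?thesis using minus[of "- u $ j" j] j by simp
  next
    case False
    then have c: "c > 0" using c0 by simp
    then obtain j where j: "u $ j = c" using c_attained by auto
    \<comment> \<open>The active monomials of each polynomial share the coordinate sum
      \<open>d i\<close>.\<close>
    have "vec 1 \<in> span {u}"
      using face c by (intro orth) (simp add: inner_vec_def)
    then obtain k where k: "vec 1 = k *\<^sub>R u" by (auto simp: span_singleton)
    have "k * u $ j = 1" using arg_cong[OF k, of "\<lambda>v. v $ j"] by simp
    then have "u = c *\<^sub>R vec 1" unfolding k j by (simp add: mult.commute)
    then show ?thesis using plus[of c] c by simp
  qed
qed

text \<open>Both \<open>u\<close> and \<open>- u\<close> would have to be among the possible ray
  directions, and these contain no opposite pair when there are at least two coordinates.\<close>

lemma no_line:
  assumes x: "edge_pt x" and u0: "u \<noteq> 0" and span: "{w. \<forall>e\<in>dif x. e \<bullet> w = 0} = span {u}"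
    and ray1: "\<And>t. t \<ge> 0 \<Longrightarrow> x + t *\<^sub>R u \<in> cell x"
    and ray2: "\<And>t. t \<ge> 0 \<Longrightarrow> x + t *\<^sub>R (- u) \<in> cell x"
  shows False
proof -
  have other: "\<exists>k::'m. k \<noteq> j" for j
  proof (rule ccontr)
    assume "\<nexists>k. k \<noteq> j"
    then have "(UNIV :: 'm set) = {j}" by auto
    then have "CARD('m) = card {j}" by (simp only:)
    then show False using card_m n_ge_2 by simp
  qed
  have span': "{w. \<forall>e\<in>dif x. e \<bullet> w = 0} = span {- u}"
    using span span_image_scale[of "{u}" "\<lambda>_. -1"] by simp
  have u0': "- u \<noteq> 0" using u0 by simp
  have "u = s *\<^sub>R vec 1 \<Longrightarrow> u $ k = s" "u = - s *\<^sub>R axis j 1 \<Longrightarrow> u $ k = (if k = j then - s else 0)"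
    for u :: "real^'m" and s k j by (auto simp: axis_def)
  note comp = this
  show False
  proof (rule ray_direction[OF x u0 span ray1])
    fix s assume s: "s > 0" "u = s *\<^sub>R vec 1"
    show False
    proof (rule ray_direction[OF x u0' span' ray2])
      fix s' assume s': "s' > 0" "- u = s' *\<^sub>R vec 1"
      \<comment> \<open>\<open>undefined\<close> stands for an arbitrary coordinate; any of them
        gives \<open>s = - s'\<close>.\<close>
      show False
        using comp(1)[OF s(2), of undefined] comp(1)[OF s'(2), of undefined] s(1) s'(1) by simp
    next
      fix s' j assume s': "s' > 0" "- u = - s' *\<^sub>R axis j 1"
      obtain k where "k \<noteq> j" using other by blast
      then show False using s(1) comp(1)[OF s(2), of k] comp(2)[OF s'(2), of k] by simp
    qed
  next
    fix s j assume s: "s > 0" "u = - s *\<^sub>R axis j 1"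
    show False
    proof (rule ray_direction[OF x u0' span' ray2])
      fix s' assume s': "s' > 0" "- u = s' *\<^sub>R vec 1"
      obtain k where "k \<noteq> j" using other by blast
      then show False using s'(1) comp(2)[OF s(2), of k] comp(1)[OF s'(2), of k] by simp
    next
      fix s' j' assume s': "s' > 0" "- u = - s' *\<^sub>R axis j' 1"
      show False using s(1) s'(1) comp(2)[OF s(2), of j] comp(2)[OF s'(2), of j] by (simp split: if_splits)
    qed
  qed
qed

text \<open>An edge is followed from \<open>x\<close> in both directions. Each way ends in a vertex
  or goes on forever, and \<open>no_line\<close> excludes the latter on both sides.\<close>

lemma edge_shape:
  assumes x: "edge_pt x"
  obtains (bounded) v w where "v \<noteq> w" "v \<in> Ver" "w \<in> Ver" "Ver \<inter> closure (cell x) = {v, w}"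
      "cell x \<subseteq> closed_segment v w"
    | (ray) v u where "u \<noteq> 0" "v \<in> Ver" "Ver \<inter> closure (cell x) = {v}"
      "cell x = {v + t *\<^sub>R u | t. t > 0}" "{w. \<forall>e\<in>dif x. e \<bullet> w = 0} = span {u}"
proof -
  obtain u where u: "u \<noteq> 0" "{w. \<forall>e\<in>dif x. e \<bullet> w = 0} = span {u}"
    by (rule edge_direction[OF x])
  have orth: "e \<bullet> u = 0" "e \<bullet> (- u) = 0" if "e \<in> dif x" for e
    using u(2) that span_base[of u "{u}"] by auto
  have line: "\<exists>t. y = x + t *\<^sub>R u" if "y \<in> cell x" for y
  proof -
    have "y - x \<in> span {u}" using cell_orthogonal[OF that] u(2) by blast
    then obtain k where "y - x = k *\<^sub>R u" by (auto simp: span_singleton)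
    then show ?thesis by (intro exI[of _ k]) (simp add: algebra_simps)
  qed
  have ver_cell: "v \<notin> cell x" if "v \<in> Ver" for v
    using that x edge_pt_cell by (auto simp: vertex_iff)
  have closed_line: "closed {x + t *\<^sub>R u | t. t \<in> I}" if "closed I" for I
  proof -
    have "{x + t *\<^sub>R u | t. t \<in> I} = (+) x ` ((\<lambda>t. t *\<^sub>R u) ` I)" by auto
    moreover have "closed ((\<lambda>t. t *\<^sub>R u) ` I)"
      using that u(1) by (intro closed_injective_linear_image) (auto simp: linear_scaleR_left inj_on_def)
    ultimately show ?thesis by (simp add: closed_translation)
  qed
  \<comment> \<open>Serves both cases with exactly one end: \<open>w\<close> points towards
    infinity, and the vertex sits at parameter \<open>- T\<close>.\<close>
  have half: thesis
    if w: "w \<noteq> 0" "{z. \<forall>e\<in>dif x. e \<bullet> z = 0} = span {w}" "\<And>y. y \<in> cell x \<Longrightarrow> \<exists>t. y = x + t *\<^sub>R w"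
      and closed: "\<And>I. closed I \<Longrightarrow> closed {x + t *\<^sub>R w | t. t \<in> I}"
      and up: "\<And>t. t \<ge> 0 \<Longrightarrow> x + t *\<^sub>R w \<in> cell x"
      and T: "T > 0" "x + T *\<^sub>R (- w) \<in> Ver"
        "\<And>t. 0 \<le> t \<Longrightarrow> x + t *\<^sub>R (- w) \<in> cell x \<longleftrightarrow> t < T" for w T
  proof -
    let ?v = "x + T *\<^sub>R (- w)"
    have iff: "x + t *\<^sub>R w \<in> cell x \<longleftrightarrow> t > - T" for t
      using up[of t] T(1) T(3)[of "- t"] by (cases "t \<ge> 0") auto
    have eq: "cell x = {x + t *\<^sub>R w | t. t > - T}"
    proof (intro set_eqI iffI)
      fix y assume y: "y \<in> cell x"
      then obtain t where "y = x + t *\<^sub>R w" using w(3) by blast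
      then show "y \<in> {x + t *\<^sub>R w | t. t > - T}" using y iff[of t] by blast
    qed (use iff in auto)
    have cl: "closure (cell x) \<subseteq> {x + t *\<^sub>R w | t. t \<in> {- T..}}"
      unfolding eq by (intro closure_minimal closed) auto
    have vcl: "?v \<in> closure (cell x)"
    proof (rule Lim_in_closed_set[OF closed_closure])
      show "((\<lambda>t. x + t *\<^sub>R w) \<longlongrightarrow> ?v) (at_right (- T))"
        by (rule tendsto_eq_intros refl | simp)+
      have "eventually (\<lambda>t. t > - T) (at_right (- T))" by (rule eventually_at_right_less)
      then show "eventually (\<lambda>t. x + t *\<^sub>R w \<in> closure (cell x)) (at_right (- T))"
        by (rule eventually_mono) (use iff closure_subset in blast)
    qed simp
    have Vt: "t = - T" if "x + t *\<^sub>R w \<in> Ver" "t \<in> {- T..}" for t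
      using that ver_cell[OF that(1)] iff[of t] by auto
    have "Ver \<inter> closure (cell x) = {?v}"
    proof
      show "Ver \<inter> closure (cell x) \<subseteq> {?v}"
      proof
        fix y assume y: "y \<in> Ver \<inter> closure (cell x)"
        then obtain t where t: "y = x + t *\<^sub>R w" "t \<in> {- T..}" using cl by blast
        then show "y \<in> {?v}" using y Vt[of t] by simp
      qed
      show "{?v} \<subseteq> Ver \<inter> closure (cell x)" using T(2) vcl by blast
    qed
    moreover have "cell x = {?v + t *\<^sub>R w | t. t > 0}"
    proof -
      show ?thesis unfolding eq
      proof (intro set_eqI iffI)
        fix y assume "y \<in> {x + t *\<^sub>R w | t. t > - T}"
        then obtain t where "y = x + t *\<^sub>R w" "t > - T" by blast
        then show "y \<in> {?v + t *\<^sub>R w | t. t > 0}"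
          by (intro CollectI exI[of _ "t + T"] conjI) (simp_all add: algebra_simps)
      next
        fix y assume "y \<in> {?v + t *\<^sub>R w | t. t > 0}"
        then obtain t where "y = ?v + t *\<^sub>R w" "t > 0" by blast
        then show "y \<in> {x + t *\<^sub>R w | t. t > - T}"
          by (intro CollectI exI[of _ "t - T"] conjI) (simp_all add: algebra_simps)
      qed
    qed
    ultimately show thesis using ray[of w ?v] w T(2) by blast
  qed
  have neg_line: "\<exists>t. y = x + t *\<^sub>R (- u)" if "y \<in> cell x" for y
    using line[OF that] by (metis minus_minus scaleR_minus_left scaleR_minus_right)
  have closed_neg: "closed {x + t *\<^sub>R (- u) | t. t \<in> I}" if "closed I" for I
  proof -
    have "{x + t *\<^sub>R (- u) | t. t \<in> I} = {x + t *\<^sub>R u | t. t \<in> uminus ` I}" by force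
    moreover have "closed (uminus ` I)" using closed_negations[OF that] by simp
    ultimately show ?thesis by (simp only: closed_line)
  qed
  have span': "{w. \<forall>e\<in>dif x. e \<bullet> w = 0} = span {- u}"
    using u(2) span_image_scale[of "{u}" "\<lambda>_. -1"] by simp
  show thesis
  proof (rule edge_end_cases[OF x orth(1)])
    assume up: "\<And>t. 0 \<le> t \<Longrightarrow> x + t *\<^sub>R u \<in> cell x"
    show thesis
    proof (rule edge_end_cases[OF x orth(2)])
      assume "\<And>t. 0 \<le> t \<Longrightarrow> x + t *\<^sub>R (- u) \<in> cell x"
      then show thesis using no_line[OF x u up] by blast
    next
      fix T assume T: "T > 0" "x + T *\<^sub>R (- u) \<in> Ver" "\<And>t. 0 \<le> t \<Longrightarrow> x + t *\<^sub>R (- u) \<in> cell x \<longleftrightarrow> t < T"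
      show thesis
        by (rule half[OF u]) (erule line closed_line up T(3) | rule T(1,2))+
    qed
  next
    fix T assume T: "T > 0" "x + T *\<^sub>R u \<in> Ver" "\<And>t. 0 \<le> t \<Longrightarrow> x + t *\<^sub>R u \<in> cell x \<longleftrightarrow> t < T"
    show thesis
    proof (rule edge_end_cases[OF x orth(2)])
      assume up: "\<And>t. 0 \<le> t \<Longrightarrow> x + t *\<^sub>R (- u) \<in> cell x"
      show thesis
        by (rule half[OF _ span'])
           (erule neg_line closed_neg up | rule T(1) | simp add: u(1) T)+
    next
      fix T' assume T': "T' > 0" "x + T' *\<^sub>R (- u) \<in> Ver"
        "\<And>t. 0 \<le> t \<Longrightarrow> x + t *\<^sub>R (- u) \<in> cell x \<longleftrightarrow> t < T'"
      let ?v = "x + (- T') *\<^sub>R u" and ?w = "x + T *\<^sub>R u"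
      have iff: "x + t *\<^sub>R u \<in> cell x \<longleftrightarrow> - T' < t \<and> t < T" for t
        using T(1) T(3)[of t] T'(1) T'(3)[of "- t"] by (cases "t \<ge> 0") auto
      have sub: "cell x \<subseteq> {x + t *\<^sub>R u | t. t \<in> {- T'..T}}"
      proof
        fix y assume y: "y \<in> cell x"
        then obtain t where "y = x + t *\<^sub>R u" using line by blast
        then show "y \<in> {x + t *\<^sub>R u | t. t \<in> {- T'..T}}" using y iff[of t] by auto
      qed
      have cl: "closure (cell x) \<subseteq> {x + t *\<^sub>R u | t. t \<in> {- T'..T}}"
        by (intro closure_minimal sub closed_line) auto
      have lim: "x + T0 *\<^sub>R u \<in> closure (cell x)" if "T0 \<in> {- T', T}" for T0
      proof (rule Lim_in_closed_set[OF closed_closure])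
        have "- T' < T" using T(1) T'(1) by simp
        then show "at T0 within {- T'<..<T} \<noteq> bot"
          using that by (auto simp: trivial_limit_within islimpt_greaterThanLessThan1 islimpt_greaterThanLessThan2)
        show "((\<lambda>t. x + t *\<^sub>R u) \<longlongrightarrow> x + T0 *\<^sub>R u) (at T0 within {- T'<..<T})"
          by (intro tendsto_intros)
        show "eventually (\<lambda>t. x + t *\<^sub>R u \<in> closure (cell x)) (at T0 within {- T'<..<T})"
          unfolding eventually_at_filter
          by (auto simp: iff intro!: always_eventually subsetD[OF closure_subset])
      qed
      have Vt: "t = - T' \<or> t = T" if "x + t *\<^sub>R u \<in> Ver" "t \<in> {- T'..T}" for t
        using that ver_cell[OF that(1)] iff[of t] by auto
      have vw: "?v \<in> Ver" "?w \<in> Ver" using T T' by simp_all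
      have "Ver \<inter> closure (cell x) = {?v, ?w}"
      proof
        show "Ver \<inter> closure (cell x) \<subseteq> {?v, ?w}" using cl Vt by blast
        show "{?v, ?w} \<subseteq> Ver \<inter> closure (cell x)" using vw lim by blast
      qed
      moreover have "?v \<noteq> ?w"
      proof
        assume "?v = ?w"
        then have "(T + T') *\<^sub>R u = 0" by (simp add: algebra_simps)
        then show False using u(1) T(1) T'(1) by simp
      qed
      moreover have "cell x \<subseteq> closed_segment ?v ?w"
      proof
        fix y assume "y \<in> cell x"
        then obtain t where t: "y = x + t *\<^sub>R u" "- T' \<le> t" "t \<le> T" using sub by auto
        define k where "k = (t + T') / (T + T')"
        have pos: "T + T' > 0" using T(1) T'(1) by simp
        have k: "0 \<le> k" "k \<le> 1" using t pos by (auto simp: k_def)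
        have "k * (T + T') = t + T'" using pos by (simp add: k_def)
        then have "t = (1 - k) * (- T') + k * T" by (simp add: algebra_simps)
        moreover have "(1 - k) *\<^sub>R ?v + k *\<^sub>R ?w = x + ((1 - k) * (- T') + k * T) *\<^sub>R u"
          by (simp add: algebra_simps)
        ultimately have "y = (1 - k) *\<^sub>R ?v + k *\<^sub>R ?w"
          using t(1) by simp
        with k show "y \<in> closed_segment ?v ?w" by (auto simp: closed_segment_def)
      qed
      ultimately show thesis using bounded[of ?v ?w] vw by blast
    qed
  qed
qed


section \<open>Incidences between vertices and edges\<close>

definition edges :: "(real^'m) set set" where
  "edges = {cell x | x. edge_pt x}"

lemma finite_edges: "finite edges"
proof (rule finite_subset)
  show "edges \<subseteq> (\<lambda>g. {y. \<forall>i<n. act i y = g i}) ` (PiE {..<n} (\<lambda>i. Pow (A i)))"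
  proof
    fix e assume "e \<in> edges"
    then obtain x where "e = cell x" by (auto simp: edges_def)
    then have "e = {y. \<forall>i<n. act i y = restrict (\<lambda>i. act i x) {..<n} i}"
      by (auto simp: cell_iff)
    moreover have "restrict (\<lambda>i. act i x) {..<n} \<in> PiE {..<n} (\<lambda>i. Pow (A i))"
      using subsetD[OF act_sub] by (auto simp: restrict_def)
    ultimately show "e \<in> (\<lambda>g. {y. \<forall>i<n. act i y = g i}) ` (PiE {..<n} (\<lambda>i. Pow (A i)))" by blast
  qed
  show "finite ((\<lambda>g. {y. \<forall>i<n. act i y = g i}) ` (PiE {..<n} (\<lambda>i. Pow (A i))))"
    by (intro finite_imageI finite_PiE) (auto simp: A_fin)
qed

lemma aff_dim_cell_edge:
  assumes x: "edge_pt x"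
  shows "aff_dim (cell x) = 1"
proof -
  obtain u where u: "u \<noteq> 0" "{w. \<forall>e\<in>dif x. e \<bullet> w = 0} = span {u}"
    by (rule edge_direction[OF x])
  have "cell x \<subseteq> affine hull {x, x + u}"
  proof
    fix y assume y: "y \<in> cell x"
    have "y - x \<in> span {u}" using cell_orthogonal[OF y] unfolding u(2)[symmetric] by blast
    then obtain k where "y - x = k *\<^sub>R u" by (auto simp: span_singleton)
    then have "y = (1 - k) *\<^sub>R x + k *\<^sub>R (x + u)" by (simp add: algebra_simps)
    then show "y \<in> affine hull {x, x + u}"
      unfolding affine_hull_2 by (intro CollectI exI[of _ "1 - k"] exI[of _ k]) simp
  qed
  then have "aff_dim (cell x) \<le> 1"
    using aff_dim_subset[of "cell x" "affine hull {x, x + u}"] u(1) by (simp add: aff_dim_affine_hull aff_dim_2)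
  moreover obtain y where y: "y \<in> cell x" "y \<noteq> x"
    using edge_not_singleton[OF x] cell_self[of x] by blast
  then have "aff_dim {x, y} \<le> aff_dim (cell x)"
    using cell_self by (intro aff_dim_subset) auto
  ultimately show ?thesis using y(2) by (simp add: aff_dim_2)
qed

lemma bounded_edges_eq: "curve_bounded_edges n A lam = {e \<in> edges. bounded e}"
proof -
  have "edge_pt x" if "x \<in> Cur" "aff_dim (cell x) = 1" for x
  proof (rule ccontr)
    assume "\<not> edge_pt x"
    then have "x \<in> Ver" using that by (simp add: vertex_iff)
    then have "cell x = {x}" by (simp add: curve_vertices_def)
    then show False using that by simp
  qed
  then show ?thesis
    unfolding curve_bounded_edges_def edges_def
    using aff_dim_cell_edge edge_pt_in_curve by blast
qed

lemma ray_unbounded: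
  fixes u v :: "real^'m"
  assumes "u \<noteq> 0"
  shows "\<not> bounded {v + t *\<^sub>R u | t. t > 0}"
proof
  assume "bounded {v + t *\<^sub>R u | t. t > 0}"
  then obtain B where B: "\<And>t. t > 0 \<Longrightarrow> norm (v + t *\<^sub>R u) \<le> B"
    unfolding bounded_iff by blast
  define t where "t = (\<bar>B\<bar> + norm v + 1) / norm u"
  have t: "t > 0" using assms by (simp add: t_def add_nonneg_pos)
  have "norm (t *\<^sub>R u) \<le> norm (v + t *\<^sub>R u) + norm v"
    using norm_triangle_ineq4[of "v + t *\<^sub>R u" v] by simp
  also have "\<dots> \<le> B + norm v" using B[OF t] by simp
  finally have "t * norm u \<le> B + norm v" using t by simp
  then show False using assms by (simp add: t_def)
qed

lemma bounded_edge_vertices: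
  assumes "e \<in> edges" "bounded e"
  obtains v w where "v \<noteq> w" "Ver \<inter> closure e = {v, w}"
proof -
  obtain x where x: "edge_pt x" "e = cell x" using assms by (auto simp: edges_def)
  show ?thesis
  proof (rule edge_shape[OF x(1)])
    fix v w assume "v \<noteq> w" "Ver \<inter> closure (cell x) = {v, w}"
    then show ?thesis using that x by simp
  next
    fix v u assume "u \<noteq> 0" "cell x = {v + t *\<^sub>R u | t. t > 0}"
    then show ?thesis using assms x ray_unbounded by simp
  qed
qed

lemma unbounded_edge_ray:
  assumes "edge_pt x" "\<not> bounded (cell x)"
  obtains v u where "u \<noteq> 0" "v \<in> Ver" "Ver \<inter> closure (cell x) = {v}"
      "cell x = {v + t *\<^sub>R u | t. t > 0}" "{w. \<forall>e\<in>dif x. e \<bullet> w = 0} = span {u}"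
proof (rule edge_shape[OF assms(1)])
  fix v w assume "cell x \<subseteq> closed_segment v w"
  then have "bounded (cell x)" using bounded_subset bounded_closed_segment by blast
  then show ?thesis using assms by simp
qed (rule that)

lemma bounded_edge_card: "e \<in> edges \<Longrightarrow> bounded e \<Longrightarrow> card (Ver \<inter> closure e) = 2"
  by (metis bounded_edge_vertices card_2_iff)

lemma unbounded_edge_card:
  assumes "e \<in> edges" "\<not> bounded e"
  shows "card (Ver \<inter> closure e) = 1"
proof -
  obtain x where x: "edge_pt x" "e = cell x" using assms by (auto simp: edges_def)
  show ?thesis
    by (rule unbounded_edge_ray[of x]) (use assms x in auto)
qed

text \<open>The edges at \<open>v\<close> correspond to the sides of its dual triangle. A side
  arises by dropping one corner \<open>c\<close>, and it occurs because some direction away from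
  \<open>v\<close> lowers the monomial \<open>c\<close> alone while all other active ones stay
  tied.\<close>

lemma edges_at_vertex:
  assumes v: "v \<in> Ver"
  shows "card {e \<in> edges. v \<in> closure e} = 3"
proof -
  obtain k where k: "k < n" "card (act k v) = 3" and two: "\<And>j. j < n \<Longrightarrow> j \<noteq> k \<Longrightarrow> card (act j v) = 2"
    by (rule vertex_cases[OF v]) (rule that, assumption+)
  \<comment> \<open>The active sets expected on the edge that belongs to the corner
    \<open>c\<close>: the triangle loses \<open>c\<close>, the segments remain.\<close>
  define B where "B c i = (if i = k then act k v - {c} else act i v)" for c i
  define T where "T c = {y. \<forall>i<n. act i y = B c i}" for c
  have card_B: "card (B c i) = 2" if "c \<in> act k v" "i < n" for c i
    using that k two act_fin by (simp add: B_def)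
  have B_sub: "B c i \<subseteq> act i v" for c i by (auto simp: B_def)
  have T_cell: "cell x = T c" if "x \<in> T c" for x c
    using that by (auto simp: T_def cell_iff)
  have T_edge: "edge_pt x" if "x \<in> T c" "c \<in> act k v" for x c
    using that card_B by (auto simp: T_def edge_pt_def)
  have star: "v \<in> closure (T c)" if c: "c \<in> act k v" for c
  proof -
    have "dim (differences {..<n} (B c)) \<le> (\<Sum>i<n. card (B c i) - 1)"
    proof (rule dim_differences_le)
      show "finite (B c i) \<and> B c i \<noteq> {}" if "i \<in> {..<n}" for i
        using card_B[OF c, of i] that by (metis card.empty card.infinite lessThan_iff zero_neq_numeral)
    qed simp
    also have "\<dots> = n" using card_B[OF c] by simp
    finally obtain u0 where u0: "u0 \<noteq> 0" "span (differences {..<n} (B c)) \<subseteq> {y. u0 \<bullet> y = 0}"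
      using lowdim_subset_hyperplane[of "differences {..<n} (B c)"] card_m by auto
    have orth0: "(p - q) \<bullet> u0 = 0" if "i < n" "p \<in> B c i" "q \<in> B c i" for i p q
    proof -
      have "p - q \<in> span (differences {..<n} (B c))"
        using that by (intro span_base differencesI) auto
      then have "p - q \<in> {y. u0 \<bullet> y = 0}" using u0(2) by blast
      then show ?thesis by (simp add: inner_commute)
    qed
    obtain a where a: "a \<in> B c k"
      using card_B[OF c k(1)] by (metis card.empty ex_in_conv zero_neq_numeral)
    \<comment> \<open>Otherwise \<open>u0\<close> would be orthogonal to all differences at
      \<open>v\<close>, which span the space.\<close>
    have ne: "(c - a) \<bullet> u0 \<noteq> 0"
    proof
      assume ca: "(c - a) \<bullet> u0 = 0"
      have "p \<bullet> u0 = a \<bullet> u0" if "p \<in> act k v" for p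
        using that ca orth0[OF k(1) _ a, of p] by (cases "p = c") (auto simp: B_def inner_diff_left)
      then have "p \<bullet> u0 = q \<bullet> u0" if "p \<in> act i v" "q \<in> act i v" "i < n" for i p q
        using that orth0[of i p q] by (cases "i = k") (auto simp: B_def inner_diff_left)
      note same = this
      have "e \<bullet> u0 = 0" if e: "e \<in> dif v" for e
      proof -
        obtain i p q where "i < n" "p \<in> act i v" "q \<in> act i v" "e = p - q"
          using e by (auto simp: dif_def differences_def)
        then show ?thesis using same[of p i q] by (simp add: inner_diff_left)
      qed
      then have "u0 = 0" using orthogonal_zero[OF vertex_dim[OF v]] by blast
      then show False using u0 by simp
    qed
    \<comment> \<open>The sign is chosen so that \<open>c\<close> falls behind the other two
      corners.\<close>
    define u where "u = (if (c - a) \<bullet> u0 < 0 then u0 else - u0)"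
    have less: "c \<bullet> u < a \<bullet> u" using ne by (auto simp: u_def inner_diff_left)
    have orth: "p \<bullet> u = q \<bullet> u" if "i < n" "p \<in> B c i" "q \<in> B c i" for i p q
      using orth0[OF that] by (auto simp: u_def inner_diff_left)
    have dirB: "{p \<in> act i v. \<forall>q\<in>act i v. q \<bullet> u \<le> p \<bullet> u} = B c i" if i: "i < n" for i
    proof (cases "i = k")
      case False
      then have eq: "B c i = act i v" by (simp add: B_def)
      have "q \<bullet> u \<le> p \<bullet> u" if "p \<in> act i v" "q \<in> act i v" for p q
        using orth[OF i, of q p] that by (simp add: eq)
      then show ?thesis unfolding eq by blast
    next
      case True
      have "q \<bullet> u \<le> a \<bullet> u" if "q \<in> act k v" for q
        using that less orth[OF k(1) _ a, of q] by (cases "q = c") (auto simp: B_def)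
      then have *: "q \<bullet> u \<le> p \<bullet> u" if "q \<in> act k v" "p \<in> B c k" for p q
        using that orth[OF k(1) that(2) a] by simp
      show ?thesis
      proof (intro set_eqI iffI)
        fix p assume p: "p \<in> {p \<in> act i v. \<forall>q\<in>act i v. q \<bullet> u \<le> p \<bullet> u}"
        have "a \<in> act k v" using a by (auto simp: B_def)
        then have "p \<noteq> c" using p less True by auto
        then show "p \<in> B c i" using p True by (auto simp: B_def)
      next
        fix p assume "p \<in> B c i"
        then show "p \<in> {p \<in> act i v. \<forall>q\<in>act i v. q \<bullet> u \<le> p \<bullet> u}"
          using True * by (auto simp: B_def)
      qed
    qed
    have "eventually (\<lambda>t. \<forall>i\<in>{..<n}. act i (v + t *\<^sub>R u) = B c i) (at_right 0)"
    proof (intro eventually_ball_finite ballI)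
      fix i assume "i \<in> {..<n}"
      then have i: "i < n" by simp
      show "eventually (\<lambda>t. act i (v + t *\<^sub>R u) = B c i) (at_right 0)"
        using active_perturb[OF A_fin[OF i] A_ne[OF i], of "lam i" v u] unfolding dirB[OF i] .
    qed simp
    then have "eventually (\<lambda>t. v + t *\<^sub>R u \<in> closure (T c)) (at_right 0)"
      by (rule eventually_mono) (auto simp: T_def intro!: subsetD[OF closure_subset])
    moreover have "((\<lambda>t. v + t *\<^sub>R u) \<longlongrightarrow> v) (at_right 0)"
      by (rule tendsto_eq_intros refl | simp)+
    ultimately show ?thesis
      by (intro Lim_in_closed_set[OF closed_closure _ trivial_limit_at_right_real])
  qed
  have T_ne: "T c \<noteq> {}" if "c \<in> act k v" for c using star[OF that] by auto
  have "bij_betw T (act k v) {e \<in> edges. v \<in> closure e}"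
  proof (rule bij_betw_imageI)
    show "inj_on T (act k v)"
    proof (rule inj_onI)
      fix c c' assume c: "c \<in> act k v" "c' \<in> act k v" "T c = T c'"
      then obtain x where "x \<in> T c" "x \<in> T c'" using T_ne by blast
      then have "act k x = B c k" "act k x = B c' k" using k(1) unfolding T_def by blast+
      then have "act k v - {c} = act k v - {c'}" by (simp add: B_def)
      then show "c = c'" using c by blast
    qed
    show "T ` act k v = {e \<in> edges. v \<in> closure e}"
    proof (intro set_eqI iffI)
      fix e assume "e \<in> T ` act k v"
      then obtain c where c: "c \<in> act k v" "e = T c" by blast
      obtain x where "x \<in> T c" using T_ne[OF c(1)] by blast
      then show "e \<in> {e \<in> edges. v \<in> closure e}"
        using c star[OF c(1)] T_cell[of x c] T_edge[of x c] unfolding edges_def by blast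
    next
      fix e assume e: "e \<in> {e \<in> edges. v \<in> closure e}"
      then obtain x where x: "edge_pt x" "e = cell x" "v \<in> closure (cell x)" by (auto simp: edges_def)
      have sub: "act i x \<subseteq> act i v" if "i < n" for i by (rule closure_cell_act[OF x(3) that])
      have eq: "act i x = act i v" if "i < n" "i \<noteq> k" for i
        using card_subset_eq[OF act_fin sub] that x(1) two by (simp add: edge_pt_def)
      have "card (act k v - act k x) = 1"
        using card_Diff_subset[OF act_fin sub] k x(1) by (simp add: edge_pt_def)
      then obtain c where c: "act k v - act k x = {c}" by (auto simp: card_1_singleton_iff)
      then have "act k x = act k v - {c}" using sub[OF k(1)] by blast
      then have "x \<in> T c" using eq by (auto simp: T_def B_def)
      then have "e = T c" using T_cell x(2) by simp
      moreover have "c \<in> act k v" using c by blast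
      ultimately show "e \<in> T ` act k v" by simp
    qed
  qed
  from bij_betw_same_card[OF this] show ?thesis using k(2) by simp
qed

lemma edge_vertex_count:
  "3 * card Ver = 2 * card {e \<in> edges. bounded e} + card {e \<in> edges. \<not> bounded e}"
proof -
  have "(\<Sum>e\<in>edges. card (Ver \<inter> closure e)) = (\<Sum>e\<in>edges. \<Sum>v\<in>Ver. if v \<in> closure e then 1 else 0)"
    using finite_vertices by (intro sum.cong refl) (simp add: sum.If_cases Int_def)
  also have "\<dots> = (\<Sum>v\<in>Ver. \<Sum>e\<in>edges. if v \<in> closure e then 1 else 0)" by (rule sum.swap)
  also have "\<dots> = (\<Sum>v\<in>Ver. card {e \<in> edges. v \<in> closure e})"
    using finite_edges by (intro sum.cong refl) (simp add: sum.If_cases Int_def)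
  also have "\<dots> = 3 * card Ver" using edges_at_vertex by simp
  finally have "3 * card Ver = (\<Sum>e\<in>edges. card (Ver \<inter> closure e))" by simp
  also have "\<dots> = (\<Sum>e\<in>{e \<in> edges. bounded e} \<union> {e \<in> edges. \<not> bounded e}. card (Ver \<inter> closure e))"
    by (rule sum.cong) auto
  also have "\<dots> = (\<Sum>e\<in>{e \<in> edges. bounded e}. card (Ver \<inter> closure e)) +
      (\<Sum>e\<in>{e \<in> edges. \<not> bounded e}. card (Ver \<inter> closure e))"
    using finite_edges by (intro sum.union_disjoint) auto
  also have "\<dots> = 2 * card {e \<in> edges. bounded e} + card {e \<in> edges. \<not> bounded e}"
    using bounded_edge_card unbounded_edge_card by simp
  finally show ?thesis .
qed

subsection \<open>Connectedness\<close>

lemma edges_closure_Int: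
  assumes e: "e \<in> edges" "e' \<in> edges" and z: "z \<in> closure e" "z \<in> closure e'"
  shows "e = e' \<or> z \<in> Ver"
proof -
  obtain x x' where x: "edge_pt x" "e = cell x" "edge_pt x'" "e' = cell x'"
    using e by (auto simp: edges_def)
  have "z \<in> cell x \<or> z \<in> Ver" "z \<in> cell x' \<or> z \<in> Ver"
    using closure_edge_cases x z by auto
  then show ?thesis using x cell_eqI by blast
qed

lemma curve_covered: "Cur \<subseteq> (\<Union>e\<in>edges. closure e)"
proof
  fix z assume z: "z \<in> Cur"
  show "z \<in> (\<Union>e\<in>edges. closure e)"
  proof (cases "edge_pt z")
    case True
    then have "cell z \<in> edges" "z \<in> closure (cell z)"
      using cell_self closure_subset by (auto simp: edges_def)
    then show ?thesis by blast
  next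
    case False
    then have "card {e \<in> edges. z \<in> closure e} = 3" using z by (simp add: edges_at_vertex vertex_iff)
    then have "{e \<in> edges. z \<in> closure e} \<noteq> {}" by (metis card.empty zero_neq_numeral)
    then show ?thesis by blast
  qed
qed

text \<open>If an adjacency class \<open>K\<close> missed a vertex, the closed edges meeting
  \<open>K\<close> and those avoiding \<open>K\<close> would disconnect the curve. Both unions are
  closed by finiteness, and disjoint because distinct edges meet only in vertices.\<close>

lemma quotient_adj:
  assumes "connected Cur"
  shows "card (Ver // (curve_adj n A lam)\<^sup>*) = 1"
proof -
  let ?R = "(curve_adj n A lam)\<^sup>*"
  have stays: "w \<in> Ver" if "(v, w) \<in> ?R" "v \<in> Ver" for v w
    using that by (induction rule: rtrancl_induct) (auto simp: curve_adj_def)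
  have all: "?R `` {v} = Ver" if v: "v \<in> Ver" for v
  proof (rule ccontr)
    define K where "K = ?R `` {v}"
    assume "?R `` {v} \<noteq> Ver"
    then have "K \<noteq> Ver" by (simp add: K_def)
    moreover have "K \<subseteq> Ver" using stays v by (auto simp: K_def)
    ultimately obtain w where w: "w \<in> Ver" "w \<notin> K" by blast
    have vK: "v \<in> K" by (auto simp: K_def)
    define Y where "Y = (\<Union>e\<in>{e \<in> edges. K \<inter> closure e \<noteq> {}}. closure e)"
    define Z where "Z = (\<Union>e\<in>{e \<in> edges. K \<inter> closure e = {}}. closure e)"
    have closed: "closed Y" "closed Z"
      unfolding Y_def Z_def using finite_edges by (auto intro!: closed_UN)
    have cover: "Cur \<subseteq> Y \<union> Z"
    proof
      fix z assume "z \<in> Cur"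
      then obtain e where e: "e \<in> edges" "z \<in> closure e" using curve_covered by auto
      then show "z \<in> Y \<union> Z" by (cases "K \<inter> closure e = {}") (auto simp: Y_def Z_def)
    qed
    \<comment> \<open>An edge whose closure contains two different vertices is bounded and makes
      them adjacent; so adjacency through bounded edges is enough.\<close>
    have in_K: "z \<in> K" if e: "e \<in> edges" "z \<in> closure e" "z \<in> Ver" "k \<in> K" "k \<in> closure e" for e z k
    proof (cases "z = k")
      case False
      have "k \<in> Ver" using e \<open>K \<subseteq> Ver\<close> by blast
      have "bounded e"
      proof (rule ccontr)
        assume "\<not> bounded e"
        then have "card (Ver \<inter> closure e) = 1" using unbounded_edge_card e by blast
        then obtain y where "Ver \<inter> closure e = {y}" by (auto simp: card_1_singleton_iff)
        moreover have "z \<in> Ver \<inter> closure e" "k \<in> Ver \<inter> closure e" using e \<open>k \<in> Ver\<close> by auto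
        ultimately show False using False by simp
      qed
      then have "(k, z) \<in> curve_adj n A lam"
        using e \<open>k \<in> Ver\<close> by (auto simp: curve_adj_def bounded_edges_eq)
      then show ?thesis using e(4) by (auto simp: K_def intro: rtrancl_into_rtrancl)
    qed (use e in simp)
    have disj: "Y \<inter> Z = {}"
    proof (rule ccontr)
      assume "Y \<inter> Z \<noteq> {}"
      then obtain z e e' k where z: "e \<in> edges" "e' \<in> edges" "z \<in> closure e" "z \<in> closure e'"
          "k \<in> K" "k \<in> closure e" "K \<inter> closure e' = {}" by (auto simp: Y_def Z_def)
      then have "z \<in> Ver" using edges_closure_Int[of e e' z] by blast
      then have "z \<in> K" using in_K[of e z k] z by blast
      then show False using z by blast
    qed
    have edge_at: "\<exists>e\<in>edges. x \<in> closure e" if "x \<in> Ver" for x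
      using curve_covered that vertex_iff by blast
    have "v \<in> Y" using edge_at[OF v] vK by (auto simp: Y_def)
    moreover have "w \<in> Z"
    proof -
      obtain e where e: "e \<in> edges" "w \<in> closure e" using edge_at w by blast
      then have "K \<inter> closure e = {}" using in_K[of e w] w by blast
      then show ?thesis using e by (auto simp: Z_def)
    qed
    moreover have "v \<in> Cur" "w \<in> Cur" using v w vertex_iff by blast+
    ultimately show False
      using assms closed cover disj unfolding connected_closed by blast
  qed
  obtain v where v: "v \<in> Ver" using vertices_nonempty by blast
  have "Ver // ?R = {Ver}"
    unfolding quotient_def using all v by auto
  then show ?thesis by simp
qed

lemma genus_formula:
  assumes "connected Cur"
  shows "2 * genus n A lam - 2 = int (card Ver) - int (card {e \<in> edges. \<not> bounded e})"
  using edge_vertex_count quotient_adj[OF assms] by (simp add: genus_def bounded_edges_eq)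

end

section \<open>Volume of a sum of segments\<close>

lemma mink_vol_segments:
  fixes p q :: "nat \<Rightarrow> real^'m"
  shows "mink_vol {..<CARD('m)} (\<lambda>i. {p i, q i}) = \<bar>vdet (\<lambda>i. p i - q i)\<bar>"
proof -
  let ?m = "CARD('m)"
  let ?Z = "{(\<Sum>i<?m. s i *\<^sub>R (p i - q i)) | s. \<forall>i<?m. 0 \<le> s i \<and> s i \<le> 1}"
  have "tprodA {..<?m} (\<lambda>i. convex hull {p i, q i}) = (+) (\<Sum>i<?m. q i) ` ?Z"
  proof (intro set_eqI iffI)
    fix b assume "b \<in> tprodA {..<?m} (\<lambda>i. convex hull {p i, q i})"
    then obtain g where g: "b = sum g {..<?m}" "\<forall>i\<in>{..<?m}. g i \<in> closed_segment (q i) (p i)"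
      by (auto simp: tprodA_def segment_convex_hull insert_commute)
    have "\<exists>s. 0 \<le> s \<and> s \<le> 1 \<and> g i = q i + s *\<^sub>R (p i - q i)" if "i < ?m" for i
    proof -
      have "g i \<in> closed_segment (q i) (p i)" using g(2) that by simp
      then obtain s where "0 \<le> s" "s \<le> 1" "g i = (1 - s) *\<^sub>R q i + s *\<^sub>R p i"
        by (auto simp: closed_segment_def)
      then show ?thesis by (intro exI[of _ s]) (simp add: algebra_simps)
    qed
    then obtain s where s: "\<And>i. i < ?m \<Longrightarrow> 0 \<le> s i \<and> s i \<le> 1 \<and> g i = q i + s i *\<^sub>R (p i - q i)"
      by metis
    have "b = (\<Sum>i<?m. q i + s i *\<^sub>R (p i - q i))" unfolding g(1) using s by (intro sum.cong) auto
    then have "b = (\<Sum>i<?m. q i) + (\<Sum>i<?m. s i *\<^sub>R (p i - q i))" by (simp add: sum.distrib)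
    moreover have "(\<Sum>i<?m. s i *\<^sub>R (p i - q i)) \<in> ?Z" using s by blast
    ultimately show "b \<in> (+) (\<Sum>i<?m. q i) ` ?Z" by blast
  next
    fix b assume "b \<in> (+) (\<Sum>i<?m. q i) ` ?Z"
    then obtain s where s: "b = (\<Sum>i<?m. q i) + (\<Sum>i<?m. s i *\<^sub>R (p i - q i))"
        "\<forall>i<?m. 0 \<le> s i \<and> s i \<le> 1" by auto
    let ?g = "\<lambda>i. (1 - s i) *\<^sub>R q i + s i *\<^sub>R p i"
    have "?g i \<in> convex hull {p i, q i}" if "i < ?m" for i
    proof -
      have "?g i \<in> closed_segment (q i) (p i)" using s(2) that by (auto simp: closed_segment_def)
      then show ?thesis by (simp add: segment_convex_hull insert_commute)
    qed
    moreover have "b = sum ?g {..<?m}"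
      unfolding s(1) sum.distrib[symmetric] by (intro sum.cong) (auto simp: algebra_simps)
    ultimately show "b \<in> tprodA {..<?m} (\<lambda>i. convex hull {p i, q i})"
      unfolding tprodA_def by (intro CollectI exI[of _ ?g]) auto
  qed
  then show ?thesis
    unfolding mink_vol_def
    by (simp only: convex_hull_tprodA finite_lessThan measure_translation measure_parallelepiped)
qed

context tropical_curve
begin

subsection \<open>Lattice index of the unbounded edges\<close>

text \<open>The dual cell of a vertex is a triangle plus segments; together with its point reflection it
  covers a parallelepiped, which therefore has volume at most \<open>2 * (1 / 2) = 1\<close>.\<close>

lemma vertex_edge_unimodular:
  assumes x: "edge_pt x" and v: "v \<in> Ver" "v \<in> closure (cell x)"
    and pq: "\<And>i. i < n \<Longrightarrow> act i x = {p i, q i}"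
  obtains t where "lattice_pt t" "\<bar>vdet ((\<lambda>i. p i - q i)(n := t))\<bar> = 1"
proof -
  obtain k where k: "k < n" "card (act k v) = 3" and two: "\<And>j. j < n \<Longrightarrow> j \<noteq> k \<Longrightarrow> card (act j v) = 2"
    by (rule vertex_cases[OF v(1)]) (rule that, assumption+)
  have sub: "act i x \<subseteq> act i v" if "i < n" for i by (rule closure_cell_act[OF v(2) that])
  have act_v: "act i v = {p i, q i}" if "i < n" "i \<noteq> k" for i
    using card_subset_eq[OF act_fin sub] that x two pq by (simp add: edge_pt_def)
  have "card (act k v - act k x) = 1"
    using card_Diff_subset[OF act_fin sub] k x by (simp add: edge_pt_def)
  then obtain c where c: "act k v - act k x = {c}" by (auto simp: card_1_singleton_iff)
  then have act_k: "act k v = {p k, q k, c}" using sub[OF k(1)] pq[OF k(1)] by blast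
  \<comment> \<open>The second side of the dual triangle at \<open>q k\<close>; the first side is
    already the \<open>k\<close>-th segment of the edge.\<close>
  define t where "t = c - q k"
  define w where "w = (\<lambda>i. p i - q i)(n := t)"
  have w_less: "w i = p i - q i" if "i < n" for i using that by (simp add: w_def)
  have w_n: "w n = t" by (simp add: w_def)
  have lat: "lattice_pt a" if "a \<in> act i v" "i < n" for a i
    using that act_sub lattice_A by blast
  have lat_t: "lattice_pt t" unfolding t_def
    by (intro lattice_pt_diff lat[of _ k]) (use k act_k in auto)
  have lat_w: "lattice_pt (w i)" if "i < CARD('m)" for i
  proof (cases "i < n")
    case True
    have "p i \<in> act i v" "q i \<in> act i v" using sub[OF True] pq[OF True] by auto
    then show ?thesis unfolding w_less[OF True] using lat True by (intro lattice_pt_diff) blast+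
  next
    case False
    then have "i = n" using that card_m by simp
    then show ?thesis using w_n lat_t by simp
  qed
  have ne: "vdet w \<noteq> 0"
  proof (rule vdet_nonzero)
    fix y assume y: "\<And>i. i < CARD('m) \<Longrightarrow> w i \<bullet> y = 0"
    have e: "p i \<bullet> y = q i \<bullet> y" if "i < n" for i
      using y[of i] that by (simp add: card_m w_less inner_diff_left)
    have tc: "c \<bullet> y = q k \<bullet> y" using y[of n] by (simp add: card_m w_n t_def inner_diff_left)
    have same: "a \<bullet> y = q i \<bullet> y" if "i < n" "a \<in> act i v" for a i
    proof (cases "i = k")
      case True
      then show ?thesis using that act_k e[OF that(1)] tc by auto
    next
      case False
      then show ?thesis using that act_v[OF that(1) False] e[OF that(1)] by auto
    qed
    have "f \<bullet> y = 0" if f: "f \<in> dif v" for f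
    proof -
      obtain i a b where "i < n" "a \<in> act i v" "b \<in> act i v" "f = a - b"
        using f by (auto simp: dif_def differences_def)
      then show ?thesis using same by (simp add: inner_diff_left)
    qed
    then show "y = 0" by (rule orthogonal_zero[OF vertex_dim[OF v(1)]])
  qed
  define Z where "Z = {(\<Sum>i<CARD('m). s i *\<^sub>R w i) | s. \<forall>i<CARD('m). 0 \<le> s i \<and> s i \<le> 1}"
  have volZ: "measure lebesgue Z = \<bar>vdet w\<bar>" unfolding Z_def by (rule measure_parallelepiped)
  \<comment> \<open>A set that is not measurable would have measure 0, so the nonzero determinant
    yields measurability.\<close>
  then have Zm: "Z \<in> sets lebesgue" using ne measure_notin_sets by fastforce
  define P where "P = convex hull (tprodA {..<n} (\<lambda>i. act i v))"
  have P: "compact P" "measure lebesgue P = 1 / 2"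
    using mink_vol_vertex[OF v(1)] act_fin unfolding P_def mink_vol_def
    by (auto intro!: finite_imp_compact_convex_hull finite_tprodA)
  define b where "b = (\<Sum>i<n. q i)"
  define E where "E = (\<Sum>i<n. p i - q i)"
  \<comment> \<open>The \<open>k\<close>-th summand gets the weights \<open>1 - s k - r\<close>,
    \<open>s k\<close>, \<open>r\<close> on \<open>q k\<close>, \<open>p k\<close>,
    \<open>c\<close>. This is the triangular half of the parallelogram spanned by
    \<open>p k - q k\<close> and \<open>t\<close>.\<close>
  have half: "b + ((\<Sum>i<n. s i *\<^sub>R (p i - q i)) + r *\<^sub>R t) \<in> P"
    if s: "\<And>i. i < n \<Longrightarrow> 0 \<le> s i \<and> s i \<le> 1" and r: "0 \<le> r" "s k + r \<le> 1" for s r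
  proof -
    define g where "g i = (1 - s i) *\<^sub>R q i + s i *\<^sub>R p i" for i
    define h where "h = g(k := (1 - s k - r) *\<^sub>R q k + s k *\<^sub>R p k + r *\<^sub>R c)"
    have "h i \<in> convex hull (act i v)" if "i < n" for i
    proof (cases "i = k")
      case True
      have "h k = s k *\<^sub>R p k + (1 - s k - r) *\<^sub>R q k + r *\<^sub>R c" by (simp add: h_def)
      then have "h k \<in> convex hull {p k, q k, c}"
        unfolding convex_hull_3 using s[OF k(1)] r by force
      then show ?thesis using True act_k by simp
    next
      case False
      have "g i \<in> closed_segment (q i) (p i)"
        using s[OF that] by (auto simp: g_def closed_segment_def)
      then show ?thesis using False act_v[OF that False]
        by (simp add: h_def segment_convex_hull insert_commute)
    qed
    then have "sum h {..<n} \<in> P"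
      unfolding P_def convex_hull_tprodA[OF finite_lessThan] unfolding tprodA_def by blast
    moreover have "sum h {..<n} = b + ((\<Sum>i<n. s i *\<^sub>R (p i - q i)) + r *\<^sub>R t)"
    proof -
      have "sum h {..<n} = h k + sum g ({..<n} - {k})"
        using k(1) by (simp add: sum.remove h_def)
      also have "h k = g k + r *\<^sub>R t" by (simp add: h_def g_def t_def algebra_simps)
      also have "g k + r *\<^sub>R t + sum g ({..<n} - {k}) = sum g {..<n} + r *\<^sub>R t"
        using k(1) by (simp add: sum.remove)
      also have "sum g {..<n} = (\<Sum>i<n. q i + s i *\<^sub>R (p i - q i))"
        by (intro sum.cong) (auto simp: g_def algebra_simps)
      finally show ?thesis by (simp add: sum.distrib b_def add.assoc)
    qed
    ultimately show ?thesis by simp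
  qed
  let ?P1 = "(+) (- b) ` P" and ?P2 = "(\<lambda>y. (- 1) *\<^sub>R y + (b + E + t)) ` P"
  have cover: "Z \<subseteq> ?P1 \<union> ?P2"
  proof
    fix z assume "z \<in> Z"
    then obtain s where s: "z = (\<Sum>i<CARD('m). s i *\<^sub>R w i)" "\<forall>i<CARD('m). 0 \<le> s i \<and> s i \<le> 1"
      by (auto simp: Z_def)
    have z: "z = (\<Sum>i<n. s i *\<^sub>R (p i - q i)) + s n *\<^sub>R t"
      unfolding s(1) card_m by (simp add: w_less w_n)
    have s01: "0 \<le> s i \<and> s i \<le> 1" if "i < n" for i using s(2) that by (simp add: card_m)
    have sn: "0 \<le> s n" "s n \<le> 1" using s(2) by (auto simp: card_m)
    show "z \<in> ?P1 \<union> ?P2"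
    proof (cases "s k + s n \<le> 1")
      case True
      then have "b + z \<in> P" unfolding z using half[of s "s n"] s01 sn by blast
      then have "z \<in> ?P1" by (intro image_eqI[of _ _ "b + z"]) auto
      then show ?thesis by blast
    next
      case False
      \<comment> \<open>The point reflection replaces every coefficient by its complement to 1 and
        so exchanges the two halves.\<close>
      let ?z' = "(\<Sum>i<n. (1 - s i) *\<^sub>R (p i - q i)) + (1 - s n) *\<^sub>R t"
      have "b + ?z' \<in> P" using half[of "\<lambda>i. 1 - s i" "1 - s n"] s01 sn False by force
      moreover have "?z' = E + t - z"
        unfolding z E_def by (simp add: algebra_simps sum.distrib sum_subtractf)
      ultimately have "z \<in> ?P2" by (intro image_eqI[of _ _ "b + ?z'"]) (auto simp: algebra_simps)
      then show ?thesis by blast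
    qed
  qed
  have cpt: "compact ?P1" "compact ?P2"
    using P(1) by (auto intro!: compact_continuous_image continuous_intros)
  have "measure lebesgue Z \<le> measure lebesgue (?P1 \<union> ?P2)"
    using cover Zm cpt by (intro measure_mono_fmeasurable) (auto intro: lmeasurable_compact)
  also have "\<dots> \<le> measure lebesgue ?P1 + measure lebesgue ?P2"
    using cpt by (intro measure_Un_le) (auto intro: lmeasurable_compact fmeasurableD)
  also have "\<dots> = 1"
    using P(2) measure_lebesgue_affine[of "-1" "b + E + t" P]
    by (simp only: measure_translation) simp
  finally have "\<bar>vdet w\<bar> \<le> 1" using volZ by simp
  moreover have "vdet w \<in> \<int>" by (rule vdet_Ints[OF lat_w])
  ultimately have "\<bar>vdet w\<bar> = 1" using ne by (auto elim!: Ints_cases)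
  then show ?thesis using that lat_t unfolding w_def by blast
qed

lemma unbounded_edge_cases:
  assumes x: "edge_pt x" "\<not> bounded (cell x)"
  obtains v u where "v \<in> Ver" "v \<in> closure (cell x)" "u \<noteq> 0" "cell x = {v + t *\<^sub>R u | t. t > 0}"
    "{w. \<forall>e\<in>dif x. e \<bullet> w = 0} = span {u}"
    "(\<exists>s>0. u = s *\<^sub>R vec 1) \<or> (\<exists>s>0. \<exists>k. u = - s *\<^sub>R axis k 1)"
proof -
  obtain v u where vu: "u \<noteq> 0" "v \<in> Ver" "Ver \<inter> closure (cell x) = {v}"
      "cell x = {v + t *\<^sub>R u | t. t > 0}" "{w. \<forall>e\<in>dif x. e \<bullet> w = 0} = span {u}"
    by (rule unbounded_edge_ray[OF x])
  obtain t0 where t0: "t0 > 0" "x = v + t0 *\<^sub>R u" using vu(4) cell_self[of x] by blast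
  have ray: "x + t *\<^sub>R u \<in> cell x" if "t \<ge> 0" for t
    unfolding vu(4) using t0 that
    by (intro CollectI exI[of _ "t0 + t"]) (simp add: algebra_simps)
  have "(\<exists>s>0. u = s *\<^sub>R vec 1) \<or> (\<exists>s>0. \<exists>k. u = - s *\<^sub>R axis k 1)"
    by (rule ray_direction[OF x(1) vu(1,5) ray]) blast+
  moreover have "v \<in> closure (cell x)" using vu(3) by blast
  ultimately show ?thesis using that vu by blast
qed

text \<open>The lattice vector \<open>t\<close> supplied by the end vertex equals \<open>r\<close>
  times e_j up to a vector orthogonal to \<open>u\<close>, which lies in the span of the segments.
  So 1 is, up to sign, \<open>r\<close> times the determinant in question; both are integers, hence
  both are 1 or -1.\<close>

lemma unbounded_edge_unimodular:
  assumes x: "edge_pt x" "\<not> bounded (cell x)"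
    and u: "{w. \<forall>e\<in>dif x. e \<bullet> w = 0} = span {u}" "u $ j \<noteq> 0"
    and dir: "(\<exists>s>0. u = s *\<^sub>R vec 1) \<or> (\<exists>s>0. \<exists>k. u = - s *\<^sub>R axis k 1)"
    and pq: "\<And>i. i < n \<Longrightarrow> act i x = {p i, q i}"
  shows "\<bar>vdet ((\<lambda>i. p i - q i)(n := axis j 1))\<bar> = 1"
proof -
  let ?w = "\<lambda>i. p i - q i"
  obtain v where v: "v \<in> Ver" "v \<in> closure (cell x)"
    by (rule unbounded_edge_cases[OF x])
  obtain t where t: "lattice_pt t" "\<bar>vdet (?w(n := t))\<bar> = 1"
    by (rule vertex_edge_unimodular[OF x(1) v pq])
  have u0: "u \<noteq> 0" using u(2) by auto
  have orth: "e \<bullet> u = 0" if "e \<in> dif x" for e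
    using u(1) that span_base[of u "{u}"] by auto
  have dif_span: "dif x \<subseteq> span (?w ` {..<n})"
  proof
    fix e assume "e \<in> dif x"
    then obtain i a b where iab: "i < n" "a \<in> act i x" "b \<in> act i x" "e = a - b"
      by (auto simp: dif_def differences_def)
    then have "e = 0 \<or> e = ?w i \<or> e = - ?w i" using pq[OF iab(1)] by auto
    moreover have "?w i \<in> span (?w ` {..<n})" using iab(1) by (intro span_base) auto
    ultimately show "e \<in> span (?w ` {..<n})" using span_zero span_neg by metis
  qed
  have "span (dif x) = {y. u \<bullet> y = 0}"
  proof (rule subspace_dim_equal)
    have "dif x \<subseteq> {y. u \<bullet> y = 0}" using orth by (auto simp: inner_commute)
    then show "span (dif x) \<subseteq> {y. u \<bullet> y = 0}" by (intro span_minimal subspace_hyperplane)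
    show "dim {y. u \<bullet> y = 0} \<le> dim (span (dif x))"
      using edge_pt_dim[OF x(1)] dim_hyperplane[OF u0] card_m by simp
  qed (auto simp: subspace_hyperplane)
  moreover have "span (dif x) \<subseteq> span (?w ` {..<n})"
    using dif_span by (intro span_minimal) auto
  ultimately have perp: "y \<in> span (?w ` {..<n})" if "u \<bullet> y = 0" for y using that by blast
  \<comment> \<open>\<open>r\<close> is an integer because \<open>u\<close> is a multiple of an
    integer vector with \<open>j\<close>-th coordinate 1 or -1; it is the coordinate sum of
    \<open>t\<close> or its \<open>j\<close>-th coordinate.\<close>
  define r where "r = (u \<bullet> t) / u $ j"
  have "u \<bullet> (t - r *\<^sub>R axis j 1) = 0"
    using u(2) by (simp add: r_def inner_diff_right inner_axis)
  then have "t - r *\<^sub>R axis j 1 \<in> span (?w ` {..<n})" by (rule perp)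
  also have "?w ` {..<n} = ?w ` ({..<CARD('m)} - {n})"
  proof -
    have "{..<CARD('m)} - {n} = {..<n}" using card_m by auto
    then show ?thesis by simp
  qed
  finally have "vdet (?w(n := r *\<^sub>R axis j 1 + (t - r *\<^sub>R axis j 1))) = r * vdet (?w(n := axis j 1))"
    by (intro vdet_upd_scale_span) (auto simp: card_m)
  then have prod: "\<bar>r * vdet (?w(n := axis j 1))\<bar> = 1" using t(2) by simp
  have "r \<in> \<int>"
    using dir
  proof (elim disjE exE conjE)
    fix s :: real assume s: "s > 0" "u = s *\<^sub>R vec 1"
    have "u \<bullet> t = s * (\<Sum>i\<in>UNIV. t $ i)" by (simp add: s(2) inner_vec_def sum_distrib_left)
    then have "r = (\<Sum>i\<in>UNIV. t $ i)" using s by (simp add: r_def)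
    then show ?thesis using t(1) by (auto simp: lattice_pt_def)
  next
    fix s k assume s: "(s::real) > 0" "u = - s *\<^sub>R axis k 1"
    then have "k = j" using u(2) by (auto simp: axis_def split: if_splits)
    then have "u \<bullet> t = - s * t $ j" by (simp add: s(2) inner_axis')
    moreover have "u $ j = - s" using \<open>k = j\<close> by (simp add: s(2) axis_def)
    ultimately have "r = t $ j" using s(1) by (simp add: r_def)
    then show ?thesis using t(1) by (auto simp: lattice_pt_def)
  qed
  moreover have "vdet (?w(n := axis j 1)) \<in> \<int>"
  proof (rule vdet_Ints)
    fix i assume "i < CARD('m)"
    show "lattice_pt ((?w(n := axis j 1)) i)"
    proof (cases "i = n")
      case False
      then have i: "i < n" using \<open>i < CARD('m)\<close> card_m by simp
      have "p i \<in> A i" "q i \<in> A i" using pq[OF i] act_sub[of i x] by auto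
      then show ?thesis using False lattice_A[OF i] by (auto intro: lattice_pt_diff)
    qed (auto simp: lattice_pt_def axis_def)
  qed
  ultimately obtain a b :: int where ab: "r = of_int a" "vdet (?w(n := axis j 1)) = of_int b"
    by (auto elim!: Ints_cases)
  then have "\<bar>of_int (a * b) :: real\<bar> = 1" using prod by simp
  then have "\<bar>b * a\<bar> = 1" by (simp add: mult.commute flip: of_int_mult of_int_abs)
  then have "\<bar>b\<bar> = 1" by (rule abs_zmult_eq_1)
  then show ?thesis using ab(2) by simp
qed

subsection \<open>The number of unbounded edges\<close>

lemma vertices_bound: "\<exists>M>0. \<forall>v\<in>Ver. \<forall>k. \<bar>v $ k\<bar> < M"
proof -
  obtain M where M: "M > 0" "\<And>v. v \<in> Ver \<Longrightarrow> norm v \<le> M"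
    using finite_imp_bounded[OF finite_vertices] by (auto simp: bounded_pos)
  show ?thesis
  proof (intro exI[of _ "M + 1"] conjI ballI allI)
    fix v k assume "v \<in> Ver"
    then show "\<bar>v $ k\<bar> < M + 1" using M(2) component_le_norm_cart[of v k] by fastforce
  qed (use M in simp)
qed

text \<open>Half the side of an open cube around the origin that contains all vertices, and with
  them all bounded edges.\<close>

definition vbound :: real where
  "vbound = (SOME M. M > 0 \<and> (\<forall>v\<in>Ver. \<forall>k. \<bar>v $ k\<bar> < M))"

lemma vbound: "vbound > 0" "v \<in> Ver \<Longrightarrow> \<bar>v $ k\<bar> < vbound"
proof -
  have "vbound > 0 \<and> (\<forall>v\<in>Ver. \<forall>k. \<bar>v $ k\<bar> < vbound)"
    unfolding vbound_def by (rule someI_ex) (use vertices_bound in blast)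
  then show "vbound > 0" "v \<in> Ver \<Longrightarrow> \<bar>v $ k\<bar> < vbound" by auto
qed

text \<open>A bounded edge lies in the segment between its two vertices, so the curve leaves the
  cube only along rays.\<close>

lemma curve_pt_cases:
  assumes "z \<in> Cur"
  obtains (near) "\<And>k. \<bar>z $ k\<bar> < vbound"
    | (far) "edge_pt z" "\<not> bounded (cell z)"
proof (cases "edge_pt z")
  case False
  then have "z \<in> Ver" using assms vertex_iff by blast
  then show ?thesis using near vbound(2) by blast
next
  case True
  show ?thesis
  proof (cases "bounded (cell z)")
    case False
    then show ?thesis using far True by blast
  next
    case bounded: True
    show ?thesis
    proof (rule edge_shape[OF True])
      fix v w assume vw: "v \<in> Ver" "w \<in> Ver" "cell z \<subseteq> closed_segment v w"
      have "z \<in> closed_segment v w" using vw(3) cell_self[of z] by blast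
      then obtain s where s: "0 \<le> s" "s \<le> 1" "z = (1 - s) *\<^sub>R v + s *\<^sub>R w"
        by (auto simp: closed_segment_def)
      have "\<bar>z $ k\<bar> < vbound" for k
      proof -
        have "z $ k \<in> closed_segment (v $ k) (w $ k)"
          using s by (auto simp: closed_segment_def)
        moreover have "closed_segment (v $ k) (w $ k) \<subseteq> ball 0 vbound"
          using vw vbound(2) by (intro closed_segment_subset) (auto simp: dist_norm)
        ultimately show ?thesis by auto
      qed
      then show ?thesis by (rule near)
    next
      fix v u assume "u \<noteq> 0" "cell z = {v + t *\<^sub>R u | t. t > 0}"
      then show ?thesis using bounded ray_unbounded by simp
    qed
  qed
qed

text \<open>The points of the curve on the hyperplane \<open>x\<^sub>j = c\<close>, far out, are counted by adding to the
  family a tropical hyperplane that agrees with \<open>x\<^sub>j = c\<close> along the curve; the Newton polytopes of the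
  enlarged family are still standard simplices.\<close>

lemma crossing_count:
  assumes c: "\<bar>c\<bar> \<ge> vbound"
  shows "finite {z \<in> Cur. z $ j = c}" and "card {z \<in> Cur. z $ j = c} = (\<Prod>i<n. d i)"
proof -
  let ?Z = "{z \<in> Cur. z $ j = c}"
  \<comment> \<open>On a ray in direction (1, ..., 1) two coordinates differ by less than
    \<open>2 * vbound\<close>; on the rest of the curve every coordinate is below
    \<open>vbound\<close>. With this \<open>R\<close> the terms x_k - R with
    \<open>k \<noteq> j\<close> stay below the maximum of 0 and x_j - c.\<close>
  define R where "R = 2 * vbound + \<bar>c\<bar>"
  define H :: "(real^'m) set" where "H = insert 0 (range (\<lambda>k. axis k (1::real)))"
  define mu where "mu a = (if a = 0 then 0 else if a = axis j 1 then - c else - R)" for a :: "real^'m"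
  define A' where "A' = A(n := H)"
  define lam' where "lam' = lam(n := mu)"
  define d' where "d' = d(n := 1)"
  define act' where "act' i x = active (A' i) (lam' i) x" for i x
  have act'_less: "act' i x = act i x" if "i < n" for i x
    using that by (simp add: act'_def A'_def lam'_def)
  have act'_n: "act' n x = active H mu x" for x
    by (simp add: act'_def A'_def lam'_def)
  have memH: "0 \<in> H" "axis k 1 \<in> H" for k by (auto simp: H_def)
  have finH: "finite H" "H \<noteq> {}" by (auto simp: H_def)
  have far: "z $ k - R < max 0 (z $ j - c)" if z: "z \<in> Cur" for z k
  proof (rule curve_pt_cases[OF z])
    assume "\<And>k. \<bar>z $ k\<bar> < vbound"
    from this[of k] show ?thesis using vbound(1) by (simp add: R_def)
  next
    assume zz: "edge_pt z" "\<not> bounded (cell z)"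
    obtain v u where vu: "v \<in> Ver" "cell z = {v + t *\<^sub>R u | t. t > 0}"
      "(\<exists>s>0. u = s *\<^sub>R vec 1) \<or> (\<exists>s>0. \<exists>k. u = - s *\<^sub>R axis k 1)"
      by (rule unbounded_edge_cases[OF zz])
    obtain t where t: "t > 0" "z = v + t *\<^sub>R u" using cell_self[of z] vu(2) by auto
    note b = vbound(2)[OF vu(1), of k] vbound(2)[OF vu(1), of j]
    show ?thesis
      using vu(3)
    proof (elim disjE exE conjE)
      fix s :: real assume "s > 0" "u = s *\<^sub>R vec 1"
      then have "z $ k = v $ k + t * s" "z $ j = v $ j + t * s" by (simp_all add: t(2))
      then show ?thesis using b by (simp add: R_def)
    next
      fix s l assume s: "(s::real) > 0" "u = - s *\<^sub>R axis l 1"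
      then have "z $ k \<le> v $ k" using t(1) by (simp add: t(2) axis_def)
      then show ?thesis using b by (simp add: R_def)
    qed
  qed
  have mu_simps: "mu 0 = 0" "mu (axis j 1) = - c" "k \<noteq> j \<Longrightarrow> mu (axis k 1) = - R" for k
    by (auto simp: mu_def axis_eq_axis)
  have le_iff: "(\<forall>b\<in>H. mu b + b \<bullet> z \<le> y) \<longleftrightarrow> 0 \<le> y \<and> z $ j - c \<le> y"
    if z: "z \<in> Cur" and y: "max 0 (z $ j - c) \<le> y \<or> y \<le> max 0 (z $ j - c)" for z y
  proof
    assume *: "\<forall>b\<in>H. mu b + b \<bullet> z \<le> y"
    have "mu 0 + 0 \<bullet> z \<le> y" "mu (axis j 1) + axis j 1 \<bullet> z \<le> y" using * by (auto simp: H_def)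
    then show "0 \<le> y \<and> z $ j - c \<le> y" by (simp add: mu_simps inner_axis')
  next
    assume y: "0 \<le> y \<and> z $ j - c \<le> y"
    have "mu (axis k 1) + axis k 1 \<bullet> z \<le> y" for k
      using far[OF z, of k] y by (cases "k = j") (auto simp: mu_simps inner_axis')
    then show "\<forall>b\<in>H. mu b + b \<bullet> z \<le> y" using y by (auto simp: H_def mu_simps)
  qed
  have act_H: "active H mu z = (if z $ j < c then {0} else if z $ j > c then {axis j 1} else {0, axis j 1})"
    if z: "z \<in> Cur" for z
  proof -
    have 0: "0 \<in> active H mu z \<longleftrightarrow> z $ j \<le> c"
      using le_iff[OF z, of 0] by (auto simp: active_iff[OF finH(1)] mu_simps memH)
    have j: "axis j 1 \<in> active H mu z \<longleftrightarrow> z $ j \<ge> c"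
      using le_iff[OF z, of "z $ j - c"] by (auto simp: active_iff[OF finH(1)] mu_simps memH inner_axis')
    have k: "axis k 1 \<notin> active H mu z" if "k \<noteq> j" for k
    proof
      assume "axis k 1 \<in> active H mu z"
      then have "\<forall>b\<in>H. mu b + b \<bullet> z \<le> z $ k - R"
        using that by (auto simp: active_iff[OF finH(1)] mu_simps inner_axis')
      moreover have "z $ k - R \<le> max 0 (z $ j - c)" using far[OF z, of k] by simp
      ultimately have "0 \<le> z $ k - R \<and> z $ j - c \<le> z $ k - R" using le_iff[OF z] by blast
      then show False using far[OF z, of k] by auto
    qed
    have "active H mu z \<subseteq> {0, axis j 1}"
    proof
      fix a assume a: "a \<in> active H mu z"
      then have "a \<in> H" using active_subset by blast
      then consider "a = 0" | l where "a = axis l 1" by (auto simp: H_def)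
      then show "a \<in> {0, axis j 1}"
      proof cases
        case 2
        then show ?thesis using a k[of l] by (cases "l = j") auto
      qed simp
    qed
    then show ?thesis using 0 j by auto
  qed
  have inter: "inter_hyp {..<Suc n} A' lam' = ?Z"
  proof -
    have "Vtr (A' i) (lam' i) = Vtr (A i) (lam i)" if "i < n" for i
      using that by (simp add: A'_def lam'_def)
    then have "inter_hyp {..<Suc n} A' lam' = Cur \<inter> Vtr H mu"
      by (auto simp: inter_hyp_def curve_def lessThan_Suc A'_def lam'_def)
    moreover have "z \<in> Vtr H mu \<longleftrightarrow> z $ j = c" if "z \<in> Cur" for z
      unfolding Vtr_def using act_H[OF that] by (auto simp: axis_eq_0_iff)
    ultimately show ?thesis by blast
  qed
  have "edge_pt z \<and> \<not> bounded (cell z)" if z: "z \<in> ?Z" for z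
  proof (rule curve_pt_cases)
    show "z \<in> Cur" using z by simp
    assume "\<And>k. \<bar>z $ k\<bar> < vbound"
    from this[of j] show ?thesis using z c by simp
  qed simp
  then have Z_edge: "edge_pt z" "\<not> bounded (cell z)" if "z \<in> ?Z" for z
    using that by blast+
  have card2: "card (act' i z) = 2" if "z \<in> ?Z" "i < Suc n" for z i
  proof (cases "i = n")
    case True
    have "act' n z = {0, axis j 1}" using that act_H[of z] act'_n[of z] by auto
    then show ?thesis using True by (simp add: card_2_iff axis_eq_0_iff)
  next
    case False
    then show ?thesis using that Z_edge(1)[OF that(1)] by (simp add: act'_less edge_pt_def)
  qed
  have small: "mink_vol S (\<lambda>i. act' i z) = 0" if z: "z \<in> ?Z" and S: "S \<subset> {..<Suc n}" for z S
  proof (rule mink_vol_eq_0)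
    show fin: "finite S" using S finite_subset by blast
    have two: "card (act' i z) = 2" if "i \<in> S" for i using card2[OF z] S that by auto
    then show "finite (act' i z) \<and> act' i z \<noteq> {}" if "i \<in> S" for i
      using that by (metis card.empty card.infinite zero_neq_numeral)
    have "card S < card {..<Suc n}" using S by (intro psubset_card_mono) auto
    then show "(\<Sum>i\<in>S. card (act' i z) - 1) < CARD('m)" using two card_m by simp
  qed
  have full: "mink_vol {..<Suc n} (\<lambda>i. act' i z) = 1" if z: "z \<in> ?Z" for z
  proof -
    have "\<exists>a b. act i z = {a, b}" if "i < n" for i
    proof -
      have "card (act i z) = 2" using Z_edge(1)[OF z] that by (simp add: edge_pt_def)
      then show ?thesis by (auto simp: card_2_iff)
    qed
    then obtain p q where pq: "\<And>i. i < n \<Longrightarrow> act i z = {p i, q i}" by metis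
    let ?p = "p(n := axis j 1)" and ?q = "q(n := 0)"
    have act'_eq: "act' i z = {?p i, ?q i}" if "i < Suc n" for i
    proof (cases "i = n")
      case True
      then show ?thesis using z act_H[of z] act'_n[of z] by auto
    next
      case False
      then show ?thesis using that pq by (simp add: act'_less)
    qed
    have "tprodA {..<Suc n} (\<lambda>i. act' i z) = tprodA {..<Suc n} (\<lambda>i. {?p i, ?q i})"
      unfolding tprodA_def using act'_eq by simp
    then have "mink_vol {..<Suc n} (\<lambda>i. act' i z) = \<bar>vdet (\<lambda>i. ?p i - ?q i)\<bar>"
      using mink_vol_segments[of ?p ?q] by (simp add: mink_vol_def card_m)
    also have "(\<lambda>i. ?p i - ?q i) = (\<lambda>i. p i - q i)(n := axis j 1)" by auto
    also have "\<bar>vdet \<dots>\<bar> = 1"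
    proof -
      obtain v u where vu: "v \<in> Ver" "v \<in> closure (cell z)" "u \<noteq> 0" "cell z = {v + t *\<^sub>R u | t. t > 0}"
        "{w. \<forall>e\<in>dif z. e \<bullet> w = 0} = span {u}"
        "(\<exists>s>0. u = s *\<^sub>R vec 1) \<or> (\<exists>s>0. \<exists>k. u = - s *\<^sub>R axis k 1)"
        by (rule unbounded_edge_cases[OF Z_edge[OF z]])
      obtain t where t: "z = v + t *\<^sub>R u" using cell_self[of z] vu(4) by auto
      \<comment> \<open>Otherwise the end vertex itself would satisfy x_j = c, outside the cube of
        vertices.\<close>
      have "u $ j \<noteq> 0"
      proof
        assume "u $ j = 0"
        then have "v $ j = c" using z t by simp
        then show False using vbound(2)[OF vu(1), of j] c by simp
      qed
      then show ?thesis by (intro unbounded_edge_unimodular[OF Z_edge[OF z] vu(5) _ vu(6)] pq)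
    qed
    finally show ?thesis .
  qed
  have A'_ok: "finite (A' i) \<and> A' i \<noteq> {}" if "i \<in> {..<Suc n}" for i
    using that finH A_fin A_ne by (auto simp: A'_def less_Suc_eq)
  have Zset: "{x \<in> inter_hyp {..<Suc n} A' lam'. mink_vol {..<Suc n} (\<lambda>i. active (A' i) (lam' i) x) \<noteq> 0} = ?Z"
    using full unfolding inter act'_def by auto
  have small': "mink_vol S (\<lambda>i. active (A' i) (lam' i) x) = 0"
    if "x \<in> inter_hyp {..<Suc n} A' lam'" "S \<subset> {..<Suc n}" for x S
    using small[of x S] that unfolding inter act'_def by blast
  note mixed = mixed_volume_eq_sum[of "{..<Suc n}" A' lam', OF finite_lessThan A'_ok small', unfolded Zset]
  show "finite ?Z" by (rule mixed(1))
  have hull: "convex hull (A' i) = std_simplex (d' i)" if "i < Suc n" for i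
    using that hull_A by (auto simp: A'_def d'_def H_def std_simplex_def less_Suc_eq)
  have "real (card ?Z) = (\<Sum>x\<in>?Z. mink_vol {..<Suc n} (\<lambda>i. act' i x))"
    using full by simp
  also have "\<dots> = (\<Sum>S\<in>Pow {..<Suc n}. (-1) ^ card ({..<Suc n} - S) * mink_vol S A')"
    using mixed(2) unfolding act'_def by simp
  also have "\<dots> = (\<Sum>S\<in>Pow {..<Suc n}. (-1) ^ card ({..<Suc n} - S) * (\<Sum>i\<in>S. real (d' i)) ^ Suc n) / fact (Suc n)"
    unfolding sum_divide_distrib
  proof (rule sum.cong[OF refl])
    fix S assume S: "S \<in> Pow {..<Suc n}"
    then have "mink_vol S A' = real (sum d' S) ^ CARD('m) / fact CARD('m)"
      by (intro mink_vol_std_simplex hull) (auto intro: finite_subset)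
    then show "(-1) ^ card ({..<Suc n} - S) * mink_vol S A' =
        (-1) ^ card ({..<Suc n} - S) * (\<Sum>i\<in>S. real (d' i)) ^ Suc n / fact (Suc n)"
      by (simp add: card_m)
  qed
  \<comment> \<open>The enlarged family has \<open>n + 1\<close> members, as many as the exponent,
    and the new degree 1 does not change the product.\<close>
  also have "\<dots> = (\<Prod>i<Suc n. real (d' i))"
    using polarization_all(2)[of "{..<Suc n}" "\<lambda>i. real (d' i)"] by (simp only: card_lessThan finite_lessThan) simp
  also have "\<dots> = (\<Prod>i<n. real (d i))" by (simp add: d'_def)
  finally show "card ?Z = (\<Prod>i<n. d i)" by (simp flip: of_nat_prod)
qed

section \<open>Sorting the unbounded edges by direction\<close>

lemma far_point:
  assumes z: "z \<in> Cur" and j: "\<bar>z $ j\<bar> = vbound"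
  obtains v u t where "edge_pt z" "\<not> bounded (cell z)" "v \<in> Ver" "t > 0" "z = v + t *\<^sub>R u"
    "cell z = {v + t *\<^sub>R u | t. t > 0}" "u $ j \<noteq> 0" "z $ j > 0 \<longleftrightarrow> u $ j > 0"
    "(\<exists>s>0. u = s *\<^sub>R vec 1) \<or> (\<exists>s>0. \<exists>k. u = - s *\<^sub>R axis k 1)"
proof -
  have "edge_pt z \<and> \<not> bounded (cell z)"
  proof (rule curve_pt_cases[OF z])
    assume "\<And>k. \<bar>z $ k\<bar> < vbound"
    from this[of j] show ?thesis using j by simp
  qed simp
  then have zz: "edge_pt z" "\<not> bounded (cell z)" by auto
  obtain v u where vu: "v \<in> Ver" "v \<in> closure (cell z)" "u \<noteq> 0" "cell z = {v + t *\<^sub>R u | t. t > 0}"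
    "{w. \<forall>e\<in>dif z. e \<bullet> w = 0} = span {u}"
    "(\<exists>s>0. u = s *\<^sub>R vec 1) \<or> (\<exists>s>0. \<exists>k. u = - s *\<^sub>R axis k 1)"
    by (rule unbounded_edge_cases[OF zz])
  obtain t where t: "t > 0" "z = v + t *\<^sub>R u" using cell_self[of z] vu(4) by auto
  have zj: "z $ j = v $ j + t * u $ j" by (simp add: t(2))
  have b: "\<bar>v $ j\<bar> < vbound" by (rule vbound(2)[OF vu(1)])
  have "u $ j \<noteq> 0" using zj b j by auto
  moreover have "z $ j > 0 \<longleftrightarrow> u $ j > 0"
  proof
    assume "z $ j > 0"
    then have "t * u $ j > 0" using zj b j by linarith
    then show "u $ j > 0" using t(1) by (simp add: zero_less_mult_iff)
  next
    assume "u $ j > 0"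
    then have "t * u $ j > 0" using t(1) by simp
    then show "z $ j > 0" using zj b j by linarith
  qed
  ultimately show ?thesis using that zz vu t by blast
qed

text \<open>The number \<open>c\<close> has the sign of \<open>u $ j\<close> and exceeds the
  coordinates of the end vertex in absolute value, so the parameter that solves x_j = c is
  positive.\<close>

lemma ray_meets_hyperplane:
  assumes x: "edge_pt x" and v: "v \<in> Ver" and e: "cell x = {v + t *\<^sub>R u | t. t > 0}"
    and u: "\<bar>c\<bar> = vbound" "c * u $ j > 0"
  shows "cell x \<in> cell ` {z \<in> Cur. z $ j = c}"
proof -
  define t where "t = (c - v $ j) / u $ j"
  have b: "\<bar>v $ j\<bar> < vbound" by (rule vbound(2)[OF v])
  have "u $ j \<noteq> 0" using u by auto
  have "t > 0"
  proof (cases "c > 0")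
    case True
    then have "u $ j > 0" "c - v $ j > 0" using u b by (auto simp: zero_less_mult_iff)
    then show ?thesis by (simp add: t_def)
  next
    case False
    then have "u $ j < 0" "c - v $ j < 0" using u b by (auto simp: zero_less_mult_iff)
    then show ?thesis by (simp add: t_def divide_neg_neg)
  qed
  then have in_cell: "v + t *\<^sub>R u \<in> cell x" unfolding e by blast
  then have "v + t *\<^sub>R u \<in> Cur" using x edge_pt_cell edge_pt_in_curve by blast
  moreover have "(v + t *\<^sub>R u) $ j = c" using \<open>u $ j \<noteq> 0\<close> by (simp add: t_def)
  ultimately show ?thesis using cell_eqI[OF in_cell] by blast
qed

text \<open>A ray that reaches the hyperplane has \<open>u $ j \<noteq> 0\<close> and meets it only
  once, so crossing points and crossed edges are equally many.\<close>

lemma card_cells_crossing: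
  assumes c: "\<bar>c\<bar> = vbound"
  shows "card (cell ` {z \<in> Cur. z $ j = c}) = (\<Prod>i<n. d i)"
proof -
  have "inj_on cell {z \<in> Cur. z $ j = c}"
  proof (rule inj_onI)
    fix z z' assume z: "z \<in> {z \<in> Cur. z $ j = c}" "z' \<in> {z \<in> Cur. z $ j = c}" "cell z = cell z'"
    then have zC: "z \<in> Cur" "\<bar>z $ j\<bar> = vbound" using c by auto
    obtain v u t where vu: "z = v + t *\<^sub>R u" "cell z = {v + t *\<^sub>R u | t. t > 0}" "u $ j \<noteq> 0"
      by (rule far_point[OF zC])
    obtain t' where "z' = v + t' *\<^sub>R u" using cell_self[of z'] z(3) vu(2) by auto
    moreover have "z $ j = z' $ j" using z by simp
    ultimately show "z = z'" using vu by simp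
  qed
  then have "card (cell ` {z \<in> Cur. z $ j = c}) = card {z \<in> Cur. z $ j = c}" by (rule card_image)
  then show ?thesis using crossing_count(2)[of c j] c by simp
qed

text \<open>Beyond the vertices, x_j = \<open>vbound\<close> is crossed by exactly the edges of
  direction (1, ..., 1), and x_j = \<open>- vbound\<close> by exactly those of direction - e_j. One
  set of the first kind and \<open>n + 1\<close> of the second partition the unbounded
  edges.\<close>

lemma unbounded_edges_count:
  "card {e \<in> edges. \<not> bounded e} = (n + 2) * (\<Prod>i<n. d i)"
proof -
  define Zp where "Zp j = cell ` {z \<in> Cur. z $ j = vbound}" for j
  define Zm where "Zm j = cell ` {z \<in> Cur. z $ j = - vbound}" for j
  \<comment> \<open>Any coordinate will do, since an edge in direction (1, ..., 1) crosses all the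
    hyperplanes x_j = \<open>vbound\<close>.\<close>
  fix j0 :: 'm
  have c: "\<bar>vbound\<bar> = vbound" "\<bar>- vbound\<bar> = vbound" using vbound(1) by auto
  have dirs: "u $ k > 0 \<Longrightarrow> \<not> u $ l < 0" "u $ k < 0 \<Longrightarrow> u $ l < 0 \<Longrightarrow> k = l"
    if "(\<exists>s>0. u = s *\<^sub>R vec 1) \<or> (\<exists>s>0. \<exists>k. u = - s *\<^sub>R axis k 1)" for u :: "real^'m" and k l
    using that by (auto simp: axis_def split: if_splits)
  have sign: "z $ j > 0 \<longleftrightarrow> u $ j > 0" "u $ j \<noteq> 0"
    if z: "z \<in> Cur" "\<bar>z $ j\<bar> = vbound" and e: "v \<in> Ver" "cell z = {v + t *\<^sub>R u | t. t > 0}" for z j v and u :: "real^'m"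
  proof -
    obtain t where t: "t > 0" "z = v + t *\<^sub>R u" using cell_self[of z] e(2) by auto
    have zj: "z $ j = v $ j + t * u $ j" by (simp add: t(2))
    have b: "\<bar>v $ j\<bar> < vbound" by (rule vbound(2)[OF e(1)])
    show "u $ j \<noteq> 0" using zj b z by auto
    have "z $ j > 0 \<longleftrightarrow> t * u $ j > 0" using zj b z(2) by linarith
    then show "z $ j > 0 \<longleftrightarrow> u $ j > 0" using t(1) by (simp add: zero_less_mult_iff)
  qed
  have eq: "{e \<in> edges. \<not> bounded e} = Zp j0 \<union> (\<Union>j\<in>UNIV. Zm j)"
  proof (intro set_eqI iffI)
    fix e assume "e \<in> {e \<in> edges. \<not> bounded e}"
    then obtain x where x: "edge_pt x" "\<not> bounded (cell x)" "e = cell x" by (auto simp: edges_def)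
    obtain v u where vu: "v \<in> Ver" "v \<in> closure (cell x)" "u \<noteq> 0" "cell x = {v + t *\<^sub>R u | t. t > 0}"
      "{w. \<forall>e\<in>dif x. e \<bullet> w = 0} = span {u}"
      "(\<exists>s>0. u = s *\<^sub>R vec 1) \<or> (\<exists>s>0. \<exists>k. u = - s *\<^sub>R axis k 1)"
      by (rule unbounded_edge_cases[OF x(1,2)])
    from vu(6) show "e \<in> Zp j0 \<union> (\<Union>j\<in>UNIV. Zm j)"
    proof (elim disjE exE conjE)
      fix s :: real assume "s > 0" "u = s *\<^sub>R vec 1"
      then have "vbound * u $ j0 > 0" using vbound(1) by simp
      then have "e \<in> Zp j0"
        unfolding Zp_def x(3) by (rule ray_meets_hyperplane[OF x(1) vu(1,4) c(1)])
      then show ?thesis by blast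
    next
      fix s k assume "(s::real) > 0" "u = - s *\<^sub>R axis k 1"
      then have "- vbound * u $ k > 0" using vbound(1) by (simp add: axis_def)
      then have "e \<in> Zm k"
        unfolding Zm_def x(3) by (rule ray_meets_hyperplane[OF x(1) vu(1,4) c(2)])
      then show ?thesis by blast
    qed
  next
    fix e assume "e \<in> Zp j0 \<union> (\<Union>j\<in>UNIV. Zm j)"
    then obtain z j where z: "z \<in> Cur" "\<bar>z $ j\<bar> = vbound" "e = cell z"
    proof (cases "e \<in> Zp j0")
      case True
      then obtain y where "y \<in> Cur" "y $ j0 = vbound" "e = cell y" unfolding Zp_def by blast
      then show ?thesis using that[of y j0] c by simp
    next
      case False
      then obtain j where "e \<in> Zm j" using \<open>e \<in> Zp j0 \<union> (\<Union>j\<in>UNIV. Zm j)\<close> by blast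
      then obtain y where "y \<in> Cur" "y $ j = - vbound" "e = cell y" unfolding Zm_def by blast
      then show ?thesis using that[of y j] c by simp
    qed
    have "edge_pt z" "\<not> bounded (cell z)" by (rule far_point[OF z(1,2)], assumption)+
    then show "e \<in> {e \<in> edges. \<not> bounded e}" using z(3) by (auto simp: edges_def)
  qed
  have disj: "Zp k \<inter> Zm l = {}" for k l
  proof (rule ccontr)
    assume "Zp k \<inter> Zm l \<noteq> {}"
    then obtain z z' where z: "z \<in> Cur" "z $ k = vbound" and z': "z' \<in> Cur" "z' $ l = - vbound"
      and eq: "cell z = cell z'" by (auto simp: Zp_def Zm_def)
    have zk: "\<bar>z $ k\<bar> = vbound" using z c by simp
    have zz: "edge_pt z" "\<not> bounded (cell z)" by (rule far_point[OF z(1) zk], assumption)+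
    obtain v u where vu: "v \<in> Ver" "cell z = {v + t *\<^sub>R u | t. t > 0}"
      "(\<exists>s>0. u = s *\<^sub>R vec 1) \<or> (\<exists>s>0. \<exists>k. u = - s *\<^sub>R axis k 1)"
      by (rule unbounded_edge_cases[OF zz])
    have "u $ k > 0" using sign(1)[of z k v u] z c vu vbound(1) by simp
    moreover have "u $ l < 0" using sign[of z' l v u] z' c vu vbound(1) eq by auto
    ultimately show False using dirs(1)[OF vu(3)] by blast
  qed
  have disj': "Zm k \<inter> Zm l = {}" if "k \<noteq> l" for k l
  proof (rule ccontr)
    assume "Zm k \<inter> Zm l \<noteq> {}"
    then obtain z z' where z: "z \<in> Cur" "z $ k = - vbound" and z': "z' \<in> Cur" "z' $ l = - vbound"
      and eq: "cell z = cell z'" by (auto simp: Zm_def)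
    have zk: "\<bar>z $ k\<bar> = vbound" using z c by simp
    have zz: "edge_pt z" "\<not> bounded (cell z)" by (rule far_point[OF z(1) zk], assumption)+
    obtain v u where vu: "v \<in> Ver" "cell z = {v + t *\<^sub>R u | t. t > 0}"
      "(\<exists>s>0. u = s *\<^sub>R vec 1) \<or> (\<exists>s>0. \<exists>k. u = - s *\<^sub>R axis k 1)"
      by (rule unbounded_edge_cases[OF zz])
    have "u $ k < 0" using sign[of z k v u] z c vu vbound(1) by auto
    moreover have "u $ l < 0" using sign[of z' l v u] z' c vu vbound(1) eq by auto
    ultimately show False using dirs(2)[OF vu(3)] that by blast
  qed
  have fin: "finite (Zp k)" "finite (Zm k)" for k
    unfolding Zp_def Zm_def using crossing_count(1) c by auto
  have "card (\<Union>j\<in>UNIV. Zm j) = (\<Sum>j\<in>(UNIV::'m set). card (Zm j))"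
    using fin disj' by (intro card_UN_disjoint) auto
  also have "\<dots> = (n + 1) * (\<Prod>i<n. d i)"
    unfolding Zm_def using card_cells_crossing[OF c(2)] card_m by simp
  finally have "card (\<Union>j\<in>UNIV. Zm j) = (n + 1) * (\<Prod>i<n. d i)" .
  moreover have "card (Zp j0) = (\<Prod>i<n. d i)"
    unfolding Zp_def by (rule card_cells_crossing[OF c(1)])
  moreover have "card (Zp j0 \<union> (\<Union>j\<in>UNIV. Zm j)) = card (Zp j0) + card (\<Union>j\<in>UNIV. Zm j)"
  proof (rule card_Un_disjoint)
    show "Zp j0 \<inter> (\<Union>j\<in>UNIV. Zm j) = {}" using disj by blast
  qed (use fin in auto)
  ultimately show "card {e \<in> edges. \<not> bounded e} = (n + 2) * (\<Prod>i<n. d i)"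
    unfolding eq by simp
qed

end

theorem theorem3p8:
  fixes A :: "nat \<Rightarrow> (real^'m) set" and lam :: "nat \<Rightarrow> real^'m \<Rightarrow> real"
    and d :: "nat \<Rightarrow> nat" and n :: nat
  assumes "n \<ge> 2"
    and "CARD('m) = n + 1"
    and "\<forall>i<n. smooth_hyp (A i) (lam i) (d i)"
    and "transversal n A lam"
    and "smooth_curve n A lam"
    and "connected (curve n A lam)"
  shows "2 * genus n A lam - 2 = (\<Prod>i<n. int (d i)) * (int (\<Sum>i<n. d i) - int (n + 2))"
proof -
  interpret tropical_curve A lam d n
    using assms by unfold_locales auto
  show ?thesis
    unfolding genus_formula[OF assms(6)] card_vertices unbounded_edges_count
    by (simp add: algebra_simps)
qed

end
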